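(* Let $1\to I\to A\xrightarrow{\pi}Q\to1$ be an extension of multiplicative Lie algebras which realizes the action terms $\chi$, and let $T$ be the 2-cocycle of $A$ determined by a section $l$ with $\chi^{l}=\chi$. Then there is an exact sequence $$1\longrightarrow \mathrm{Der}(Q,\zeta(I),\chi_{\zeta})\xrightarrow{\ i\ }\mathrm{Aut}_I A\xrightarrow{\ \psi\ }C(Q,I,\chi)\xrightarrow{\ W_T\ }H^{2}(Q,\zeta(I),\chi_{\zeta}),$$ where $i$ and $\psi$ are group homomorphisms and $W_T$ is the Wells map; exactness at $C(Q,I,\chi)$ means that the image of $\psi$ is $\{(\omega,\kappa): W_T(\omega,\kappa)=0\}$.
   Context: A multiplicative Lie algebra is a group $\langle A,\cdot,1\rangle$ with a binary operation $\{\,,\}$ such that, with $x^{z}:=zxz^{-1}$, for all $x,y,z$: $\{x,x\}=1$; $\{x,yz\}=\{x,y\}\{x,z\}^{y}$; $\{xy,z\}=\{y,z\}^{x}\{x,z\}$; $\{\{x,y\},z^{y}\}\{\{y,z\},x^{z}\}\{\{z,x\},y^{x}\}=1$; $\{x,y\}^{z}=\{x^{z},y^{z}\}$. An extension of $I$ by $Q$ is an exact sequence $1\to I\to A\xrightarrow{\pi}Q\to1$ of multiplicative Lie algebras ($I$ is identified with its image). Two extensions are equivalent if there is an isomorphism between the middle terms inducing the identity on $I$ and on $Q$. A section is a map $l:Q\to A$ with $\pi l=\mathrm{id}$, $l(1)=1$. The algebraic center is $\zeta(I)=\{a\in I: ab=ba,\ \{a,b\}=\{b,a\}=1\ \forall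 b\in I\}$ (written additively when convenient). Action terms for $(Q,I)$: $\chi=\{\sigma,\tau,\nu\}$ with $\sigma:Q\to\mathrm{Aut}\,I$, $\tau:Q\times I\to I$, $\nu:I\times Q\to I$, $\tau_x(1)=\nu_x(1)=1$. A section $l$ determines action terms $\chi^{l}$: $\sigma_x(a)=l(x)al(x)^{-1}$, $\tau_x(a)=\{l(x),a\}$, $\nu_x(a)=\{a,l(x)\}$, and a 2-cocycle $T=\{T,T_f,\sigma,\tau,\nu\}$ with $T(x,y)=l(x)l(y)l(xy)^{-1}$, $T_f(x,y)=\{l(x),l(y)\}l(\{x,y\})^{-1}$. The extension realizes $\chi$ if $\chi=\chi^{l}$ for some section $l$. For such data, $I\rtimes_T Q$ is the set $I\times Q$ with $\langle a,x\rangle\langle b,y\rangle=\langle a\,\sigma_x(b)\,T(x,y),xy\rangle$ and $\{\langle a,x\rangle,\langle b,y\rangle\}=\langle \tau_x(b)^{a}\{a,b\}\,ba\,T_f(x,y)\,\sigma_{\{x,y\}}(a^{-1}\nu_y(a)b^{-1}),\{x,y\}\rangle$; $A\cong I\rtimes_T Q$ via $a\,l(x)\leftrightarrow\langle a,x\rangle$, and it is an extension via $a\mapsto\langle a,1\rangle$, $\langle a,x\rangle\mapsto x$. Action terms satisfy $\chi\sim\chi'$ if there is $h:Q\to I$ with $\sigma_x(a)=h(x)\sigma'_x(a)h(x)^{-1}$, $\tau_x(a)=\tau'_x(a)^{h(x)}\{h(x),a\}$, $\nu_x(a)=\{a,h(x)\}\nu'_x(a)^{h(x)}$ for all $x,a$;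 $[\chi]$ is the class. $\zeta(I)$ is closed under realized action terms $\chi$; $\chi_\zeta=\chi_{\zeta(I)}$ is the restriction to $\zeta(I)$, which depends only on $[\chi]$. $\mathrm{Aut}_I A=\{\phi\in\mathrm{Aut}\,A:\phi(I)=I\}$. For $(\omega,\kappa)\in\mathrm{Aut}\,I\times\mathrm{Aut}\,Q$ let $\chi^{(\omega,\kappa)}$ have components $\sigma^{(\omega,\kappa)}_x=\omega\sigma_{\kappa^{-1}(x)}\omega^{-1}$, $\tau^{(\omega,\kappa)}_x=\omega\tau_{\kappa^{-1}(x)}\omega^{-1}$, $\nu^{(\omega,\kappa)}_x=\omega\nu_{\kappa^{-1}(x)}\omega^{-1}$, and let $T^{(\omega,\kappa)}$ be the 2-cocycle with action terms $\chi^{(\omega,\kappa)}$ and $T^{(\omega,\kappa)}(x,y)=\omega(T(\kappa^{-1}(x),\kappa^{-1}(y)))$, $T_f^{(\omega,\kappa)}(x,y)=\omega(T_f(\kappa^{-1}(x),\kappa^{-1}(y)))$. The group of compatible automorphisms is $C(Q,I,\chi)=\{(\omega,\kappa)\in\mathrm{Aut}\,I\times\mathrm{Aut}\,Q:[\chi]=[\chi^{(\omega,\kappa)}]\}$. Abelian (co)homological notions for an abelian multiplicative Lie algebra $B$ (commutative group written additively, trivial bracket) with action terms $\chi$ for $(Q,B)$. $\mathrm{Der}(Q,B,\chi)$ is the group under pointwise addition of maps $d:Q\to B$ with $d(xy)=d(x)+\sigma_x(d(y))$ and $d(\{x,y\})=\tau_x(d(y))+d(x)+d(y)+\sigma_{\{x,y\}}(\nu_y(d(x))-d(x)-d(y))$.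 A compatible 2-cocycle is a pair of maps $S,S_f:Q^2\to B$ with $S(x,1)=S(1,x)=0$, $S_f(x,x)=S_f(x,1)=S_f(1,x)=0$ such that $B\times Q$ with $\langle a,x\rangle\langle b,y\rangle=\langle a+\sigma_x(b)+S(x,y),xy\rangle$, $\{\langle a,x\rangle,\langle b,y\rangle\}=\langle a+b+\tau_x(b)+S_f(x,y)+\sigma_{\{x,y\}}(\nu_y(a)-a-b),\{x,y\}\rangle$ is a multiplicative Lie algebra. $H^{2}(Q,B,\chi)$ is the group (pointwise addition) of compatible 2-cocycles modulo 2-coboundaries, i.e. pairs $G(x,y)=h(x)+\sigma_x(h(y))-h(xy)$, $G_f(x,y)=\tau_x(h(y))+h(x)+h(y)+\sigma_{\{x,y\}}(\nu_y(h(x))-h(x)-h(y))-h(\{x,y\})$ for some $h:Q\to B$. $H^2(Q,\zeta(I),\chi_\zeta)$ acts simply transitively on the equivalence classes of extensions of $I$ by $Q$ realizing $[\chi]$ by $[I\rtimes_{R}Q]\cdot[S]=[I\rtimes_{R\ast S}Q]$, where $R\ast S$ has the same action terms as $R$, $(R\ast S)(x,y)=R(x,y)S(x,y)$ and $(R\ast S)_f(x,y)=R_f(x,y)S_f(x,y)$. Maps: $i(d)=\phi_d$ with $\phi_d(\langle a,x\rangle)=\langle a\,d(x),x\rangle$ (using $A\cong I\rtimes_TQ$). $\psi(\phi)=(\phi|_I,\phi_t)$, where $t:Q\to A$ is any section and $\phi_t(x)=\pi(\phi(t(x)))$. The Wells map $W_T(\omega,\kappa)$ is the unique element of $H^{2}(Q,\zeta(I),\chi_\zeta)$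 with $[I\rtimes_{T^{(\omega,\kappa)}}Q]\cdot W_T(\omega,\kappa)=[I\rtimes_T Q]$. *)

theory Defs
  imports "HOL-Algebra.Coset" "HOL-Algebra.Bij"
begin

section \<open>Multiplicative Lie algebras\<close>

record 'a mla = "'a monoid" +
  lie :: "'a \<Rightarrow> 'a \<Rightarrow> 'a"  (\<open>(\<lbrace>_,/ _\<rbrace>\<index>)\<close>)

text \<open>\<open>cj G z x\<close> is the left conjugate $x^z = z x z^{-1}$.\<close>

definition cj :: "('a, 'm) monoid_scheme \<Rightarrow> 'a \<Rightarrow> 'a \<Rightarrow> 'a" where
  "cj G z x = z \<otimes>\<^bsub>G\<^esub> x \<otimes>\<^bsub>G\<^esub> inv\<^bsub>G\<^esub> z"

locale mult_lie_algebra = group A for A :: "('a, 'm) mla_scheme" (structure) +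
  assumes lie_closed: "\<lbrakk>x \<in> carrier A; y \<in> carrier A\<rbrakk> \<Longrightarrow> \<lbrace>x, y\<rbrace> \<in> carrier A"
    and lie_self: "x \<in> carrier A \<Longrightarrow> \<lbrace>x, x\<rbrace> = \<one>"
    and lie_mult_right: "\<lbrakk>x \<in> carrier A; y \<in> carrier A; z \<in> carrier A\<rbrakk> \<Longrightarrow>
          \<lbrace>x, y \<otimes> z\<rbrace> = \<lbrace>x, y\<rbrace> \<otimes> cj A y \<lbrace>x, z\<rbrace>"
    and lie_mult_left: "\<lbrakk>x \<in> carrier A; y \<in> carrier A; z \<in> carrier A\<rbrakk> \<Longrightarrow>
          \<lbrace>x \<otimes> y, z\<rbrace> = cj A x \<lbrace>y, z\<rbrace> \<otimes> \<lbrace>x, z\<rbrace>"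
    and lie_jacobi: "\<lbrakk>x \<in> carrier A; y \<in> carrier A; z \<in> carrier A\<rbrakk> \<Longrightarrow>
          \<lbrace>\<lbrace>x, y\<rbrace>, cj A y z\<rbrace> \<otimes> \<lbrace>\<lbrace>y, z\<rbrace>, cj A z x\<rbrace> \<otimes> \<lbrace>\<lbrace>z, x\<rbrace>, cj A x y\<rbrace> = \<one>"
    and lie_conj: "\<lbrakk>x \<in> carrier A; y \<in> carrier A; z \<in> carrier A\<rbrakk> \<Longrightarrow>
          cj A z \<lbrace>x, y\<rbrace> = \<lbrace>cj A z x, cj A z y\<rbrace>"

definition mla_hom :: "('a, 'm) mla_scheme \<Rightarrow> ('b, 'n) mla_scheme \<Rightarrow> ('a \<Rightarrow> 'b) set" where
  "mla_hom A B = {f \<in> hom A B. \<forall>x \<in> carrier A. \<forall>y \<in> carrier A. f \<lbrace>x, y\<rbrace>\<^bsub>A\<^esub> = \<lbrace>f x, f y\<rbrace>\<^bsub>B\<^esub>}"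

text \<open>As for \<^const>\<open>AutoGroup\<close>, automorphisms are extensional functions.\<close>

definition mla_auto :: "('a, 'm) mla_scheme \<Rightarrow> ('a \<Rightarrow> 'a) set" where
  "mla_auto A = mla_hom A A \<inter> Bij (carrier A)"

definition mla_AutoGroup :: "('a, 'm) mla_scheme \<Rightarrow> ('a \<Rightarrow> 'a) monoid" where
  "mla_AutoGroup A = BijGroup (carrier A) \<lparr>carrier := mla_auto A\<rparr>"

definition alg_center :: "('a, 'm) mla_scheme \<Rightarrow> ('a, 'm) mla_scheme" where
  "alg_center I = I \<lparr>carrier :=
     {a \<in> carrier I. \<forall>b \<in> carrier I.
        a \<otimes>\<^bsub>I\<^esub> b = b \<otimes>\<^bsub>I\<^esub> a \<and> \<lbrace>a, b\<rbrace>\<^bsub>I\<^esub> = \<one>\<^bsub>I\<^esub> \<and> \<lbrace>b, a\<rbrace>\<^bsub>I\<^esub> = \<one>\<^bsub>I\<^esub>}\<rparr>"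


section \<open>Extensions\<close>

record ('i, 'a, 'q) mla_ext =
  mid :: "'a mla"
  incl :: "'i \<Rightarrow> 'a"
  proj :: "'a \<Rightarrow> 'q"

definition extension :: "'i mla \<Rightarrow> 'q mla \<Rightarrow> ('i, 'a, 'q) mla_ext \<Rightarrow> bool" where
  "extension I Q E \<longleftrightarrow>
     mult_lie_algebra I \<and> mult_lie_algebra (mid E) \<and> mult_lie_algebra Q \<and>
     incl E \<in> mla_hom I (mid E) \<and> inj_on (incl E) (carrier I) \<and>
     proj E \<in> mla_hom (mid E) Q \<and> proj E ` carrier (mid E) = carrier Q \<and>
     incl E ` carrier I = kernel (mid E) Q (proj E)"

definition ext_equiv ::
    "'i mla \<Rightarrow> ('i, 'a, 'q) mla_ext \<Rightarrow> ('i, 'b, 'q) mla_ext \<Rightarrow> bool" where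
  "ext_equiv I E E' \<longleftrightarrow>
     (\<exists>f. f \<in> mla_hom (mid E) (mid E') \<and> bij_betw f (carrier (mid E)) (carrier (mid E')) \<and>
          (\<forall>a \<in> carrier I. f (incl E a) = incl E' a) \<and>
          (\<forall>u \<in> carrier (mid E). proj E' (f u) = proj E u))"

definition ext_class ::
    "'i mla \<Rightarrow> 'q mla \<Rightarrow> ('i, 'a, 'q) mla_ext \<Rightarrow> ('i, 'a, 'q) mla_ext set" where
  "ext_class I Q E = {E'. extension I Q E' \<and> ext_equiv I E E'}"

definition is_section :: "'q mla \<Rightarrow> ('i, 'a, 'q) mla_ext \<Rightarrow> ('q \<Rightarrow> 'a) \<Rightarrow> bool" where
  "is_section Q E l \<longleftrightarrow>
     l \<in> carrier Q \<rightarrow> carrier (mid E) \<and> (\<forall>x \<in> carrier Q. proj E (l x) = x) \<and>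
     l \<one>\<^bsub>Q\<^esub> = \<one>\<^bsub>mid E\<^esub>"

definition incl_inv :: "'i mla \<Rightarrow> ('i, 'a, 'q) mla_ext \<Rightarrow> 'a \<Rightarrow> 'i" where
  "incl_inv I E = inv_into (carrier I) (incl E)"


section \<open>Action terms and 2-cocycles\<close>

text \<open>
  The component \<open>nu\<close> is curried with the argument from \<open>Q\<close> first: \<open>nu \<chi> x a\<close> is $\nu_x(a)$.
  All components are extensional on their domains, so that equality of action terms and of
  2-cocycles is equality of HOL values.
\<close>

record ('i, 'q) act_terms =
  sigma :: "'q \<Rightarrow> 'i \<Rightarrow> 'i"
  tau :: "'q \<Rightarrow> 'i \<Rightarrow> 'i"
  nu :: "'q \<Rightarrow> 'i \<Rightarrow> 'i"

record ('i, 'q) cocycle = "('i, 'q) act_terms" +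
  coc :: "'q \<times> 'q \<Rightarrow> 'i"
  coc_f :: "'q \<times> 'q \<Rightarrow> 'i"

definition action_terms :: "'i mla \<Rightarrow> 'q mla \<Rightarrow> ('i, 'q) act_terms \<Rightarrow> bool" where
  "action_terms I Q \<chi> \<longleftrightarrow>
     sigma \<chi> \<in> carrier Q \<rightarrow>\<^sub>E mla_auto I \<and>
     tau \<chi> \<in> carrier Q \<rightarrow>\<^sub>E (carrier I \<rightarrow>\<^sub>E carrier I) \<and>
     nu \<chi> \<in> carrier Q \<rightarrow>\<^sub>E (carrier I \<rightarrow>\<^sub>E carrier I) \<and>
     (\<forall>x \<in> carrier Q. tau \<chi> x \<one>\<^bsub>I\<^esub> = \<one>\<^bsub>I\<^esub> \<and> nu \<chi> x \<one>\<^bsub>I\<^esub> = \<one>\<^bsub>I\<^esub>)"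

definition section_action ::
    "'i mla \<Rightarrow> 'q mla \<Rightarrow> ('i, 'a, 'q) mla_ext \<Rightarrow> ('q \<Rightarrow> 'a) \<Rightarrow> ('i, 'q) act_terms" where
  "section_action I Q E l =
     \<lparr>sigma = (\<lambda>x \<in> carrier Q. \<lambda>a \<in> carrier I. incl_inv I E (cj (mid E) (l x) (incl E a))),
      tau = (\<lambda>x \<in> carrier Q. \<lambda>a \<in> carrier I. incl_inv I E \<lbrace>l x, incl E a\<rbrace>\<^bsub>mid E\<^esub>),
      nu = (\<lambda>x \<in> carrier Q. \<lambda>a \<in> carrier I. incl_inv I E \<lbrace>incl E a, l x\<rbrace>\<^bsub>mid E\<^esub>)\<rparr>"

definition section_cocycle ::
    "'i mla \<Rightarrow> 'q mla \<Rightarrow> ('i, 'a, 'q) mla_ext \<Rightarrow> ('q \<Rightarrow> 'a) \<Rightarrow> ('i, 'q) cocycle" where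
  "section_cocycle I Q E l =
     act_terms.extend (section_action I Q E l) (cocycle.fields
       (\<lambda>(x, y) \<in> carrier Q \<times> carrier Q.
          incl_inv I E (l x \<otimes>\<^bsub>mid E\<^esub> l y \<otimes>\<^bsub>mid E\<^esub> inv\<^bsub>mid E\<^esub> l (x \<otimes>\<^bsub>Q\<^esub> y)))
       (\<lambda>(x, y) \<in> carrier Q \<times> carrier Q.
          incl_inv I E (\<lbrace>l x, l y\<rbrace>\<^bsub>mid E\<^esub> \<otimes>\<^bsub>mid E\<^esub> inv\<^bsub>mid E\<^esub> l \<lbrace>x, y\<rbrace>\<^bsub>Q\<^esub>)))"

definition realizes ::
    "'i mla \<Rightarrow> 'q mla \<Rightarrow> ('i, 'a, 'q) mla_ext \<Rightarrow> ('i, 'q) act_terms \<Rightarrow> bool" where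
  "realizes I Q E \<chi> \<longleftrightarrow> (\<exists>l. is_section Q E l \<and> \<chi> = section_action I Q E l)"

definition cocycle_ext ::
    "'i mla \<Rightarrow> 'q mla \<Rightarrow> ('i, 'q) cocycle \<Rightarrow> ('i, 'i \<times> 'q, 'q) mla_ext" where
  "cocycle_ext I Q T =
     \<lparr>mid =
        \<lparr>carrier = carrier I \<times> carrier Q,
         mult = (\<lambda>(a, x) (b, y).
           (a \<otimes>\<^bsub>I\<^esub> sigma T x b \<otimes>\<^bsub>I\<^esub> coc T (x, y), x \<otimes>\<^bsub>Q\<^esub> y)),
         one = (\<one>\<^bsub>I\<^esub>, \<one>\<^bsub>Q\<^esub>),
         lie = (\<lambda>(a, x) (b, y).
           (cj I a (tau T x b) \<otimes>\<^bsub>I\<^esub> \<lbrace>a, b\<rbrace>\<^bsub>I\<^esub> \<otimes>\<^bsub>I\<^esub> b \<otimes>\<^bsub>I\<^esub> a \<otimes>\<^bsub>I\<^esub> coc_f T (x, y) \<otimes>\<^bsub>I\<^esub>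
              sigma T \<lbrace>x, y\<rbrace>\<^bsub>Q\<^esub> (inv\<^bsub>I\<^esub> a \<otimes>\<^bsub>I\<^esub> nu T y a \<otimes>\<^bsub>I\<^esub> inv\<^bsub>I\<^esub> b),
            \<lbrace>x, y\<rbrace>\<^bsub>Q\<^esub>))\<rparr>,
      incl = (\<lambda>a. (a, \<one>\<^bsub>Q\<^esub>)),
      proj = snd\<rparr>"

definition act_equiv ::
    "'i mla \<Rightarrow> 'q mla \<Rightarrow> ('i, 'q) act_terms \<Rightarrow> ('i, 'q) act_terms \<Rightarrow> bool" where
  "act_equiv I Q \<chi> \<chi>' \<longleftrightarrow>
     (\<exists>h \<in> carrier Q \<rightarrow> carrier I. \<forall>x \<in> carrier Q. \<forall>a \<in> carrier I.
        sigma \<chi> x a = cj I (h x) (sigma \<chi>' x a) \<and>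
        tau \<chi> x a = cj I (h x) (tau \<chi>' x a) \<otimes>\<^bsub>I\<^esub> \<lbrace>h x, a\<rbrace>\<^bsub>I\<^esub> \<and>
        nu \<chi> x a = \<lbrace>a, h x\<rbrace>\<^bsub>I\<^esub> \<otimes>\<^bsub>I\<^esub> cj I (h x) (nu \<chi>' x a))"

definition act_class ::
    "'i mla \<Rightarrow> 'q mla \<Rightarrow> ('i, 'q) act_terms \<Rightarrow> ('i, 'q) act_terms set" where
  "act_class I Q \<chi> = {\<chi>'. action_terms I Q \<chi>' \<and> act_equiv I Q \<chi> \<chi>'}"

definition act_restrict ::
    "'i mla \<Rightarrow> 'q mla \<Rightarrow> ('i, 'q) act_terms \<Rightarrow> ('i, 'q) act_terms" where
  "act_restrict B Q \<chi> =
     \<lparr>sigma = (\<lambda>x \<in> carrier Q. restrict (sigma \<chi> x) (carrier B)),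
      tau = (\<lambda>x \<in> carrier Q. restrict (tau \<chi> x) (carrier B)),
      nu = (\<lambda>x \<in> carrier Q. restrict (nu \<chi> x) (carrier B))\<rparr>"


section \<open>Automorphisms\<close>

definition Aut_I :: "'i mla \<Rightarrow> ('i, 'a, 'q) mla_ext \<Rightarrow> ('a \<Rightarrow> 'a) monoid" where
  "Aut_I I E = mla_AutoGroup (mid E)
     \<lparr>carrier := {\<phi> \<in> mla_auto (mid E). \<phi> ` incl E ` carrier I = incl E ` carrier I}\<rparr>"

definition twist ::
    "'i mla \<Rightarrow> 'q mla \<Rightarrow> ('i \<Rightarrow> 'i) \<Rightarrow> ('q \<Rightarrow> 'q) \<Rightarrow> ('q \<Rightarrow> 'i \<Rightarrow> 'i) \<Rightarrow> 'q \<Rightarrow> 'i \<Rightarrow> 'i" where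
  "twist I Q \<omega> \<kappa> f = (\<lambda>x \<in> carrier Q. \<lambda>a \<in> carrier I.
     \<omega> (f (inv_into (carrier Q) \<kappa> x) (inv_into (carrier I) \<omega> a)))"

definition act_twist :: "'i mla \<Rightarrow> 'q mla \<Rightarrow> ('i \<Rightarrow> 'i) \<times> ('q \<Rightarrow> 'q) \<Rightarrow>
    ('i, 'q) act_terms \<Rightarrow> ('i, 'q) act_terms" where
  "act_twist I Q = (\<lambda>(\<omega>, \<kappa>) \<chi>.
     \<lparr>sigma = twist I Q \<omega> \<kappa> (sigma \<chi>),
      tau = twist I Q \<omega> \<kappa> (tau \<chi>),
      nu = twist I Q \<omega> \<kappa> (nu \<chi>)\<rparr>)"

definition cocycle_twist :: "'i mla \<Rightarrow> 'q mla \<Rightarrow> ('i \<Rightarrow> 'i) \<times> ('q \<Rightarrow> 'q) \<Rightarrow>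
    ('i, 'q) cocycle \<Rightarrow> ('i, 'q) cocycle" where
  "cocycle_twist I Q = (\<lambda>(\<omega>, \<kappa>) T.
     act_terms.extend (act_twist I Q (\<omega>, \<kappa>) (act_terms.truncate T)) (cocycle.fields
       (\<lambda>(x, y) \<in> carrier Q \<times> carrier Q.
          \<omega> (coc T (inv_into (carrier Q) \<kappa> x, inv_into (carrier Q) \<kappa> y)))
       (\<lambda>(x, y) \<in> carrier Q \<times> carrier Q.
          \<omega> (coc_f T (inv_into (carrier Q) \<kappa> x, inv_into (carrier Q) \<kappa> y)))))"

definition compatible_autos ::
    "'i mla \<Rightarrow> 'q mla \<Rightarrow> ('i, 'q) act_terms \<Rightarrow> (('i \<Rightarrow> 'i) \<times> ('q \<Rightarrow> 'q)) monoid" where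
  "compatible_autos I Q \<chi> = (mla_AutoGroup I \<times>\<times> mla_AutoGroup Q)
     \<lparr>carrier := {p \<in> mla_auto I \<times> mla_auto Q.
        act_class I Q \<chi> = act_class I Q (act_twist I Q p \<chi>)}\<rparr>"


section \<open>Derivations and second cohomology with abelian coefficients\<close>

text \<open>
  The coefficient algebra \<open>B\<close> is written multiplicatively; the definitions are meant for \<open>B\<close>
  commutative with trivial bracket.  \<open>lie_term\<close> is the expression
  $\tau_x(b) + a + b + \sigma_{\{x,y\}}(\nu_y(a) - a - b)$ shared by the formulas below.
\<close>

definition lie_term ::
    "'i mla \<Rightarrow> 'q mla \<Rightarrow> ('i, 'q) act_terms \<Rightarrow> 'i \<Rightarrow> 'q \<Rightarrow> 'i \<Rightarrow> 'q \<Rightarrow> 'i" where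
  "lie_term B Q \<chi> a x b y =
     tau \<chi> x b \<otimes>\<^bsub>B\<^esub> a \<otimes>\<^bsub>B\<^esub> b \<otimes>\<^bsub>B\<^esub>
       sigma \<chi> \<lbrace>x, y\<rbrace>\<^bsub>Q\<^esub> (nu \<chi> y a \<otimes>\<^bsub>B\<^esub> inv\<^bsub>B\<^esub> a \<otimes>\<^bsub>B\<^esub> inv\<^bsub>B\<^esub> b)"

definition Der :: "'i mla \<Rightarrow> 'q mla \<Rightarrow> ('i, 'q) act_terms \<Rightarrow> ('q \<Rightarrow> 'i) monoid" where
  "Der B Q \<chi> =
     \<lparr>carrier = {d \<in> carrier Q \<rightarrow>\<^sub>E carrier B. \<forall>x \<in> carrier Q. \<forall>y \<in> carrier Q.
        d (x \<otimes>\<^bsub>Q\<^esub> y) = d x \<otimes>\<^bsub>B\<^esub> sigma \<chi> x (d y) \<and>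
        d \<lbrace>x, y\<rbrace>\<^bsub>Q\<^esub> = lie_term B Q \<chi> (d x) x (d y) y},
      mult = (\<lambda>d d'. \<lambda>x \<in> carrier Q. d x \<otimes>\<^bsub>B\<^esub> d' x),
      one = (\<lambda>x \<in> carrier Q. \<one>\<^bsub>B\<^esub>)\<rparr>"

definition abelian_twisted :: "'i mla \<Rightarrow> 'q mla \<Rightarrow> ('i, 'q) act_terms \<Rightarrow>
    ('q \<times> 'q \<Rightarrow> 'i) \<Rightarrow> ('q \<times> 'q \<Rightarrow> 'i) \<Rightarrow> ('i \<times> 'q) mla" where
  "abelian_twisted B Q \<chi> S S\<^sub>f =
     \<lparr>carrier = carrier B \<times> carrier Q,
      mult = (\<lambda>(a, x) (b, y). (a \<otimes>\<^bsub>B\<^esub> sigma \<chi> x b \<otimes>\<^bsub>B\<^esub> S (x, y), x \<otimes>\<^bsub>Q\<^esub> y)),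
      one = (\<one>\<^bsub>B\<^esub>, \<one>\<^bsub>Q\<^esub>),
      lie = (\<lambda>(a, x) (b, y). (lie_term B Q \<chi> a x b y \<otimes>\<^bsub>B\<^esub> S\<^sub>f (x, y), \<lbrace>x, y\<rbrace>\<^bsub>Q\<^esub>))\<rparr>"

definition Z2 :: "'i mla \<Rightarrow> 'q mla \<Rightarrow> ('i, 'q) act_terms \<Rightarrow>
    (('q \<times> 'q \<Rightarrow> 'i) \<times> ('q \<times> 'q \<Rightarrow> 'i)) monoid" where
  "Z2 B Q \<chi> =
     \<lparr>carrier = {(S, S\<^sub>f).
        S \<in> carrier Q \<times> carrier Q \<rightarrow>\<^sub>E carrier B \<and>
        S\<^sub>f \<in> carrier Q \<times> carrier Q \<rightarrow>\<^sub>E carrier B \<and>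
        (\<forall>x \<in> carrier Q. S (x, \<one>\<^bsub>Q\<^esub>) = \<one>\<^bsub>B\<^esub> \<and> S (\<one>\<^bsub>Q\<^esub>, x) = \<one>\<^bsub>B\<^esub> \<and>
           S\<^sub>f (x, x) = \<one>\<^bsub>B\<^esub> \<and> S\<^sub>f (x, \<one>\<^bsub>Q\<^esub>) = \<one>\<^bsub>B\<^esub> \<and> S\<^sub>f (\<one>\<^bsub>Q\<^esub>, x) = \<one>\<^bsub>B\<^esub>) \<and>
        mult_lie_algebra (abelian_twisted B Q \<chi> S S\<^sub>f)},
      mult = (\<lambda>(S, S\<^sub>f) (R, R\<^sub>f).
        (\<lambda>p \<in> carrier Q \<times> carrier Q. S p \<otimes>\<^bsub>B\<^esub> R p,
         \<lambda>p \<in> carrier Q \<times> carrier Q. S\<^sub>f p \<otimes>\<^bsub>B\<^esub> R\<^sub>f p)),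
      one = (\<lambda>p \<in> carrier Q \<times> carrier Q. \<one>\<^bsub>B\<^esub>, \<lambda>p \<in> carrier Q \<times> carrier Q. \<one>\<^bsub>B\<^esub>)\<rparr>"

text \<open>
  Coboundaries are taken inside the normalized cocycles.  Since $G(1,y) = h(1)$ when $\sigma_1$
  is the identity, this amounts to requiring $h(1) = 0$, without which the coboundaries would
  not form a subgroup of the compatible 2-cocycles.
\<close>

definition B2 :: "'i mla \<Rightarrow> 'q mla \<Rightarrow> ('i, 'q) act_terms \<Rightarrow>
    (('q \<times> 'q \<Rightarrow> 'i) \<times> ('q \<times> 'q \<Rightarrow> 'i)) set" where
  "B2 B Q \<chi> = {(G, G\<^sub>f) \<in> carrier (Z2 B Q \<chi>). \<exists>h \<in> carrier Q \<rightarrow> carrier B.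
     \<forall>x \<in> carrier Q. \<forall>y \<in> carrier Q.
       G (x, y) = h x \<otimes>\<^bsub>B\<^esub> sigma \<chi> x (h y) \<otimes>\<^bsub>B\<^esub> inv\<^bsub>B\<^esub> h (x \<otimes>\<^bsub>Q\<^esub> y) \<and>
       G\<^sub>f (x, y) = lie_term B Q \<chi> (h x) x (h y) y \<otimes>\<^bsub>B\<^esub> inv\<^bsub>B\<^esub> h \<lbrace>x, y\<rbrace>\<^bsub>Q\<^esub>}"

definition H2 :: "'i mla \<Rightarrow> 'q mla \<Rightarrow> ('i, 'q) act_terms \<Rightarrow>
    (('q \<times> 'q \<Rightarrow> 'i) \<times> ('q \<times> 'q \<Rightarrow> 'i)) set monoid" where
  "H2 B Q \<chi> = Z2 B Q \<chi> Mod B2 B Q \<chi>"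


section \<open>The action of cohomology on extension classes and the three maps\<close>

definition cocycle_shift :: "'i mla \<Rightarrow> 'q mla \<Rightarrow> ('i, 'q) cocycle \<Rightarrow>
    ('q \<times> 'q \<Rightarrow> 'i) \<times> ('q \<times> 'q \<Rightarrow> 'i) \<Rightarrow> ('i, 'q) cocycle" where
  "cocycle_shift I Q R = (\<lambda>(S, S\<^sub>f). R
     \<lparr>coc := (\<lambda>p \<in> carrier Q \<times> carrier Q. coc R p \<otimes>\<^bsub>I\<^esub> S p),
      coc_f := (\<lambda>p \<in> carrier Q \<times> carrier Q. coc_f R p \<otimes>\<^bsub>I\<^esub> S\<^sub>f p)\<rparr>)"

text \<open>
  A 2-cocycle is one determined by a section of some extension.  Taking the middle term on the
  type \<open>'i \<times> 'q\<close> is no restriction, because of the isomorphism of every extension with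
  some $I \rtimes_T Q$; the same applies to the equivalence classes of extensions below.
\<close>

definition two_cocycle :: "'i mla \<Rightarrow> 'q mla \<Rightarrow> ('i, 'q) cocycle \<Rightarrow> bool" where
  "two_cocycle I Q R \<longleftrightarrow> (\<exists>(E :: ('i, 'i \<times> 'q, 'q) mla_ext) l.
     extension I Q E \<and> is_section Q E l \<and> R = section_cocycle I Q E l)"

text \<open>
  $X \cdot u$ for a class \<open>X\<close> of extensions and a cohomology class \<open>u\<close>, as for
  \<^const>\<open>set_mult\<close>: the union over all representatives of $X = [I \rtimes_R Q]$ and of \<open>u\<close>.
\<close>

definition ext_act :: "'i mla \<Rightarrow> 'q mla \<Rightarrow> ('i, 'i \<times> 'q, 'q) mla_ext set \<Rightarrow>
    (('q \<times> 'q \<Rightarrow> 'i) \<times> ('q \<times> 'q \<Rightarrow> 'i)) set \<Rightarrow> ('i, 'i \<times> 'q, 'q) mla_ext set" where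
  "ext_act I Q X u =
     (\<Union>R \<in> {R. two_cocycle I Q R \<and> ext_class I Q (cocycle_ext I Q R) = X}.
      \<Union>S \<in> u. ext_class I Q (cocycle_ext I Q (cocycle_shift I Q R S)))"

definition Wells :: "'i mla \<Rightarrow> 'q mla \<Rightarrow> ('i, 'q) cocycle \<Rightarrow> ('i \<Rightarrow> 'i) \<times> ('q \<Rightarrow> 'q) \<Rightarrow>
    (('q \<times> 'q \<Rightarrow> 'i) \<times> ('q \<times> 'q \<Rightarrow> 'i)) set" where
  "Wells I Q T p = (THE u.
     u \<in> carrier (H2 (alg_center I) Q (act_restrict (alg_center I) Q (act_terms.truncate T))) \<and>
     ext_act I Q (ext_class I Q (cocycle_ext I Q (cocycle_twist I Q p T))) u =
       ext_class I Q (cocycle_ext I Q T))"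

definition decode :: "('i, 'a, 'q) mla_ext \<Rightarrow> ('q \<Rightarrow> 'a) \<Rightarrow> 'i \<times> 'q \<Rightarrow> 'a" where
  "decode E l = (\<lambda>(a, x). incl E a \<otimes>\<^bsub>mid E\<^esub> l x)"

definition i_map :: "'i mla \<Rightarrow> 'q mla \<Rightarrow> ('i, 'a, 'q) mla_ext \<Rightarrow> ('q \<Rightarrow> 'a) \<Rightarrow>
    ('q \<Rightarrow> 'i) \<Rightarrow> 'a \<Rightarrow> 'a" where
  "i_map I Q E l d = (\<lambda>u \<in> carrier (mid E).
     let (a, x) = inv_into (carrier I \<times> carrier Q) (decode E l) u
     in decode E l (a \<otimes>\<^bsub>I\<^esub> d x, x))"

definition psi :: "'i mla \<Rightarrow> 'q mla \<Rightarrow> ('i, 'a, 'q) mla_ext \<Rightarrow> ('q \<Rightarrow> 'a) \<Rightarrow>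
    ('a \<Rightarrow> 'a) \<Rightarrow> ('i \<Rightarrow> 'i) \<times> ('q \<Rightarrow> 'q)" where
  "psi I Q E t \<phi> =
     (\<lambda>a \<in> carrier I. incl_inv I E (\<phi> (incl E a)), \<lambda>x \<in> carrier Q. proj E (\<phi> (t x)))"

end

theory Submission
  imports Defs
begin

text \<open>
  Let \<open>B\<close> be the algebraic center of \<open>I\<close>, and let \<open>\<iota>\<close> and \<open>\<pi>\<close> be the inclusion and the
  projection of an extension with middle term \<open>A\<close>.  The computations take place in
  \<open>A\<close> rather than in $I \rtimes_T Q$, because central elements can be pulled out of both
  operations of \<open>A\<close>: for \<open>u\<close>, \<open>v\<close> over \<open>x\<close>, \<open>y\<close> and \<open>c\<close>, \<open>d\<close> in \<open>B\<close>, the product of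
  $\iota(c)u$ and $\iota(d)v$ is $\iota(c + \sigma_x(d))\,uv$, and their bracket is
  $\iota(\tau_x(d) + c + d + \sigma_{\{x,y\}}(\nu_y(c) - c - d))\,\{u,v\}$
  (\<open>central_mult\<close>, \<open>central_lie\<close>).  These two coefficients are the expressions in the definitions
  of derivations, cocycles and coboundaries.

  Multiplying the values of the two operations of \<open>A\<close> by a central cochain \<open>S\<close> gives a structure
  \<open>twist_ext E S\<close> on the same set.  It is again an extension exactly when \<open>S\<close> is a cocycle
  (\<open>Z2_iff\<close>), because it is a quotient of the fibre product of \<open>A\<close> and $B \rtimes_S Q$ over \<open>Q\<close>,
  and conversely $B \rtimes_S Q$ is a quotient of a subalgebra of the product of \<open>A\<close> and the
  twisted structure.  Every isomorphism between twists by \<open>S\<close> and \<open>R\<close> that induces the identity on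
  \<open>I\<close> and \<open>Q\<close> has the form $u \mapsto \iota(k(\pi(u)))\,u$ with \<open>k\<close> having values in \<open>B\<close>, and then
  \<open>S\<close> and \<open>R\<close> differ by the coboundary of \<open>k\<close> (\<open>twist_iso_form\<close>).  For trivial \<open>S\<close> and \<open>R\<close> this
  says that the automorphisms of \<open>A\<close> inducing the identity on \<open>I\<close> and \<open>Q\<close> are those given by
  derivations, which is exactness at $\mathrm{Aut}_I A$.

  A section with cocycle \<open>R\<close> identifies $I \rtimes_{R \ast S} Q$ with the twist by \<open>S\<close>
  (\<open>decode_iso\<close>), so the action of cohomology on classes of extensions is given by twisting, and
  twisting respects isomorphisms.  This action is transitive because two sections with equal
  action terms, of two extensions with middle terms $A_1$ and $A_2$, have cocycles differing by a
  central cochain (\<open>same_action_cocycle\<close>): the pairs $(l_1(x), l_2(x))$ lie in the idealizer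
  of the diagonal copy of \<open>I\<close> in $A_1 \times A_2$, and idealizers are subalgebras, so the pairs
  of cocycle values lie in it as well.  That idealizers are closed under the bracket depends on the
  identity $\{[x,y],z\} = [\{x,y\},z]$ (\<open>lie_commutator\<close>).

  For a pair $(\omega,\kappa)$ of automorphisms, composing \<open>\<iota>\<close> with $\omega^{-1}$ and \<open>\<pi>\<close> with
  $\kappa$ gives an extension with the same middle term \<open>A\<close> and with the cocycle
  $T^{(\omega,\kappa)}$ (\<open>relabel_section\<close>).  If the pair is compatible, transitivity gives an
  \<open>S\<close> such that the twist of this extension by \<open>S\<close> is isomorphic to the original one, and the Wells
  map takes the pair to the class of \<open>S\<close> (\<open>Wells_eq\<close>).  This class vanishes exactly when the
  relabelled extension is isomorphic to the original one.  Such an isomorphism is an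
  automorphism of \<open>A\<close> preserving \<open>I\<close> and inducing $\omega$ on \<open>I\<close> and $\kappa$ on \<open>Q\<close>, so
  exactness at $C(Q,I,\chi)$ follows.
\<close>

section \<open>Identities in a multiplicative Lie algebra\<close>

context group
begin

lemma inv_cancel_left:
  "x \<in> carrier G \<Longrightarrow> y \<in> carrier G \<Longrightarrow> x \<otimes> (inv x \<otimes> y) = y"
  "x \<in> carrier G \<Longrightarrow> y \<in> carrier G \<Longrightarrow> inv x \<otimes> (x \<otimes> y) = y"
  by (simp_all add: m_assoc [symmetric])

lemmas group_word = m_assoc inv_mult_group inv_cancel_left

lemma cj_closed [simp, intro]:
  "z \<in> carrier G \<Longrightarrow> x \<in> carrier G \<Longrightarrow> cj G z x \<in> carrier G"
  by (simp add: cj_def)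

lemma cj_mult:
  "z \<in> carrier G \<Longrightarrow> x \<in> carrier G \<Longrightarrow> y \<in> carrier G \<Longrightarrow> cj G z (x \<otimes> y) = cj G z x \<otimes> cj G z y"
  by (simp add: cj_def group_word)

lemma cj_cj:
  "z \<in> carrier G \<Longrightarrow> w \<in> carrier G \<Longrightarrow> x \<in> carrier G \<Longrightarrow> cj G z (cj G w x) = cj G (z \<otimes> w) x"
  by (simp add: cj_def group_word)

lemma cj_inv:
  "z \<in> carrier G \<Longrightarrow> x \<in> carrier G \<Longrightarrow> cj G z (inv x) = inv (cj G z x)"
  by (simp add: cj_def group_word)

lemma cj_one_left [simp]: "x \<in> carrier G \<Longrightarrow> cj G \<one> x = x"
  by (simp add: cj_def)

lemma cj_one_right [simp]: "z \<in> carrier G \<Longrightarrow> cj G z \<one> = \<one>"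
  by (simp add: cj_def)

lemma cj_inv_cancel [simp]:
  "z \<in> carrier G \<Longrightarrow> x \<in> carrier G \<Longrightarrow> cj G z (cj G (inv z) x) = x"
  "z \<in> carrier G \<Longrightarrow> x \<in> carrier G \<Longrightarrow> cj G (inv z) (cj G z x) = x"
  by (simp_all add: cj_cj)

lemma cj_swap: "z \<in> carrier G \<Longrightarrow> x \<in> carrier G \<Longrightarrow> z \<otimes> x = cj G z x \<otimes> z"
  by (simp add: cj_def group_word)

lemma cj_eq_self_iff:
  "z \<in> carrier G \<Longrightarrow> x \<in> carrier G \<Longrightarrow> cj G z x = x \<longleftrightarrow> z \<otimes> x = x \<otimes> z"
  by (metis cj_closed cj_swap right_cancel)

end

context mult_lie_algebra
begin

lemma lie_one_left [simp]: "x \<in> carrier A \<Longrightarrow> \<lbrace>\<one>, x\<rbrace> = \<one>"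
  using lie_mult_left [of \<one> \<one> x] by (simp add: lie_closed)

lemma lie_one_right [simp]: "x \<in> carrier A \<Longrightarrow> \<lbrace>x, \<one>\<rbrace> = \<one>"
  using lie_mult_right [of x \<one> \<one>] by (simp add: lie_closed)

text \<open>
  Expand $\{xy,xy\} = 1$ on both sides.
\<close>

lemma lie_antisym:
  assumes [simp]: "x \<in> carrier A" "y \<in> carrier A"
  shows "\<lbrace>y, x\<rbrace> = inv \<lbrace>x, y\<rbrace>"
proof -
  have "\<one> = \<lbrace>x \<otimes> y, x \<otimes> y\<rbrace>" by (simp add: lie_self)
  also have "\<dots> = cj A x \<lbrace>y, x \<otimes> y\<rbrace> \<otimes> \<lbrace>x, x \<otimes> y\<rbrace>" by (simp add: lie_mult_left)
  also have "\<dots> = cj A x (\<lbrace>y, x\<rbrace> \<otimes> \<lbrace>x, y\<rbrace>)"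
    by (simp add: lie_mult_right lie_self lie_closed cj_mult)
  finally have "cj A x (\<lbrace>y, x\<rbrace> \<otimes> \<lbrace>x, y\<rbrace>) = cj A x \<one>" by (metis assms(1) cj_one_right)
  then have "cj A (inv x) (cj A x (\<lbrace>y, x\<rbrace> \<otimes> \<lbrace>x, y\<rbrace>)) = cj A (inv x) (cj A x \<one>)" by simp
  then have "\<lbrace>y, x\<rbrace> \<otimes> \<lbrace>x, y\<rbrace> = \<one>" by (simp add: lie_closed)
  then show ?thesis by (simp add: lie_closed inv_equality)
qed

lemma lie_inv_left:
  assumes [simp]: "x \<in> carrier A" "y \<in> carrier A"
  shows "\<lbrace>inv x, y\<rbrace> = inv (cj A (inv x) \<lbrace>x, y\<rbrace>)"
proof -
  have "cj A (inv x) \<lbrace>x, y\<rbrace> \<otimes> \<lbrace>inv x, y\<rbrace> = \<one>"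
    using lie_mult_left [of "inv x" x y] by simp
  then show ?thesis by (metis assms cj_closed inv_closed lie_closed inv_equality inv_inv)
qed


text \<open>
  Both sides are what remains of $\{xx',yy'\}$, expanded first on the left or first on the
  right, after the common outer factors are cancelled.
\<close>

lemma lie_interchange:
  assumes [simp]: "x \<in> carrier A" "y \<in> carrier A" "x' \<in> carrier A" "y' \<in> carrier A"
  shows "cj A (x \<otimes> y) \<lbrace>x', y'\<rbrace> \<otimes> \<lbrace>x, y\<rbrace> = \<lbrace>x, y\<rbrace> \<otimes> cj A (y \<otimes> x) \<lbrace>x', y'\<rbrace>"
proof -
  let ?l = "cj A x \<lbrace>x', y\<rbrace>" and ?r = "cj A y \<lbrace>x, y'\<rbrace>"
  have "\<lbrace>x \<otimes> x', y \<otimes> y'\<rbrace> = cj A x (\<lbrace>x', y\<rbrace> \<otimes> cj A y \<lbrace>x', y'\<rbrace>) \<otimes> (\<lbrace>x, y\<rbrace> \<otimes> ?r)"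
    using lie_mult_left [of x x' "y \<otimes> y'"] lie_mult_right [of x' y y'] lie_mult_right [of x y y']
    by simp
  also have "\<dots> = ?l \<otimes> (cj A (x \<otimes> y) \<lbrace>x', y'\<rbrace> \<otimes> \<lbrace>x, y\<rbrace>) \<otimes> ?r"
    by (simp add: cj_mult cj_cj lie_closed m_assoc)
  finally have 1: "\<lbrace>x \<otimes> x', y \<otimes> y'\<rbrace> = \<dots>" .
  have "\<lbrace>x \<otimes> x', y \<otimes> y'\<rbrace> = (?l \<otimes> \<lbrace>x, y\<rbrace>) \<otimes> cj A y (cj A x \<lbrace>x', y'\<rbrace> \<otimes> \<lbrace>x, y'\<rbrace>)"
    using lie_mult_right [of "x \<otimes> x'" y y'] lie_mult_left [of x x' y] lie_mult_left [of x x' y']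
    by simp
  also have "\<dots> = ?l \<otimes> (\<lbrace>x, y\<rbrace> \<otimes> cj A (y \<otimes> x) \<lbrace>x', y'\<rbrace>) \<otimes> ?r"
    by (simp add: cj_mult cj_cj lie_closed m_assoc)
  finally show ?thesis using 1 by (simp add: lie_closed)
qed

text \<open>
  A commutator and the corresponding bracket conjugate brackets in the same way: apply
  \<open>lie_interchange\<close> to the conjugate of $\{u,v\}$ by $(yx)^{-1}$.
\<close>

lemma cj_lie_commutator:
  assumes [simp]: "x \<in> carrier A" "y \<in> carrier A" "u \<in> carrier A" "v \<in> carrier A"
  shows "cj A (x \<otimes> y \<otimes> inv x \<otimes> inv y) \<lbrace>u, v\<rbrace> = cj A \<lbrace>x, y\<rbrace> \<lbrace>u, v\<rbrace>"
proof -
  let ?w = "cj A (inv (y \<otimes> x)) \<lbrace>u, v\<rbrace>"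
  have w: "?w = \<lbrace>cj A (inv (y \<otimes> x)) u, cj A (inv (y \<otimes> x)) v\<rbrace>"
    by (rule lie_conj) auto
  have "cj A (x \<otimes> y) ?w \<otimes> \<lbrace>x, y\<rbrace> = \<lbrace>x, y\<rbrace> \<otimes> cj A (y \<otimes> x) ?w"
    unfolding w by (rule lie_interchange) auto
  then have "cj A (x \<otimes> y \<otimes> inv (y \<otimes> x)) \<lbrace>u, v\<rbrace> \<otimes> \<lbrace>x, y\<rbrace> = \<lbrace>x, y\<rbrace> \<otimes> \<lbrace>u, v\<rbrace>"
    by (simp add: cj_cj lie_closed)
  also have "\<dots> = cj A \<lbrace>x, y\<rbrace> \<lbrace>u, v\<rbrace> \<otimes> \<lbrace>x, y\<rbrace>" by (intro cj_swap lie_closed assms)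
  finally show ?thesis by (simp add: lie_closed inv_mult_group m_assoc)
qed

text \<open>
  Write the commutator as $x \cdot (x^{-1})^y$ and expand its bracket with \<open>z\<close>. The
  factor $\{x, z^{y^{-1}}\}^y$ is found from the two expansions of $\{x, zy\} = \{x, y
  z^{y^{-1}}\}$, and the remaining conjugations by the commutator act on brackets, where
  \<open>cj_lie_commutator\<close> replaces them by conjugations by $\{x,y\}$.
\<close>

lemma lie_commutator:
  assumes [simp]: "x \<in> carrier A" "y \<in> carrier A" "z \<in> carrier A"
  shows "\<lbrace>x \<otimes> y \<otimes> inv x \<otimes> inv y, z\<rbrace> = \<lbrace>x, y\<rbrace> \<otimes> z \<otimes> inv \<lbrace>x, y\<rbrace> \<otimes> inv z"
proof -
  define g v u where "g = x \<otimes> y \<otimes> inv x \<otimes> inv y" and "v = \<lbrace>x, y\<rbrace>" and "u = cj A (inv y) z"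
  have [simp]: "g \<in> carrier A" "v \<in> carrier A" "u \<in> carrier A" "\<lbrace>x, z\<rbrace> \<in> carrier A"
    "\<lbrace>x, u\<rbrace> \<in> carrier A"
    by (simp_all add: g_def v_def u_def lie_closed)
  have gv: "cj A g v = v"
    using cj_lie_commutator [of x y x y] by (simp add: g_def v_def cj_eq_self_iff lie_closed)
  have gz: "cj A g (cj A z v) = cj A v (cj A z v)"
    using cj_lie_commutator [of x y "cj A z x" "cj A z y"]
    by (simp add: g_def v_def lie_conj)
  have gxz: "cj A g \<lbrace>x, z\<rbrace> = cj A v \<lbrace>x, z\<rbrace>"
    using cj_lie_commutator [of x y x z] by (simp add: g_def v_def)
  have zy: "z \<otimes> y = y \<otimes> u" by (simp add: u_def cj_def group_word)
  have "\<lbrace>x, z\<rbrace> \<otimes> cj A z v = v \<otimes> cj A y \<lbrace>x, u\<rbrace>"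
    using lie_mult_right [of x z y] lie_mult_right [of x y u] zy by (simp add: v_def)
  then have yu: "cj A y \<lbrace>x, u\<rbrace> = inv v \<otimes> \<lbrace>x, z\<rbrace> \<otimes> cj A z v"
    by (simp add: m_assoc inv_cancel_left)
  have g: "g = x \<otimes> cj A y (inv x)" by (simp add: g_def cj_def m_assoc)
  have yz: "z = cj A y u" by (simp add: u_def)
  have "\<lbrace>g, z\<rbrace> = cj A x \<lbrace>cj A y (inv x), z\<rbrace> \<otimes> \<lbrace>x, z\<rbrace>"
    unfolding g by (simp add: lie_mult_left)
  also have "\<lbrace>cj A y (inv x), z\<rbrace> = cj A y \<lbrace>inv x, u\<rbrace>"
    by (subst yz) (simp add: lie_conj)
  also have "cj A x (cj A y \<lbrace>inv x, u\<rbrace>) = inv (cj A g (cj A y \<lbrace>x, u\<rbrace>))"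
    by (simp add: lie_inv_left g_def cj_inv cj_cj m_assoc)
  also have "cj A g (cj A y \<lbrace>x, u\<rbrace>) = inv v \<otimes> cj A v \<lbrace>x, z\<rbrace> \<otimes> cj A v (cj A z v)"
    by (simp add: yu cj_mult cj_inv gv gz gxz)
  finally have "\<lbrace>g, z\<rbrace> = v \<otimes> z \<otimes> inv v \<otimes> inv z"
    by (simp add: cj_def group_word)
  then show ?thesis by (simp add: g_def v_def)
qed

lemma lie_expand:
  assumes [simp]: "a \<in> carrier A" "u \<in> carrier A" "b \<in> carrier A" "v \<in> carrier A"
  shows "\<lbrace>a \<otimes> u, b \<otimes> v\<rbrace> =
    a \<otimes> \<lbrace>u, b\<rbrace> \<otimes> b \<otimes> \<lbrace>u, v\<rbrace> \<otimes> inv b \<otimes> inv a \<otimes> \<lbrace>a, b\<rbrace> \<otimes> b \<otimes> \<lbrace>a, v\<rbrace> \<otimes> inv b"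
  using lie_mult_left [of a u "b \<otimes> v"] lie_mult_right [of a b v] lie_mult_right [of u b v]
  by (simp add: cj_def lie_closed group_word)

text \<open>
  The expansion in the form of the bracket of $I \rtimes_T Q$: with \<open>a\<close>,
  \<open>b\<close> in the kernel and \<open>u\<close>, \<open>v\<close> values of a section, all
  factors before the last one lie in the kernel. The order of the factors differs from that in
  \<open>lie_expand\<close> by one use of \<open>lie_interchange\<close>.
\<close>

lemma lie_expand_sorted:
  assumes [simp]: "a \<in> carrier A" "u \<in> carrier A" "b \<in> carrier A" "v \<in> carrier A"
  shows "\<lbrace>a \<otimes> u, b \<otimes> v\<rbrace> =
    cj A a \<lbrace>u, b\<rbrace> \<otimes> \<lbrace>a, b\<rbrace> \<otimes> b \<otimes> a \<otimes> cj A \<lbrace>u, v\<rbrace> (inv a \<otimes> \<lbrace>a, v\<rbrace> \<otimes> inv b) \<otimes> \<lbrace>u, v\<rbrace>"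
proof -
  have [simp]: "\<lbrace>u, v\<rbrace> \<in> carrier A" "\<lbrace>a, b\<rbrace> \<in> carrier A" "\<lbrace>u, b\<rbrace> \<in> carrier A" "\<lbrace>a, v\<rbrace> \<in> carrier A"
    by (simp_all add: lie_closed)
  have "cj A (a \<otimes> b) \<lbrace>u, v\<rbrace> \<otimes> \<lbrace>a, b\<rbrace> = \<lbrace>a, b\<rbrace> \<otimes> cj A (b \<otimes> a) \<lbrace>u, v\<rbrace>"
    by (rule lie_interchange) auto
  then have "a \<otimes> b \<otimes> \<lbrace>u, v\<rbrace> \<otimes> inv b \<otimes> inv a \<otimes> \<lbrace>a, b\<rbrace>
      = \<lbrace>a, b\<rbrace> \<otimes> b \<otimes> a \<otimes> \<lbrace>u, v\<rbrace> \<otimes> inv a \<otimes> inv b"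
    by (simp add: cj_def group_word)
  then have e: "inv a \<otimes> (a \<otimes> b \<otimes> \<lbrace>u, v\<rbrace> \<otimes> inv b \<otimes> inv a \<otimes> \<lbrace>a, b\<rbrace>) \<otimes> w
      = inv a \<otimes> (\<lbrace>a, b\<rbrace> \<otimes> b \<otimes> a \<otimes> \<lbrace>u, v\<rbrace> \<otimes> inv a \<otimes> inv b) \<otimes> w" if "w \<in> carrier A" for w by simp
  then have *: "b \<otimes> (\<lbrace>u, v\<rbrace> \<otimes> (inv b \<otimes> (inv a \<otimes> (\<lbrace>a, b\<rbrace> \<otimes> w))))
      = inv a \<otimes> (\<lbrace>a, b\<rbrace> \<otimes> (b \<otimes> (a \<otimes> (\<lbrace>u, v\<rbrace> \<otimes> (inv a \<otimes> (inv b \<otimes> w))))))"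
    if "w \<in> carrier A" for w
    using that e [OF that] by (simp add: group_word)
  show ?thesis
    unfolding lie_expand [OF assms]
    using * [of "b \<otimes> \<lbrace>a, v\<rbrace> \<otimes> inv b"]
    by (simp add: cj_def group_word)
qed

end

section \<open>Subalgebras, products and images\<close>

definition subalgebra :: "'a set \<Rightarrow> ('a, 'm) mla_scheme \<Rightarrow> bool" where
  "subalgebra J A \<longleftrightarrow> subgroup J A \<and> (\<forall>x \<in> J. \<forall>y \<in> J. \<lbrace>x, y\<rbrace>\<^bsub>A\<^esub> \<in> J)"

definition mla_prod :: "('a, 'm) mla_scheme \<Rightarrow> ('b, 'n) mla_scheme \<Rightarrow> ('a \<times> 'b) mla" where
  "mla_prod A B =
     \<lparr>carrier = carrier A \<times> carrier B,
      mult = (\<lambda>(a, b) (a', b'). (a \<otimes>\<^bsub>A\<^esub> a', b \<otimes>\<^bsub>B\<^esub> b')),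
      one = (\<one>\<^bsub>A\<^esub>, \<one>\<^bsub>B\<^esub>),
      lie = (\<lambda>(a, b) (a', b'). (\<lbrace>a, a'\<rbrace>\<^bsub>A\<^esub>, \<lbrace>b, b'\<rbrace>\<^bsub>B\<^esub>))\<rparr>"

lemma mla_prod_simps [simp]:
  "carrier (mla_prod A B) = carrier A \<times> carrier B"
  "(a, b) \<otimes>\<^bsub>mla_prod A B\<^esub> (a', b') = (a \<otimes>\<^bsub>A\<^esub> a', b \<otimes>\<^bsub>B\<^esub> b')"
  "\<one>\<^bsub>mla_prod A B\<^esub> = (\<one>\<^bsub>A\<^esub>, \<one>\<^bsub>B\<^esub>)"
  "\<lbrace>(a, b), (a', b')\<rbrace>\<^bsub>mla_prod A B\<^esub> = (\<lbrace>a, a'\<rbrace>\<^bsub>A\<^esub>, \<lbrace>b, b'\<rbrace>\<^bsub>B\<^esub>)"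
  by (simp_all add: mla_prod_def)

lemma group_mla_prod:
  assumes "group A" "group B"
  shows "group (mla_prod A B)"
proof -
  interpret A: group A by fact
  interpret B: group B by fact
  show ?thesis
    by (rule groupI) (auto simp: A.m_assoc B.m_assoc intro: A.l_inv_ex B.l_inv_ex)
qed

lemma inv_mla_prod:
  assumes "group A" "group B" "a \<in> carrier A" "b \<in> carrier B"
  shows "inv\<^bsub>mla_prod A B\<^esub> (a, b) = (inv\<^bsub>A\<^esub> a, inv\<^bsub>B\<^esub> b)"
proof -
  interpret A: group A by fact
  interpret B: group B by fact
  interpret P: group "mla_prod A B" by (rule group_mla_prod) fact+
  show ?thesis using assms by (intro P.inv_equality) auto
qed

lemma cj_mla_prod:
  assumes "group A" "group B" "a \<in> carrier A" "b \<in> carrier B"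
  shows "cj (mla_prod A B) (a, b) (a', b') = (cj A a a', cj B b b')"
  using assms by (simp add: cj_def inv_mla_prod)

lemma mult_lie_algebra_mla_prod:
  assumes "mult_lie_algebra A" "mult_lie_algebra B"
  shows "mult_lie_algebra (mla_prod A B)"
proof -
  interpret A: mult_lie_algebra A by fact
  interpret B: mult_lie_algebra B by fact
  interpret P: group "mla_prod A B" by (simp add: group_mla_prod A.is_group B.is_group)
  note [simp] = cj_mla_prod [OF A.is_group B.is_group]
  show ?thesis
    apply unfold_locales
         apply (auto simp: A.lie_closed B.lie_closed A.lie_self B.lie_self)
         apply (simp_all add: A.lie_mult_right B.lie_mult_right A.lie_mult_left B.lie_mult_left
          A.lie_jacobi B.lie_jacobi A.lie_conj B.lie_conj)
    done
qed

lemma mult_lie_algebra_subalgebra: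
  assumes "mult_lie_algebra A" "subalgebra J A"
  shows "mult_lie_algebra (A\<lparr>carrier := J\<rparr>)"
proof -
  interpret A: mult_lie_algebra A by fact
  interpret J: subgroup J A using assms by (simp add: subalgebra_def)
  interpret G: group "A\<lparr>carrier := J\<rparr>" by (rule J.subgroup_is_group) (rule A.is_group)
  have [simp]: "cj (A\<lparr>carrier := J\<rparr>) z x = cj A z x" if "z \<in> J" for z x
    using that by (simp add: cj_def A.m_inv_consistent J.subgroup_axioms)
  have mem: "\<And>x. x \<in> J \<Longrightarrow> x \<in> carrier A" by (rule J.mem_carrier)
  have lie: "\<And>x y. x \<in> J \<Longrightarrow> y \<in> J \<Longrightarrow> \<lbrace>x, y\<rbrace>\<^bsub>A\<^esub> \<in> J"
    using assms(2) by (simp add: subalgebra_def)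
  show ?thesis
    apply unfold_locales
         apply (simp_all add: mem lie A.lie_self)
       apply (simp_all add: mem A.lie_mult_right A.lie_mult_left A.lie_jacobi A.lie_conj)
    done
qed

text \<open>
  Multiplicative Lie algebras are defined by identities, so they are inherited by any structure
  that is the image of a map preserving the operations; the image is not assumed to be a group.
\<close>

lemma mult_lie_algebra_surj_image:
  fixes A :: "('a, 'm) mla_scheme" and B :: "('b, 'n) mla_scheme"
  assumes "mult_lie_algebra A" and surj: "f ` carrier A = carrier B"
    and mult: "\<And>x y. x \<in> carrier A \<Longrightarrow> y \<in> carrier A \<Longrightarrow> f (x \<otimes>\<^bsub>A\<^esub> y) = f x \<otimes>\<^bsub>B\<^esub> f y"
    and lie: "\<And>x y. x \<in> carrier A \<Longrightarrow> y \<in> carrier A \<Longrightarrow> f \<lbrace>x, y\<rbrace>\<^bsub>A\<^esub> = \<lbrace>f x, f y\<rbrace>\<^bsub>B\<^esub>"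
    and one: "f \<one>\<^bsub>A\<^esub> = \<one>\<^bsub>B\<^esub>"
  shows "mult_lie_algebra B"
proof -
  interpret A: mult_lie_algebra A by fact
  have mem: "\<And>x. x \<in> carrier A \<Longrightarrow> f x \<in> carrier B" using surj by auto
  have exE_B: P if "y \<in> carrier B" "\<And>x. x \<in> carrier A \<Longrightarrow> y = f x \<Longrightarrow> P" for y P
    using that surj by auto
  interpret B: group B
  proof (rule groupI, goal_cases)
    case (1 x y)
    then obtain a b where "a \<in> carrier A" "b \<in> carrier A" "x = f a" "y = f b" by (elim exE_B)
    then show ?case by (simp add: mult [symmetric] mem)
  next
    case 2 then show ?case by (simp add: one [symmetric] mem)
  next
    case (3 x y z)
    then obtain a b c where "a \<in> carrier A" "b \<in> carrier A" "c \<in> carrier A"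
      "x = f a" "y = f b" "z = f c" by (elim exE_B)
    then show ?case by (simp add: mult [symmetric] A.m_assoc)
  next
    case (4 x)
    then obtain a where "a \<in> carrier A" "x = f a" by (elim exE_B)
    then show ?case by (simp add: mult [symmetric] one [symmetric])
  next
    case (5 x)
    then obtain a where "a \<in> carrier A" "x = f a" by (elim exE_B)
    then show ?case
      by (intro bexI [of _ "f (inv\<^bsub>A\<^esub> a)"]) (simp_all add: mult [symmetric] one [symmetric] mem)
  qed
  have inv: "inv\<^bsub>B\<^esub> (f x) = f (inv\<^bsub>A\<^esub> x)" if "x \<in> carrier A" for x
    using that by (intro B.inv_equality) (simp_all add: mem mult [symmetric] one)
  have cj: "cj B (f z) (f x) = f (cj A z x)" if "x \<in> carrier A" "z \<in> carrier A" for x z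
    using that by (simp add: cj_def mult inv)
  note hom = lie [symmetric] mult [symmetric] cj A.lie_closed
  show ?thesis
  proof (unfold_locales, goal_cases)
    case (1 x y)
    then obtain a b where "a \<in> carrier A" "b \<in> carrier A" "x = f a" "y = f b" by (elim exE_B)
    then show ?case by (simp add: lie [symmetric] mem A.lie_closed)
  next
    case (2 x)
    then obtain a where "a \<in> carrier A" "x = f a" by (elim exE_B)
    then show ?case by (simp add: lie [symmetric] A.lie_self one)
  next
    case (3 x y z)
    then obtain a b c where "a \<in> carrier A" "b \<in> carrier A" "c \<in> carrier A"
      "x = f a" "y = f b" "z = f c" by (elim exE_B)
    then show ?case by (simp add: hom) (simp add: A.lie_mult_right)
  next
    case (4 x y z)
    then obtain a b c where "a \<in> carrier A" "b \<in> carrier A" "c \<in> carrier A"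
      "x = f a" "y = f b" "z = f c" by (elim exE_B)
    then show ?case by (simp add: hom) (simp add: A.lie_mult_left)
  next
    case (5 x y z)
    then obtain a b c where "a \<in> carrier A" "b \<in> carrier A" "c \<in> carrier A"
      "x = f a" "y = f b" "z = f c" by (elim exE_B)
    then show ?case by (simp add: hom) (simp add: A.lie_jacobi one)
  next
    case (6 x y z)
    then obtain a b c where "a \<in> carrier A" "b \<in> carrier A" "c \<in> carrier A"
      "x = f a" "y = f b" "z = f c" by (elim exE_B)
    then show ?case by (simp add: hom) (simp add: A.lie_conj)
  qed
qed

lemma mult_lie_algebra_iso:
  fixes A :: "('a, 'm) mla_scheme" and B :: "('b, 'n) mla_scheme"
  assumes "mult_lie_algebra B" and bij: "bij_betw f (carrier A) (carrier B)"
    and mult: "\<And>x y. x \<in> carrier A \<Longrightarrow> y \<in> carrier A \<Longrightarrow>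
      x \<otimes>\<^bsub>A\<^esub> y \<in> carrier A \<and> f (x \<otimes>\<^bsub>A\<^esub> y) = f x \<otimes>\<^bsub>B\<^esub> f y"
    and lie: "\<And>x y. x \<in> carrier A \<Longrightarrow> y \<in> carrier A \<Longrightarrow>
      \<lbrace>x, y\<rbrace>\<^bsub>A\<^esub> \<in> carrier A \<and> f \<lbrace>x, y\<rbrace>\<^bsub>A\<^esub> = \<lbrace>f x, f y\<rbrace>\<^bsub>B\<^esub>"
    and one: "\<one>\<^bsub>A\<^esub> \<in> carrier A" "f \<one>\<^bsub>A\<^esub> = \<one>\<^bsub>B\<^esub>"
  shows "mult_lie_algebra A"
proof (rule mult_lie_algebra_surj_image [OF assms(1), where f = "inv_into (carrier A) f"])
  let ?g = "inv_into (carrier A) f"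
  note left = bij_betw_inv_into_left [OF bij] and right = bij_betw_inv_into_right [OF bij]
  have mem: "\<And>x. x \<in> carrier B \<Longrightarrow> ?g x \<in> carrier A"
    using bij bij_betw_inv_into bij_betwE by blast
  show "?g ` carrier B = carrier A"
    using bij_betw_inv_into [OF bij] by (simp add: bij_betw_def)
  show "?g \<one>\<^bsub>B\<^esub> = \<one>\<^bsub>A\<^esub>" using left [OF one(1)] one by simp
  fix x y assume xy: "x \<in> carrier B" "y \<in> carrier B"
  show "?g (x \<otimes>\<^bsub>B\<^esub> y) = ?g x \<otimes>\<^bsub>A\<^esub> ?g y"
    using left [of "?g x \<otimes>\<^bsub>A\<^esub> ?g y"] mult [OF mem mem, OF xy] right xy by simp
  show "?g \<lbrace>x, y\<rbrace>\<^bsub>B\<^esub> = \<lbrace>?g x, ?g y\<rbrace>\<^bsub>A\<^esub>"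
    using left [of "\<lbrace>?g x, ?g y\<rbrace>\<^bsub>A\<^esub>"] lie [OF mem mem, OF xy] right xy by simp
qed

section \<open>The idealizer of a subalgebra\<close>

text \<open>
  Conjugation by the inverse is included so that \<open>w\<close> maps \<open>J\<close> onto itself and the
  idealizer is a subgroup also when \<open>J\<close> is infinite.
\<close>

definition idealizer :: "'a set \<Rightarrow> ('a, 'm) mla_scheme \<Rightarrow> 'a set" where
  "idealizer J A = {w \<in> carrier A. \<forall>j \<in> J.
     cj A w j \<in> J \<and> cj A (inv\<^bsub>A\<^esub> w) j \<in> J \<and> \<lbrace>w, j\<rbrace>\<^bsub>A\<^esub> \<in> J}"

text \<open>
  Closure under the bracket is the point. Conjugation by $\{w,v\}$ differs from the identity by
  the bracket with the commutator of \<open>w\<close> and \<open>v\<close>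
  (\<open>lie_commutator\<close>), and that commutator is in the idealizer. The bracket of
  $\{w,v\}$ with an element of \<open>J\<close> is expressed by the Jacobi identity through
  brackets of elements of \<open>J\<close> with elements of the idealizer.
\<close>

lemma (in mult_lie_algebra) subalgebra_idealizer:
  assumes "subalgebra J A"
  shows "subalgebra (idealizer J A) A"
proof -
  interpret J: subgroup J A using assms by (simp add: subalgebra_def)
  note mem = J.mem_carrier
  have N: "w \<in> carrier A" "\<And>j. j \<in> J \<Longrightarrow> cj A w j \<in> J" "\<And>j. j \<in> J \<Longrightarrow> cj A (inv w) j \<in> J"
    "\<And>j. j \<in> J \<Longrightarrow> \<lbrace>w, j\<rbrace> \<in> J" if "w \<in> idealizer J A" for w
    using that by (auto simp: idealizer_def)
  have N': "\<lbrace>j, w\<rbrace> \<in> J" if "w \<in> idealizer J A" "j \<in> J" for w j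
    using N(4) [OF that] lie_antisym [of w j] N(1) [OF that(1)] mem [OF that(2)] by simp
  have mult: "w \<otimes> v \<in> idealizer J A" if w: "w \<in> idealizer J A" and v: "v \<in> idealizer J A" for w v
  proof -
    have "\<lbrace>w \<otimes> v, j\<rbrace> \<in> J" if "j \<in> J" for j
      using that N [OF w] N [OF v] by (simp add: lie_mult_left mem)
    moreover have "cj A (w \<otimes> v) j \<in> J" "cj A (inv (w \<otimes> v)) j \<in> J" if "j \<in> J" for j
      using that N [OF w] N [OF v]
      by (simp_all add: inv_mult_group cj_cj [symmetric] mem)
    ultimately show ?thesis using N(1) w v by (simp add: idealizer_def)
  qed
  have inv: "inv w \<in> idealizer J A" if w: "w \<in> idealizer J A" for w
    using N [OF w] by (auto simp: idealizer_def lie_inv_left mem)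
  have cjN: "cj A w v \<in> idealizer J A" if "w \<in> idealizer J A" "v \<in> idealizer J A" for w v
    unfolding cj_def using that by (intro mult inv)
  have cj_lie: "cj A \<lbrace>w, v\<rbrace> j \<in> J"
    if w: "w \<in> idealizer J A" and v: "v \<in> idealizer J A" and j: "j \<in> J" for w v j
  proof -
    let ?c = "w \<otimes> v \<otimes> inv w \<otimes> inv v"
    have c: "?c \<in> idealizer J A" using w v by (intro mult inv)
    have "cj A \<lbrace>w, v\<rbrace> j = \<lbrace>?c, j\<rbrace> \<otimes> j"
      using N(1) [OF w] N(1) [OF v] mem [OF j] lie_commutator [of w v j]
      by (simp add: cj_def lie_closed group_word)
    then show ?thesis using N(4) [OF c j] j by simp
  qed
  have lie: "\<lbrace>w, v\<rbrace> \<in> idealizer J A" if w: "w \<in> idealizer J A" and v: "v \<in> idealizer J A" for w v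
  proof -
    have "\<lbrace>\<lbrace>w, v\<rbrace>, z\<rbrace> \<in> J" if z: "z \<in> J" for z
    proof -
      let ?z = "cj A (inv v) z"
      have z': "?z \<in> J" using N(3) [OF v z] .
      note [simp] = N(1) [OF w] N(1) [OF v] mem [OF z] mem [OF z'] lie_closed
      have "\<lbrace>\<lbrace>v, ?z\<rbrace>, cj A ?z w\<rbrace> = cj A ?z \<lbrace>cj A (inv ?z) \<lbrace>v, ?z\<rbrace>, w\<rbrace>"
        by (simp add: lie_conj [of _ _ ?z])
      moreover have "\<dots> \<in> J"
        unfolding cj_def [of A ?z] cj_def [of A "inv ?z"]
        using N(4) [OF v z'] z' N' [OF w] by simp
      ultimately have 1: "\<lbrace>\<lbrace>v, ?z\<rbrace>, cj A ?z w\<rbrace> \<in> J" by simp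
      have 2: "\<lbrace>\<lbrace>?z, w\<rbrace>, cj A w v\<rbrace> \<in> J"
        using N' [OF cjN [OF w v] N' [OF w z']] .
      have "\<lbrace>\<lbrace>w, v\<rbrace>, cj A v ?z\<rbrace> \<otimes> (\<lbrace>\<lbrace>v, ?z\<rbrace>, cj A ?z w\<rbrace> \<otimes> \<lbrace>\<lbrace>?z, w\<rbrace>, cj A w v\<rbrace>) = \<one>"
        using lie_jacobi [of w v ?z] by (simp add: m_assoc)
      then have "\<lbrace>\<lbrace>w, v\<rbrace>, z\<rbrace> = inv (\<lbrace>\<lbrace>v, ?z\<rbrace>, cj A ?z w\<rbrace> \<otimes> \<lbrace>\<lbrace>?z, w\<rbrace>, cj A w v\<rbrace>)"
        by (simp add: inv_equality)
      then show ?thesis using 1 2 by simp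
    qed
    moreover have "cj A (inv \<lbrace>w, v\<rbrace>) j \<in> J" if "j \<in> J" for j
      using cj_lie [OF v w that] lie_antisym [of w v] N(1) w v by simp
    ultimately show ?thesis using N(1) w v cj_lie by (simp add: idealizer_def lie_closed)
  qed
  have one: "\<one> \<in> idealizer J A" by (auto simp: idealizer_def mem)
  show ?thesis
    unfolding subalgebra_def
    using N(1) one mult inv lie by (auto intro!: subgroup.intro)
qed

lemma idealizerD:
  assumes "w \<in> idealizer J A" "j \<in> J"
  shows "cj A w j \<in> J" "\<lbrace>w, j\<rbrace>\<^bsub>A\<^esub> \<in> J"
  using assms by (simp_all add: idealizer_def)

lemma (in mult_lie_algebra) subalgebra_le_idealizer:
  assumes J: "subalgebra J A"
  shows "J \<subseteq> idealizer J A"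
proof
  interpret J: subgroup J A using J by (simp add: subalgebra_def)
  fix w assume "w \<in> J"
  then show "w \<in> idealizer J A"
    using J by (simp add: idealizer_def cj_def subalgebra_def)
qed

section \<open>The algebraic center\<close>

lemma alg_center_simps [simp]:
  "mult (alg_center I) = mult I" "one (alg_center I) = one I" "lie (alg_center I) = lie I"
  by (simp_all add: alg_center_def)

context mult_lie_algebra
begin

abbreviation Z where "Z \<equiv> carrier (alg_center A)"

lemma Z_carrier: "a \<in> Z \<Longrightarrow> a \<in> carrier A"
  by (simp add: alg_center_def)

lemma Z_comm: "a \<in> Z \<Longrightarrow> b \<in> carrier A \<Longrightarrow> a \<otimes> b = b \<otimes> a"
  by (simp add: alg_center_def)

lemma Z_lie: "a \<in> Z \<Longrightarrow> b \<in> carrier A \<Longrightarrow> \<lbrace>a, b\<rbrace> = \<one>" "a \<in> Z \<Longrightarrow> b \<in> carrier A \<Longrightarrow> \<lbrace>b, a\<rbrace> = \<one>"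
  by (simp_all add: alg_center_def)

lemma ZI:
  assumes "a \<in> carrier A" "\<And>b. b \<in> carrier A \<Longrightarrow> a \<otimes> b = b \<otimes> a"
    "\<And>b. b \<in> carrier A \<Longrightarrow> \<lbrace>a, b\<rbrace> = \<one>"
  shows "a \<in> Z"
  using assms lie_antisym [of a] by (simp add: alg_center_def)

lemma Z_cj: "a \<in> Z \<Longrightarrow> b \<in> carrier A \<Longrightarrow> cj A b a = a"
  using Z_comm [of a b] by (simp add: cj_eq_self_iff Z_carrier)

lemma subgroup_Z: "subgroup Z A"
proof (rule subgroup.intro)
  show "Z \<subseteq> carrier A" by (auto simp: Z_carrier)
  show "\<one> \<in> Z" by (rule ZI) auto
next
  fix x y assume xy: "x \<in> Z" "y \<in> Z"
  note [simp] = xy [THEN Z_carrier]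
  show "x \<otimes> y \<in> Z"
  proof (rule ZI)
    fix b assume [simp]: "b \<in> carrier A"
    have "x \<otimes> (y \<otimes> b) = x \<otimes> (b \<otimes> y)" using xy by (simp add: Z_comm)
    also have "\<dots> = b \<otimes> (x \<otimes> y)" using Z_comm [OF xy(1), of b] by (simp add: m_assoc [symmetric])
    finally show "x \<otimes> y \<otimes> b = b \<otimes> (x \<otimes> y)" by (simp add: m_assoc)
    show "\<lbrace>x \<otimes> y, b\<rbrace> = \<one>" using xy by (simp add: lie_mult_left Z_lie)
  qed simp
next
  fix x assume x: "x \<in> Z"
  note [simp] = Z_carrier [OF x]
  show "inv x \<in> Z"
  proof (rule ZI)
    fix b assume [simp]: "b \<in> carrier A"
    have "inv x \<otimes> (b \<otimes> x) \<otimes> inv x = inv x \<otimes> (x \<otimes> b) \<otimes> inv x" using x by (simp add: Z_comm)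
    then show "inv x \<otimes> b = b \<otimes> inv x" by (simp add: group_word)
    show "\<lbrace>inv x, b\<rbrace> = \<one>" using x by (simp add: lie_inv_left Z_lie)
  qed simp
qed

lemma comm_group_Z: "comm_group (alg_center A)"
proof -
  have "alg_center A = A\<lparr>carrier := Z\<rparr>" by (simp add: alg_center_def)
  then have "group (alg_center A)"
    using subgroup.subgroup_is_group [OF subgroup_Z is_group] by simp
  then show ?thesis
    by (rule group.group_comm_groupI) (simp add: Z_comm Z_carrier)
qed

lemma inv_Z: "a \<in> Z \<Longrightarrow> inv\<^bsub>alg_center A\<^esub> a = inv a"
proof -
  have "alg_center A = A\<lparr>carrier := Z\<rparr>" by (simp add: alg_center_def)
  then show "a \<in> Z \<Longrightarrow> inv\<^bsub>alg_center A\<^esub> a = inv a"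
    using m_inv_consistent [OF subgroup_Z] by simp
qed

end

section \<open>Extensions and their isomorphisms\<close>

locale mla_extension =
  fixes I :: "'i mla" and Q :: "'q mla" and E :: "('i, 'a, 'q) mla_ext"
  assumes ext: "extension I Q E"
begin

abbreviation A where "A \<equiv> mid E"
abbreviation B where "B \<equiv> alg_center I"
abbreviation \<iota> where "\<iota> \<equiv> incl E"
abbreviation \<pi> where "\<pi> \<equiv> proj E"

sublocale I: mult_lie_algebra I using ext by (simp add: extension_def)
sublocale A: mult_lie_algebra "mid E" using ext by (simp add: extension_def)
sublocale Q: mult_lie_algebra Q using ext by (simp add: extension_def)
sublocale B: comm_group "alg_center I" by (rule I.comm_group_Z)
sublocale incl: group_hom I "mid E" "incl E"
  using ext by (simp add: extension_def mla_hom_def group_hom_def group_hom_axioms_def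
      I.is_group A.is_group)
sublocale proj: group_hom "mid E" Q "proj E"
  using ext by (simp add: extension_def mla_hom_def group_hom_def group_hom_axioms_def
      Q.is_group A.is_group)

lemma incl_lie [simp]:
  "a \<in> carrier I \<Longrightarrow> b \<in> carrier I \<Longrightarrow> \<iota> \<lbrace>a, b\<rbrace>\<^bsub>I\<^esub> = \<lbrace>\<iota> a, \<iota> b\<rbrace>\<^bsub>A\<^esub>"
  using ext by (simp add: extension_def mla_hom_def)

lemma proj_lie [simp]:
  "u \<in> carrier A \<Longrightarrow> v \<in> carrier A \<Longrightarrow> \<pi> \<lbrace>u, v\<rbrace>\<^bsub>A\<^esub> = \<lbrace>\<pi> u, \<pi> v\<rbrace>\<^bsub>Q\<^esub>"
  using ext by (simp add: extension_def mla_hom_def)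

lemma incl_eq_iff [simp]:
  "a \<in> carrier I \<Longrightarrow> b \<in> carrier I \<Longrightarrow> \<iota> a = \<iota> b \<longleftrightarrow> a = b"
  using ext by (auto simp: extension_def inj_on_def)

lemma incl_inv_incl [simp]: "a \<in> carrier I \<Longrightarrow> incl_inv I E (\<iota> a) = a"
  using ext by (simp add: extension_def incl_inv_def)

lemma kernel_incl: "incl E ` carrier I = kernel A Q \<pi>"
  using ext by (simp add: extension_def)

lemma proj_incl [simp]: "a \<in> carrier I \<Longrightarrow> \<pi> (\<iota> a) = \<one>\<^bsub>Q\<^esub>"
  using kernel_incl by (auto simp: kernel_def)

lemma proj_oneE:
  assumes "u \<in> carrier A" "\<pi> u = \<one>\<^bsub>Q\<^esub>"
  obtains a where "a \<in> carrier I" "u = \<iota> a"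
  using assms kernel_incl by (auto simp: kernel_def)

lemma proj_surjE:
  assumes "x \<in> carrier Q"
  obtains u where "u \<in> carrier A" "\<pi> u = x"
proof -
  have "x \<in> \<pi> ` carrier A" using assms ext unfolding extension_def by metis
  then show ?thesis using that by blast
qed

lemma proj_eqE:
  assumes "u \<in> carrier A" "v \<in> carrier A" "\<pi> u = \<pi> v"
  obtains a where "a \<in> carrier I" "u = \<iota> a \<otimes>\<^bsub>A\<^esub> v"
proof -
  have "\<pi> (u \<otimes>\<^bsub>A\<^esub> inv\<^bsub>A\<^esub> v) = \<one>\<^bsub>Q\<^esub>" using assms by simp
  then obtain a where "a \<in> carrier I" "u \<otimes>\<^bsub>A\<^esub> inv\<^bsub>A\<^esub> v = \<iota> a"
    using assms by (meson A.inv_closed A.m_closed proj_oneE)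
  then show ?thesis using that assms by (metis A.inv_solve_right incl.hom_closed)
qed

lemma incl_cj [simp]:
  "a \<in> carrier I \<Longrightarrow> b \<in> carrier I \<Longrightarrow> \<iota> (cj I a b) = cj A (\<iota> a) (\<iota> b)"
  by (simp add: cj_def)

lemma incl_inv_closed:
  assumes "u \<in> carrier A" "\<pi> u = \<one>\<^bsub>Q\<^esub>"
  shows "incl_inv I E u \<in> carrier I" "\<iota> (incl_inv I E u) = u"
  using assms by (auto elim!: proj_oneE)

lemma proj_cj_incl [simp]:
  "u \<in> carrier A \<Longrightarrow> a \<in> carrier I \<Longrightarrow> \<pi> (cj A u (\<iota> a)) = \<one>\<^bsub>Q\<^esub>"
  by (simp add: cj_def)

lemma proj_lie_incl [simp]:
  "u \<in> carrier A \<Longrightarrow> a \<in> carrier I \<Longrightarrow> \<pi> \<lbrace>u, \<iota> a\<rbrace>\<^bsub>A\<^esub> = \<one>\<^bsub>Q\<^esub>"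
  "u \<in> carrier A \<Longrightarrow> a \<in> carrier I \<Longrightarrow> \<pi> \<lbrace>\<iota> a, u\<rbrace>\<^bsub>A\<^esub> = \<one>\<^bsub>Q\<^esub>"
  by simp_all

text \<open>
  This is what makes \<open>B\<close> a coefficient algebra for \<open>Q\<close>. For the
  bracket $\{u,\iota(b)\}$, \<open>lie_commutator\<close> gives that it commutes with
  \<open>I\<close>, and the Jacobi identity that its brackets with \<open>I\<close> are trivial.
\<close>

lemma center_stable:
  assumes u: "u \<in> carrier A" and b: "b \<in> I.Z"
  shows "incl_inv I E (cj A u (\<iota> b)) \<in> I.Z" (is "?s \<in> _")
    and "incl_inv I E \<lbrace>u, \<iota> b\<rbrace>\<^bsub>A\<^esub> \<in> I.Z" (is "?t \<in> _")
    and "incl_inv I E \<lbrace>\<iota> b, u\<rbrace>\<^bsub>A\<^esub> \<in> I.Z" (is "?n \<in> _")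
proof -
  note [simp] = u I.Z_carrier [OF b] A.lie_closed
  have s: "?s \<in> carrier I" "\<iota> ?s = cj A u (\<iota> b)" by (simp_all add: incl_inv_closed)
  have t: "?t \<in> carrier I" "\<iota> ?t = \<lbrace>u, \<iota> b\<rbrace>\<^bsub>A\<^esub>" by (simp_all add: incl_inv_closed)
  \<comment> \<open>Every element of \<open>I\<close> is a conjugate by \<open>u\<close> of an element of \<open>I\<close>.\<close>
  have ex: "\<exists>a'. a' \<in> carrier I \<and> \<iota> a = cj A u (\<iota> a')" if "a \<in> carrier I" for a
    using that
    by (intro exI [of _ "incl_inv I E (cj A (inv\<^bsub>A\<^esub> u) (\<iota> a))"]) (simp add: incl_inv_closed)
  show sZ: "?s \<in> I.Z"
  proof (rule I.ZI)
    fix a assume a: "a \<in> carrier I"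
    then obtain a' where a': "a' \<in> carrier I" "\<iota> a = cj A u (\<iota> a')" using ex by blast
    have "\<iota> b \<otimes>\<^bsub>A\<^esub> \<iota> a' = \<iota> a' \<otimes>\<^bsub>A\<^esub> \<iota> b"
      using I.Z_comm [OF b a'(1)] a'(1) by (simp flip: incl.hom_mult)
    then have "cj A u (\<iota> b) \<otimes>\<^bsub>A\<^esub> cj A u (\<iota> a') = cj A u (\<iota> a') \<otimes>\<^bsub>A\<^esub> cj A u (\<iota> b)"
      using a'(1) by (simp flip: A.cj_mult)
    then have "\<iota> (?s \<otimes>\<^bsub>I\<^esub> a) = \<iota> (a \<otimes>\<^bsub>I\<^esub> ?s)" using s a a' by simp
    then show "?s \<otimes>\<^bsub>I\<^esub> a = a \<otimes>\<^bsub>I\<^esub> ?s"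
      by (subst (asm) incl_eq_iff) (use s a in auto)
    have "\<lbrace>\<iota> b, \<iota> a'\<rbrace>\<^bsub>A\<^esub> = \<one>\<^bsub>A\<^esub>"
      using I.Z_lie(1) [OF b a'(1)] a'(1) by (simp flip: incl_lie)
    then have "\<lbrace>cj A u (\<iota> b), cj A u (\<iota> a')\<rbrace>\<^bsub>A\<^esub> = \<one>\<^bsub>A\<^esub>"
      using a'(1) by (simp flip: A.lie_conj)
    then have "\<iota> \<lbrace>?s, a\<rbrace>\<^bsub>I\<^esub> = \<iota> \<one>\<^bsub>I\<^esub>" using s a a' by simp
    then show "\<lbrace>?s, a\<rbrace>\<^bsub>I\<^esub> = \<one>\<^bsub>I\<^esub>" using s a I.lie_closed by (metis I.one_closed incl_eq_iff)
  qed (rule s)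
  have one: "\<lbrace>\<iota> c, \<iota> a\<rbrace>\<^bsub>A\<^esub> = \<one>\<^bsub>A\<^esub>" if "c \<in> I.Z" "a \<in> carrier I" for c a
    using I.Z_lie(1) [OF that] that by (simp add: I.Z_carrier flip: incl_lie)
  have one': "\<lbrace>\<iota> a, \<iota> c\<rbrace>\<^bsub>A\<^esub> = \<one>\<^bsub>A\<^esub>" if "c \<in> I.Z" "a \<in> carrier I" for c a
    using I.Z_lie(2) [OF that] that by (simp add: I.Z_carrier flip: incl_lie)
  show tZ: "?t \<in> I.Z"
  proof (rule I.ZI)
    fix a assume a: "a \<in> carrier I"
    \<comment> \<open>Conjugation by a bracket is bracketing with a commutator, which here is central.\<close>
    have "u \<otimes>\<^bsub>A\<^esub> \<iota> b \<otimes>\<^bsub>A\<^esub> inv\<^bsub>A\<^esub> u \<otimes>\<^bsub>A\<^esub> inv\<^bsub>A\<^esub> (\<iota> b) = \<iota> (?s \<otimes>\<^bsub>I\<^esub> inv\<^bsub>I\<^esub> b)"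
      using s by (simp add: cj_def)
    moreover have "?s \<otimes>\<^bsub>I\<^esub> inv\<^bsub>I\<^esub> b \<in> I.Z"
      using sZ b I.subgroup_Z by (simp add: subgroup.m_closed subgroup.m_inv_closed)
    ultimately have "\<lbrace>u, \<iota> b\<rbrace>\<^bsub>A\<^esub> \<otimes>\<^bsub>A\<^esub> \<iota> a \<otimes>\<^bsub>A\<^esub> inv\<^bsub>A\<^esub> \<lbrace>u, \<iota> b\<rbrace>\<^bsub>A\<^esub> \<otimes>\<^bsub>A\<^esub> inv\<^bsub>A\<^esub> (\<iota> a) = \<one>\<^bsub>A\<^esub>"
      using A.lie_commutator [of u "\<iota> b" "\<iota> a"] one a by simp
    then have "cj A \<lbrace>u, \<iota> b\<rbrace>\<^bsub>A\<^esub> (\<iota> a) = \<iota> a"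
      using a by (metis A.cj_closed A.inv_equality A.inv_inv A.lie_closed \<open>u \<in> carrier A\<close>
          cj_def incl.hom_closed A.inv_closed I.Z_carrier b)
    then have "\<iota> (?t \<otimes>\<^bsub>I\<^esub> a) = \<iota> (a \<otimes>\<^bsub>I\<^esub> ?t)"
      using t a by (simp add: A.cj_eq_self_iff)
    then show "?t \<otimes>\<^bsub>I\<^esub> a = a \<otimes>\<^bsub>I\<^esub> ?t"
      by (subst (asm) incl_eq_iff) (use t a in auto)
    have "cj A (\<iota> b) (\<iota> a) = \<iota> a"
      using I.Z_comm [OF b a] a by (simp add: A.cj_eq_self_iff flip: incl.hom_mult)
    moreover have "\<lbrace>\<lbrace>\<iota> a, u\<rbrace>\<^bsub>A\<^esub>, cj A u (\<iota> b)\<rbrace>\<^bsub>A\<^esub> = \<one>\<^bsub>A\<^esub>"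
      using one' [OF sZ, of "incl_inv I E \<lbrace>\<iota> a, u\<rbrace>\<^bsub>A\<^esub>"] s a by (simp add: incl_inv_closed)
    ultimately have "\<iota> \<lbrace>?t, a\<rbrace>\<^bsub>I\<^esub> = \<one>\<^bsub>A\<^esub>"
      using A.lie_jacobi [of u "\<iota> b" "\<iota> a"] one [OF b a] t a by simp
    then show "\<lbrace>?t, a\<rbrace>\<^bsub>I\<^esub> = \<one>\<^bsub>I\<^esub>"
      using t a I.lie_closed by (metis I.one_closed incl_eq_iff incl.hom_one)
  qed (rule t)
  have "\<lbrace>\<iota> b, u\<rbrace>\<^bsub>A\<^esub> = \<iota> (inv\<^bsub>I\<^esub> ?t)" using t A.lie_antisym [of u "\<iota> b"] by simp
  then have "?n = inv\<^bsub>I\<^esub> ?t" using t(1) by (simp only: incl_inv_incl I.inv_closed)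
  then show "?n \<in> I.Z" using tZ I.subgroup_Z by (simp add: subgroup.m_inv_closed)
qed

end

text \<open>
  An isomorphism inducing the identity on \<open>I\<close> and \<open>Q\<close>, for structures
  that need not be known to be extensions. Closure of the source under the operations is part of
  the definition, which makes the relation symmetric.
\<close>

definition ext_iso ::
    "'i mla \<Rightarrow> ('i, 'a, 'q) mla_ext \<Rightarrow> ('i, 'b, 'q) mla_ext \<Rightarrow> ('a \<Rightarrow> 'b) \<Rightarrow> bool" where
  "ext_iso I E E' f \<longleftrightarrow>
     bij_betw f (carrier (mid E)) (carrier (mid E')) \<and>
     (\<forall>u \<in> carrier (mid E). \<forall>v \<in> carrier (mid E).
        u \<otimes>\<^bsub>mid E\<^esub> v \<in> carrier (mid E) \<and> f (u \<otimes>\<^bsub>mid E\<^esub> v) = f u \<otimes>\<^bsub>mid E'\<^esub> f v \<and>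
        \<lbrace>u, v\<rbrace>\<^bsub>mid E\<^esub> \<in> carrier (mid E) \<and> f \<lbrace>u, v\<rbrace>\<^bsub>mid E\<^esub> = \<lbrace>f u, f v\<rbrace>\<^bsub>mid E'\<^esub>) \<and>
     \<one>\<^bsub>mid E\<^esub> \<in> carrier (mid E) \<and> f \<one>\<^bsub>mid E\<^esub> = \<one>\<^bsub>mid E'\<^esub> \<and>
     (\<forall>a \<in> carrier I. incl E a \<in> carrier (mid E) \<and> f (incl E a) = incl E' a) \<and>
     (\<forall>u \<in> carrier (mid E). proj E' (f u) = proj E u)"

lemma ext_isoD:
  assumes "ext_iso I E E' f"
  shows "bij_betw f (carrier (mid E)) (carrier (mid E'))"
    "u \<in> carrier (mid E) \<Longrightarrow> f u \<in> carrier (mid E')"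
    "u \<in> carrier (mid E) \<Longrightarrow> v \<in> carrier (mid E) \<Longrightarrow> u \<otimes>\<^bsub>mid E\<^esub> v \<in> carrier (mid E)"
    "u \<in> carrier (mid E) \<Longrightarrow> v \<in> carrier (mid E) \<Longrightarrow> f (u \<otimes>\<^bsub>mid E\<^esub> v) = f u \<otimes>\<^bsub>mid E'\<^esub> f v"
    "u \<in> carrier (mid E) \<Longrightarrow> v \<in> carrier (mid E) \<Longrightarrow> \<lbrace>u, v\<rbrace>\<^bsub>mid E\<^esub> \<in> carrier (mid E)"
    "u \<in> carrier (mid E) \<Longrightarrow> v \<in> carrier (mid E) \<Longrightarrow> f \<lbrace>u, v\<rbrace>\<^bsub>mid E\<^esub> = \<lbrace>f u, f v\<rbrace>\<^bsub>mid E'\<^esub>"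
    "\<one>\<^bsub>mid E\<^esub> \<in> carrier (mid E)" "f \<one>\<^bsub>mid E\<^esub> = \<one>\<^bsub>mid E'\<^esub>"
    "a \<in> carrier I \<Longrightarrow> incl E a \<in> carrier (mid E)"
    "a \<in> carrier I \<Longrightarrow> f (incl E a) = incl E' a"
    "u \<in> carrier (mid E) \<Longrightarrow> proj E' (f u) = proj E u"
  using assms by (auto simp: ext_iso_def bij_betw_def)

lemma ext_iso_sym:
  assumes f: "ext_iso I E E' f"
  shows "ext_iso I E' E (inv_into (carrier (mid E)) f)"
proof -
  let ?g = "inv_into (carrier (mid E)) f"
  note bij = ext_isoD(1) [OF f]
  note left = bij_betw_inv_into_left [OF bij]
  have im: "carrier (mid E') = f ` carrier (mid E)" using bij by (simp add: bij_betw_def)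
  note D = ext_isoD(2-) [OF f]
  have mult: "u \<otimes>\<^bsub>mid E'\<^esub> v \<in> carrier (mid E') \<and> ?g (u \<otimes>\<^bsub>mid E'\<^esub> v) = ?g u \<otimes>\<^bsub>mid E\<^esub> ?g v"
    and lie: "\<lbrace>u, v\<rbrace>\<^bsub>mid E'\<^esub> \<in> carrier (mid E') \<and> ?g \<lbrace>u, v\<rbrace>\<^bsub>mid E'\<^esub> = \<lbrace>?g u, ?g v\<rbrace>\<^bsub>mid E\<^esub>"
    if uv: "u \<in> carrier (mid E')" "v \<in> carrier (mid E')" for u v
  proof -
    obtain a b where "a \<in> carrier (mid E)" "b \<in> carrier (mid E)" "u = f a" "v = f b"
      using uv im by auto
    then show "u \<otimes>\<^bsub>mid E'\<^esub> v \<in> carrier (mid E') \<and> ?g (u \<otimes>\<^bsub>mid E'\<^esub> v) = ?g u \<otimes>\<^bsub>mid E\<^esub> ?g v"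
      and "\<lbrace>u, v\<rbrace>\<^bsub>mid E'\<^esub> \<in> carrier (mid E') \<and> ?g \<lbrace>u, v\<rbrace>\<^bsub>mid E'\<^esub> = \<lbrace>?g u, ?g v\<rbrace>\<^bsub>mid E\<^esub>"
      by (simp_all add: left D(1,2,4) flip: D(3,5))
  qed
  have "proj E (?g u) = proj E' u" if "u \<in> carrier (mid E')" for u
    using that im by (auto simp: left D)
  moreover have "incl E' a \<in> carrier (mid E')" "?g (incl E' a) = incl E a" if "a \<in> carrier I" for a
    using D(1) [OF D(8) [OF that]] D(9) [OF that] left [OF D(8) [OF that]] by simp_all
  moreover have "\<one>\<^bsub>mid E'\<^esub> \<in> carrier (mid E')" "?g \<one>\<^bsub>mid E'\<^esub> = \<one>\<^bsub>mid E\<^esub>"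
    using D(1) [OF D(6)] D(7) left [OF D(6)] by simp_all
  ultimately show ?thesis
    unfolding ext_iso_def using bij_betw_inv_into [OF bij] mult lie by blast
qed

lemma ext_iso_trans:
  assumes f: "ext_iso I E E' f" and g: "ext_iso I E' E'' g"
  shows "ext_iso I E E'' (g \<circ> f)"
  using ext_isoD(2-) [OF f] ext_isoD(2-) [OF g]
    bij_betw_trans [OF ext_isoD(1) [OF f] ext_isoD(1) [OF g]]
  unfolding ext_iso_def by (intro conjI ballI) simp_all

lemma ext_equivI: "ext_iso I E E' f \<Longrightarrow> ext_equiv I E E'"
  unfolding ext_equiv_def
  by (rule exI [of _ f]) (auto simp: mla_hom_def hom_def dest: ext_isoD)

lemma ext_equivE:
  assumes "ext_equiv I E E'" "extension I Q E" "extension I Q E'"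
  obtains f where "ext_iso I E E' f"
proof -
  obtain f where f: "f \<in> mla_hom (mid E) (mid E')" "bij_betw f (carrier (mid E)) (carrier (mid E'))"
    "\<forall>a \<in> carrier I. f (incl E a) = incl E' a" "\<forall>u \<in> carrier (mid E). proj E' (f u) = proj E u"
    using assms(1) by (auto simp: ext_equiv_def)
  interpret E: mla_extension I Q E by unfold_locales fact
  interpret E': mla_extension I Q E' by unfold_locales fact
  have "f \<one>\<^bsub>mid E\<^esub> = \<one>\<^bsub>mid E'\<^esub>"
    using f(3) by (metis E.incl.hom_one E'.incl.hom_one E.I.one_closed)
  then have "ext_iso I E E' f"
    using f by (auto simp: ext_iso_def mla_hom_def hom_def E.A.lie_closed)
  then show ?thesis using that by blast
qed

text \<open>
  The source need not be known to be a group: this is how structures such as $I \rtimes_T Q$ are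
  shown to be extensions.
\<close>

lemma extension_iso:
  assumes f: "ext_iso I E E' f" and E': "extension I Q E'"
  shows "extension I Q E"
proof -
  interpret E': mla_extension I Q E' by unfold_locales fact
  note D = ext_isoD(2-) [OF f]
  note bij = ext_isoD(1) [OF f]
  have inj: "u = v" if "f u = f v" "u \<in> carrier (mid E)" "v \<in> carrier (mid E)" for u v
    using that bij by (auto simp: bij_betw_def inj_on_def)
  have A: "mult_lie_algebra (mid E)"
    by (rule mult_lie_algebra_iso [OF E'.A.mult_lie_algebra_axioms bij]) (simp_all add: D)
  have incl: "incl E \<in> mla_hom I (mid E)"
    unfolding mla_hom_def hom_def
    by (auto intro!: inj simp: D E'.I.lie_closed)
  have proj: "proj E \<in> mla_hom (mid E) Q"
    unfolding mla_hom_def hom_def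
    by (auto simp: D simp flip: D(10))
  have "inj_on (incl E) (carrier I)"
    by (rule inj_onI) (metis D(9) E'.incl_eq_iff)
  moreover have "proj E ` carrier (mid E) = proj E' ` f ` carrier (mid E)"
    by (auto simp: D image_image)
  then have "proj E ` carrier (mid E) = carrier Q"
    using bij E' by (simp add: bij_betw_def extension_def)
  moreover have "incl E ` carrier I = kernel (mid E) Q (proj E)"
  proof
    show "incl E ` carrier I \<subseteq> kernel (mid E) Q (proj E)"
    proof
      fix u assume "u \<in> incl E ` carrier I"
      then obtain a where a: "a \<in> carrier I" "u = incl E a" by blast
      then show "u \<in> kernel (mid E) Q (proj E)"
        using D(8) [OF a(1)] D(9) [OF a(1)] D(10) [OF D(8) [OF a(1)]] by (simp add: kernel_def)
    qed
    show "kernel (mid E) Q (proj E) \<subseteq> incl E ` carrier I"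
    proof
      fix u assume "u \<in> kernel (mid E) Q (proj E)"
      then have u: "u \<in> carrier (mid E)" "proj E' (f u) = \<one>\<^bsub>Q\<^esub>" by (auto simp: kernel_def D)
      then obtain a where "a \<in> carrier I" "f u = incl E' a" by (meson D(1) E'.proj_oneE)
      then have "u = incl E a" using u by (intro inj) (simp_all add: D)
      then show "u \<in> incl E ` carrier I" using \<open>a \<in> carrier I\<close> by blast
    qed
  qed
  ultimately show ?thesis
    using A incl proj E' by (simp add: extension_def)
qed

section \<open>Twisting an extension by a central cochain\<close>

text \<open>
  The normalized pairs among which the compatible cocycles are singled out; the operations are
  those of \<^const>\<open>Z2\<close>, so \<open>Z2\<close> is a subgroup.
\<close>

definition cochains :: "'i mla \<Rightarrow> 'q mla \<Rightarrow> (('q \<times> 'q \<Rightarrow> 'i) \<times> ('q \<times> 'q \<Rightarrow> 'i)) monoid" where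
  "cochains B Q =
     \<lparr>carrier = {(S, S\<^sub>f).
        S \<in> carrier Q \<times> carrier Q \<rightarrow>\<^sub>E carrier B \<and>
        S\<^sub>f \<in> carrier Q \<times> carrier Q \<rightarrow>\<^sub>E carrier B \<and>
        (\<forall>x \<in> carrier Q. S (x, \<one>\<^bsub>Q\<^esub>) = \<one>\<^bsub>B\<^esub> \<and> S (\<one>\<^bsub>Q\<^esub>, x) = \<one>\<^bsub>B\<^esub> \<and>
           S\<^sub>f (x, x) = \<one>\<^bsub>B\<^esub> \<and> S\<^sub>f (x, \<one>\<^bsub>Q\<^esub>) = \<one>\<^bsub>B\<^esub> \<and> S\<^sub>f (\<one>\<^bsub>Q\<^esub>, x) = \<one>\<^bsub>B\<^esub>)},
      mult = (\<lambda>(S, S\<^sub>f) (R, R\<^sub>f).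
        (\<lambda>p \<in> carrier Q \<times> carrier Q. S p \<otimes>\<^bsub>B\<^esub> R p,
         \<lambda>p \<in> carrier Q \<times> carrier Q. S\<^sub>f p \<otimes>\<^bsub>B\<^esub> R\<^sub>f p)),
      one = (\<lambda>p \<in> carrier Q \<times> carrier Q. \<one>\<^bsub>B\<^esub>, \<lambda>p \<in> carrier Q \<times> carrier Q. \<one>\<^bsub>B\<^esub>)\<rparr>"

text \<open>
  If \<open>R\<close> is the cocycle of a section of \<open>E\<close>, this is
  $I \rtimes_{R \ast S} Q$ transported to the middle term of \<open>E\<close>; the description needs no choice
  of a section.
\<close>

definition twist_ext :: "('i, 'a, 'q) mla_ext \<Rightarrow> ('q \<times> 'q \<Rightarrow> 'i) \<times> ('q \<times> 'q \<Rightarrow> 'i) \<Rightarrow>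
    ('i, 'a, 'q) mla_ext" where
  "twist_ext E S = E\<lparr>mid :=
     \<lparr>carrier = carrier (mid E),
      mult = (\<lambda>u v. incl E (fst S (proj E u, proj E v)) \<otimes>\<^bsub>mid E\<^esub> (u \<otimes>\<^bsub>mid E\<^esub> v)),
      one = \<one>\<^bsub>mid E\<^esub>,
      lie = (\<lambda>u v. incl E (snd S (proj E u, proj E v)) \<otimes>\<^bsub>mid E\<^esub> \<lbrace>u, v\<rbrace>\<^bsub>mid E\<^esub>)\<rparr>\<rparr>"

lemma twist_ext_simps [simp]:
  "carrier (mid (twist_ext E S)) = carrier (mid E)"
  "u \<otimes>\<^bsub>mid (twist_ext E S)\<^esub> v =
    incl E (fst S (proj E u, proj E v)) \<otimes>\<^bsub>mid E\<^esub> (u \<otimes>\<^bsub>mid E\<^esub> v)"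
  "\<one>\<^bsub>mid (twist_ext E S)\<^esub> = \<one>\<^bsub>mid E\<^esub>"
  "\<lbrace>u, v\<rbrace>\<^bsub>mid (twist_ext E S)\<^esub> =
    incl E (snd S (proj E u, proj E v)) \<otimes>\<^bsub>mid E\<^esub> \<lbrace>u, v\<rbrace>\<^bsub>mid E\<^esub>"
  "incl (twist_ext E S) = incl E"
  "proj (twist_ext E S) = proj E"
  by (simp_all add: twist_ext_def)

lemma abelian_twisted_simps [simp]:
  "carrier (abelian_twisted B Q \<chi> S S') = carrier B \<times> carrier Q"
  "(a, x) \<otimes>\<^bsub>abelian_twisted B Q \<chi> S S'\<^esub> (b, y) =
    (a \<otimes>\<^bsub>B\<^esub> sigma \<chi> x b \<otimes>\<^bsub>B\<^esub> S (x, y), x \<otimes>\<^bsub>Q\<^esub> y)"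
  "\<one>\<^bsub>abelian_twisted B Q \<chi> S S'\<^esub> = (\<one>\<^bsub>B\<^esub>, \<one>\<^bsub>Q\<^esub>)"
  "\<lbrace>(a, x), (b, y)\<rbrace>\<^bsub>abelian_twisted B Q \<chi> S S'\<^esub> =
    (lie_term B Q \<chi> a x b y \<otimes>\<^bsub>B\<^esub> S' (x, y), \<lbrace>x, y\<rbrace>\<^bsub>Q\<^esub>)"
  by (simp_all add: abelian_twisted_def)

text \<open>
  The action of \<open>Q\<close> on the center, expressed through all elements of the middle
  term instead of a section. In this form it passes to twisted and relabelled extensions with
  unchanged \<open>\<chi>\<close>.
\<close>

locale central_action = mla_extension I Q E
  for I :: "'i mla" and Q :: "'q mla" and E :: "('i, 'a, 'q) mla_ext" +
  fixes \<chi> :: "('i, 'q) act_terms"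
  assumes act: "\<lbrakk>u \<in> carrier (mid E); b \<in> carrier (alg_center I)\<rbrakk> \<Longrightarrow>
      sigma \<chi> (proj E u) b \<in> carrier (alg_center I) \<and>
      tau \<chi> (proj E u) b \<in> carrier (alg_center I) \<and>
      nu \<chi> (proj E u) b \<in> carrier (alg_center I) \<and>
      incl E (sigma \<chi> (proj E u) b) = cj (mid E) u (incl E b) \<and>
      incl E (tau \<chi> (proj E u) b) = \<lbrace>u, incl E b\<rbrace>\<^bsub>mid E\<^esub> \<and>
      incl E (nu \<chi> (proj E u) b) = \<lbrace>incl E b, u\<rbrace>\<^bsub>mid E\<^esub>"
begin

lemma Z_in_I [simp]: "b \<in> carrier B \<Longrightarrow> b \<in> carrier I"
  by (rule I.Z_carrier)

lemma act_closed [simp]: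
  assumes "x \<in> carrier Q" "b \<in> carrier B"
  shows "sigma \<chi> x b \<in> carrier B" "tau \<chi> x b \<in> carrier B" "nu \<chi> x b \<in> carrier B"
  using proj_surjE [OF assms(1)] act assms(2) by metis+

lemma incl_act:
  assumes "u \<in> carrier A" "b \<in> carrier B"
  shows "\<iota> (sigma \<chi> (\<pi> u) b) = cj A u (\<iota> b)" "\<iota> (tau \<chi> (\<pi> u) b) = \<lbrace>u, \<iota> b\<rbrace>\<^bsub>A\<^esub>"
    "\<iota> (nu \<chi> (\<pi> u) b) = \<lbrace>\<iota> b, u\<rbrace>\<^bsub>A\<^esub>"
  using act [OF assms] by simp_all

lemma Z_closed [simp]:
  "b \<in> carrier B \<Longrightarrow> c \<in> carrier B \<Longrightarrow> b \<otimes>\<^bsub>I\<^esub> c \<in> carrier B"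
  "b \<in> carrier B \<Longrightarrow> inv\<^bsub>I\<^esub> b \<in> carrier B" "\<one>\<^bsub>I\<^esub> \<in> carrier B"
  using I.subgroup_Z by (simp_all add: subgroup.m_closed subgroup.m_inv_closed subgroup.one_closed)

lemmas Z_ac = B.m_assoc [simplified] B.m_comm [simplified] B.m_lcomm [simplified]

lemma incl_Z_comm:
  assumes "b \<in> carrier B" "a \<in> carrier I"
  shows "\<iota> a \<otimes>\<^bsub>A\<^esub> \<iota> b = \<iota> b \<otimes>\<^bsub>A\<^esub> \<iota> a"
  using assms I.Z_comm [of b a] by (simp flip: incl.hom_mult)

lemma sigma_mult:
  assumes x: "x \<in> carrier Q" and b: "b \<in> carrier B" "c \<in> carrier B"
  shows "sigma \<chi> x (b \<otimes>\<^bsub>I\<^esub> c) = sigma \<chi> x b \<otimes>\<^bsub>I\<^esub> sigma \<chi> x c"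
proof -
  obtain u where u: "u \<in> carrier A" "\<pi> u = x" using proj_surjE [OF x] by blast
  have "\<iota> (sigma \<chi> (\<pi> u) (b \<otimes>\<^bsub>I\<^esub> c)) = \<iota> (sigma \<chi> (\<pi> u) b \<otimes>\<^bsub>I\<^esub> sigma \<chi> (\<pi> u) c)"
    using u(1) b by (simp add: incl_act A.cj_mult)
  then show ?thesis by (subst (asm) incl_eq_iff) (use u b in auto)
qed

lemma tau_mult:
  assumes x: "x \<in> carrier Q" and b: "b \<in> carrier B" "c \<in> carrier B"
  shows "tau \<chi> x (b \<otimes>\<^bsub>I\<^esub> c) = tau \<chi> x b \<otimes>\<^bsub>I\<^esub> tau \<chi> x c"
proof -
  obtain u where u: "u \<in> carrier A" "\<pi> u = x" using proj_surjE [OF x] by blast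
  have "cj I b (tau \<chi> x c) = tau \<chi> x c" using x b by (intro I.Z_cj) auto
  then have "\<iota> (tau \<chi> (\<pi> u) (b \<otimes>\<^bsub>I\<^esub> c)) = \<iota> (tau \<chi> (\<pi> u) b \<otimes>\<^bsub>I\<^esub> cj I b (tau \<chi> (\<pi> u) c))"
    using u(1) b by (simp add: incl_act A.lie_mult_right)
  also have "cj I b (tau \<chi> (\<pi> u) c) = tau \<chi> (\<pi> u) c" using u b by (intro I.Z_cj) auto
  finally show ?thesis by (subst (asm) incl_eq_iff) (use u b in auto)
qed

lemma nu_mult:
  assumes x: "x \<in> carrier Q" and b: "b \<in> carrier B" "c \<in> carrier B"
  shows "nu \<chi> x (b \<otimes>\<^bsub>I\<^esub> c) = nu \<chi> x b \<otimes>\<^bsub>I\<^esub> nu \<chi> x c"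
proof -
  obtain u where u: "u \<in> carrier A" "\<pi> u = x" using proj_surjE [OF x] by blast
  have "\<iota> (nu \<chi> (\<pi> u) (b \<otimes>\<^bsub>I\<^esub> c)) = \<iota> (cj I b (nu \<chi> (\<pi> u) c) \<otimes>\<^bsub>I\<^esub> nu \<chi> (\<pi> u) b)"
    using u(1) b by (simp add: incl_act A.lie_mult_left)
  also have "cj I b (nu \<chi> (\<pi> u) c) = nu \<chi> (\<pi> u) c" using u b by (intro I.Z_cj) auto
  also have "nu \<chi> (\<pi> u) c \<otimes>\<^bsub>I\<^esub> nu \<chi> (\<pi> u) b = nu \<chi> (\<pi> u) b \<otimes>\<^bsub>I\<^esub> nu \<chi> (\<pi> u) c"
    using u b by (intro I.Z_comm) auto
  finally show ?thesis by (subst (asm) incl_eq_iff) (use u b in auto)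
qed

lemma sigma_one_left [simp]: "b \<in> carrier B \<Longrightarrow> sigma \<chi> \<one>\<^bsub>Q\<^esub> b = b"
  using incl_act(1) [of "\<one>\<^bsub>A\<^esub>" b] act_closed(1) [of "\<one>\<^bsub>Q\<^esub>" b] by simp

lemma sigma_sigma:
  assumes x: "x \<in> carrier Q" "y \<in> carrier Q" and b: "b \<in> carrier B"
  shows "sigma \<chi> x (sigma \<chi> y b) = sigma \<chi> (x \<otimes>\<^bsub>Q\<^esub> y) b"
proof -
  obtain u v where u: "u \<in> carrier A" "\<pi> u = x" "v \<in> carrier A" "\<pi> v = y"
    using proj_surjE [OF x(1)] proj_surjE [OF x(2)] by metis
  have "\<iota> (sigma \<chi> (\<pi> u) (sigma \<chi> (\<pi> v) b)) = \<iota> (sigma \<chi> (\<pi> (u \<otimes>\<^bsub>A\<^esub> v)) b)"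
    using u(1,3) b by (simp add: incl_act A.cj_cj del: proj.hom_mult)
  then show ?thesis by (subst (asm) incl_eq_iff) (use u b in auto)
qed

lemma sigma_one [simp]: "x \<in> carrier Q \<Longrightarrow> sigma \<chi> x \<one>\<^bsub>I\<^esub> = \<one>\<^bsub>I\<^esub>"
  using sigma_mult [of x "\<one>\<^bsub>I\<^esub>" "\<one>\<^bsub>I\<^esub>"] by simp

lemma tau_one [simp]: "x \<in> carrier Q \<Longrightarrow> tau \<chi> x \<one>\<^bsub>I\<^esub> = \<one>\<^bsub>I\<^esub>"
  using tau_mult [of x "\<one>\<^bsub>I\<^esub>" "\<one>\<^bsub>I\<^esub>"] by simp

lemma nu_one [simp]: "x \<in> carrier Q \<Longrightarrow> nu \<chi> x \<one>\<^bsub>I\<^esub> = \<one>\<^bsub>I\<^esub>"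
  using nu_mult [of x "\<one>\<^bsub>I\<^esub>" "\<one>\<^bsub>I\<^esub>"] by simp

abbreviation lt where "lt \<equiv> lie_term B Q \<chi>"

lemma lt_eq:
  assumes "c \<in> carrier B" "d \<in> carrier B"
  shows "lt c x d y = tau \<chi> x d \<otimes>\<^bsub>I\<^esub> c \<otimes>\<^bsub>I\<^esub> d \<otimes>\<^bsub>I\<^esub>
    sigma \<chi> \<lbrace>x, y\<rbrace>\<^bsub>Q\<^esub> (nu \<chi> y c \<otimes>\<^bsub>I\<^esub> inv\<^bsub>I\<^esub> c \<otimes>\<^bsub>I\<^esub> inv\<^bsub>I\<^esub> d)"
  using assms by (simp add: lie_term_def I.inv_Z)

lemma lt_closed [simp]:
  assumes "x \<in> carrier Q" "y \<in> carrier Q" "c \<in> carrier B" "d \<in> carrier B"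
  shows "lt c x d y \<in> carrier B"
  using assms by (simp add: lt_eq Q.lie_closed)

lemma lt_mult:
  assumes [simp]: "x \<in> carrier Q" "y \<in> carrier Q" "c \<in> carrier B" "d \<in> carrier B"
    "c' \<in> carrier B" "d' \<in> carrier B"
  shows "lt (c \<otimes>\<^bsub>I\<^esub> c') x (d \<otimes>\<^bsub>I\<^esub> d') y = lt c x d y \<otimes>\<^bsub>I\<^esub> lt c' x d' y"
  by (simp add: lt_eq sigma_mult tau_mult nu_mult Q.lie_closed I.inv_mult_group Z_ac)

lemma lt_one [simp]:
  assumes "x \<in> carrier Q" "y \<in> carrier Q"
  shows "lt \<one>\<^bsub>I\<^esub> x \<one>\<^bsub>I\<^esub> y = \<one>\<^bsub>I\<^esub>"
  using assms by (simp add: lt_eq Q.lie_closed)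

lemma central_mult:
  assumes [simp]: "u \<in> carrier A" "v \<in> carrier A" "c \<in> carrier B" "d \<in> carrier B"
  shows "(\<iota> c \<otimes>\<^bsub>A\<^esub> u) \<otimes>\<^bsub>A\<^esub> (\<iota> d \<otimes>\<^bsub>A\<^esub> v) = \<iota> (c \<otimes>\<^bsub>I\<^esub> sigma \<chi> (\<pi> u) d) \<otimes>\<^bsub>A\<^esub> (u \<otimes>\<^bsub>A\<^esub> v)"
  by (simp add: incl_act cj_def A.group_word)

text \<open>
  In the sorted expansion everything before the last factor lies in \<open>B\<close>, so it can
  be reordered.
\<close>

lemma central_lie:
  assumes [simp]: "u \<in> carrier A" "v \<in> carrier A" "c \<in> carrier B" "d \<in> carrier B"
  shows "\<lbrace>\<iota> c \<otimes>\<^bsub>A\<^esub> u, \<iota> d \<otimes>\<^bsub>A\<^esub> v\<rbrace>\<^bsub>A\<^esub> = \<iota> (lt c (\<pi> u) d (\<pi> v)) \<otimes>\<^bsub>A\<^esub> \<lbrace>u, v\<rbrace>\<^bsub>A\<^esub>"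
proof -
  have 1: "cj A (\<iota> c) \<lbrace>u, \<iota> d\<rbrace>\<^bsub>A\<^esub> = \<lbrace>u, \<iota> d\<rbrace>\<^bsub>A\<^esub>"
    using I.Z_cj [of "tau \<chi> (\<pi> u) d" c] by (simp flip: incl_act(2) incl_cj)
  have 2: "\<lbrace>\<iota> c, \<iota> d\<rbrace>\<^bsub>A\<^esub> = \<one>\<^bsub>A\<^esub>"
    using I.Z_lie(1) [of c d] by (simp flip: incl_lie)
  have 3: "inv\<^bsub>A\<^esub> (\<iota> c) \<otimes>\<^bsub>A\<^esub> \<lbrace>\<iota> c, v\<rbrace>\<^bsub>A\<^esub> \<otimes>\<^bsub>A\<^esub> inv\<^bsub>A\<^esub> (\<iota> d) =
    \<iota> (nu \<chi> (\<pi> v) c \<otimes>\<^bsub>I\<^esub> inv\<^bsub>I\<^esub> c \<otimes>\<^bsub>I\<^esub> inv\<^bsub>I\<^esub> d)"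
    using incl_Z_comm [of "inv\<^bsub>I\<^esub> c" "nu \<chi> (\<pi> v) c"] by (simp add: incl_act)
  have 4: "\<iota> d \<otimes>\<^bsub>A\<^esub> \<iota> c = \<iota> c \<otimes>\<^bsub>A\<^esub> \<iota> d" by (rule incl_Z_comm) auto
  have "\<lbrace>\<iota> c \<otimes>\<^bsub>A\<^esub> u, \<iota> d \<otimes>\<^bsub>A\<^esub> v\<rbrace>\<^bsub>A\<^esub> = \<lbrace>u, \<iota> d\<rbrace>\<^bsub>A\<^esub> \<otimes>\<^bsub>A\<^esub> (\<iota> c \<otimes>\<^bsub>A\<^esub> \<iota> d) \<otimes>\<^bsub>A\<^esub>
    cj A \<lbrace>u, v\<rbrace>\<^bsub>A\<^esub> (\<iota> (nu \<chi> (\<pi> v) c \<otimes>\<^bsub>I\<^esub> inv\<^bsub>I\<^esub> c \<otimes>\<^bsub>I\<^esub> inv\<^bsub>I\<^esub> d)) \<otimes>\<^bsub>A\<^esub> \<lbrace>u, v\<rbrace>\<^bsub>A\<^esub>"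
    unfolding A.lie_expand_sorted [OF incl.hom_closed [OF Z_in_I [OF assms(3)]] assms(1)
        incl.hom_closed [OF Z_in_I [OF assms(4)]] assms(2)] 1 2 3
    using 4 by (simp add: A.lie_closed A.m_assoc)
  also have "cj A \<lbrace>u, v\<rbrace>\<^bsub>A\<^esub> (\<iota> (nu \<chi> (\<pi> v) c \<otimes>\<^bsub>I\<^esub> inv\<^bsub>I\<^esub> c \<otimes>\<^bsub>I\<^esub> inv\<^bsub>I\<^esub> d)) =
    \<iota> (sigma \<chi> (\<pi> \<lbrace>u, v\<rbrace>\<^bsub>A\<^esub>) (nu \<chi> (\<pi> v) c \<otimes>\<^bsub>I\<^esub> inv\<^bsub>I\<^esub> c \<otimes>\<^bsub>I\<^esub> inv\<^bsub>I\<^esub> d))"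
    by (rule incl_act(1) [symmetric]) (auto simp: A.lie_closed)
  finally show ?thesis
    by (simp add: lt_eq incl_act(2) Q.lie_closed A.m_assoc A.lie_closed)
qed

lemma cochainsD:
  assumes "S \<in> carrier (cochains B Q)" "x \<in> carrier Q"
  shows "y \<in> carrier Q \<Longrightarrow> fst S (x, y) \<in> carrier B"
    "y \<in> carrier Q \<Longrightarrow> snd S (x, y) \<in> carrier B"
    "fst S (x, \<one>\<^bsub>Q\<^esub>) = \<one>\<^bsub>I\<^esub>" "fst S (\<one>\<^bsub>Q\<^esub>, x) = \<one>\<^bsub>I\<^esub>"
    "snd S (x, x) = \<one>\<^bsub>I\<^esub>" "snd S (x, \<one>\<^bsub>Q\<^esub>) = \<one>\<^bsub>I\<^esub>" "snd S (\<one>\<^bsub>Q\<^esub>, x) = \<one>\<^bsub>I\<^esub>"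
  using assms by (auto simp: cochains_def)

lemma Z2_iff_abelian:
  "S \<in> carrier (Z2 B Q \<chi>) \<longleftrightarrow>
    S \<in> carrier (cochains B Q) \<and> mult_lie_algebra (abelian_twisted B Q \<chi> (fst S) (snd S))"
  by (cases S) (auto simp: Z2_def cochains_def)

abbreviation twisted where "twisted S \<equiv> mid (twist_ext E S)"
abbreviation abel where "abel S \<equiv> abelian_twisted B Q \<chi> (fst S) (snd S)"

text \<open>
  The coefficients are the first components of the product and of the bracket of $\langle
  c,\pi(u)\rangle$ and $\langle d,\pi(v)\rangle$ in $B \rtimes_S Q$.
\<close>

lemma twist_shift:
  assumes S: "S \<in> carrier (cochains B Q)"
    and [simp]: "u \<in> carrier A" "v \<in> carrier A" "c \<in> carrier B" "d \<in> carrier B"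
  shows "(\<iota> c \<otimes>\<^bsub>A\<^esub> u) \<otimes>\<^bsub>twisted S\<^esub> (\<iota> d \<otimes>\<^bsub>A\<^esub> v) =
      \<iota> (c \<otimes>\<^bsub>I\<^esub> sigma \<chi> (\<pi> u) d \<otimes>\<^bsub>I\<^esub> fst S (\<pi> u, \<pi> v)) \<otimes>\<^bsub>A\<^esub> (u \<otimes>\<^bsub>A\<^esub> v)"
    and "\<lbrace>\<iota> c \<otimes>\<^bsub>A\<^esub> u, \<iota> d \<otimes>\<^bsub>A\<^esub> v\<rbrace>\<^bsub>twisted S\<^esub> =
      \<iota> (lt c (\<pi> u) d (\<pi> v) \<otimes>\<^bsub>I\<^esub> snd S (\<pi> u, \<pi> v)) \<otimes>\<^bsub>A\<^esub> \<lbrace>u, v\<rbrace>\<^bsub>A\<^esub>"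
proof -
  have [simp]: "\<pi> u \<in> carrier Q" "\<pi> v \<in> carrier Q" by simp_all
  note [simp] = cochainsD(1,2) [OF S]
  have "(\<iota> c \<otimes>\<^bsub>A\<^esub> u) \<otimes>\<^bsub>twisted S\<^esub> (\<iota> d \<otimes>\<^bsub>A\<^esub> v) =
      \<iota> (fst S (\<pi> u, \<pi> v) \<otimes>\<^bsub>I\<^esub> (c \<otimes>\<^bsub>I\<^esub> sigma \<chi> (\<pi> u) d)) \<otimes>\<^bsub>A\<^esub> (u \<otimes>\<^bsub>A\<^esub> v)"
    unfolding twist_ext_simps central_mult [OF assms(2-5)] by (simp add: A.m_assoc)
  also have "fst S (\<pi> u, \<pi> v) \<otimes>\<^bsub>I\<^esub> (c \<otimes>\<^bsub>I\<^esub> sigma \<chi> (\<pi> u) d) =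
      c \<otimes>\<^bsub>I\<^esub> sigma \<chi> (\<pi> u) d \<otimes>\<^bsub>I\<^esub> fst S (\<pi> u, \<pi> v)"
    by (rule I.Z_comm) auto
  finally show "(\<iota> c \<otimes>\<^bsub>A\<^esub> u) \<otimes>\<^bsub>twisted S\<^esub> (\<iota> d \<otimes>\<^bsub>A\<^esub> v) =
      \<iota> (c \<otimes>\<^bsub>I\<^esub> sigma \<chi> (\<pi> u) d \<otimes>\<^bsub>I\<^esub> fst S (\<pi> u, \<pi> v)) \<otimes>\<^bsub>A\<^esub> (u \<otimes>\<^bsub>A\<^esub> v)" .
  have "\<lbrace>\<iota> c \<otimes>\<^bsub>A\<^esub> u, \<iota> d \<otimes>\<^bsub>A\<^esub> v\<rbrace>\<^bsub>twisted S\<^esub> =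
      \<iota> (snd S (\<pi> u, \<pi> v) \<otimes>\<^bsub>I\<^esub> lt c (\<pi> u) d (\<pi> v)) \<otimes>\<^bsub>A\<^esub> \<lbrace>u, v\<rbrace>\<^bsub>A\<^esub>"
    by (simp add: central_lie A.m_assoc A.lie_closed)
  also have "snd S (\<pi> u, \<pi> v) \<otimes>\<^bsub>I\<^esub> lt c (\<pi> u) d (\<pi> v) = lt c (\<pi> u) d (\<pi> v) \<otimes>\<^bsub>I\<^esub> snd S (\<pi> u, \<pi> v)"
    by (rule I.Z_comm) auto
  finally show "\<lbrace>\<iota> c \<otimes>\<^bsub>A\<^esub> u, \<iota> d \<otimes>\<^bsub>A\<^esub> v\<rbrace>\<^bsub>twisted S\<^esub> =
      \<iota> (lt c (\<pi> u) d (\<pi> v) \<otimes>\<^bsub>I\<^esub> snd S (\<pi> u, \<pi> v)) \<otimes>\<^bsub>A\<^esub> \<lbrace>u, v\<rbrace>\<^bsub>A\<^esub>" .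
qed

text \<open>
  The map $(u, \langle c,x\rangle) \mapsto \iota(c)u$ from the fibre product over
  \<open>Q\<close> preserves the operations by \<open>twist_shift\<close>.
\<close>

lemma twisted_if_abel:
  assumes S: "S \<in> carrier (cochains B Q)" and "mult_lie_algebra (abel S)"
  shows "mult_lie_algebra (twisted S)"
proof -
  interpret M: mult_lie_algebra "abel S" by fact
  let ?X = "mla_prod A (abel S)"
  let ?P = "{(u, c, x). u \<in> carrier A \<and> c \<in> carrier B \<and> x = \<pi> u}"
  let ?f = "\<lambda>(u, c, x). \<iota> c \<otimes>\<^bsub>A\<^esub> u"
  note [simp] = cochainsD(1,2) [OF S] A.lie_closed Q.lie_closed
  have X: "mult_lie_algebra ?X"
    by (rule mult_lie_algebra_mla_prod) (rule A.mult_lie_algebra_axioms, fact)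
  interpret X: mult_lie_algebra ?X by fact
  have "inv\<^bsub>?X\<^esub> (u, c, \<pi> u) \<in> ?P" if [simp]: "u \<in> carrier A" "c \<in> carrier B" for u c
  proof -
    obtain c' y where cy: "inv\<^bsub>abel S\<^esub> (c, \<pi> u) = (c', y)" by (rule prod.exhaust)
    have m: "(c', y) \<in> carrier (abel S)" unfolding cy [symmetric] by (rule M.inv_closed) simp
    have "(c', y) \<otimes>\<^bsub>abel S\<^esub> (c, \<pi> u) = \<one>\<^bsub>abel S\<^esub>" unfolding cy [symmetric] by (rule M.l_inv) simp
    then have "y = inv\<^bsub>Q\<^esub> \<pi> u" using m Q.inv_equality [of y "\<pi> u"] by simp
    then show ?thesis
      using m by (simp add: inv_mla_prod [OF A.is_group M.is_group] cy)
  qed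
  note inv = this
  have P: "subalgebra ?P ?X"
    unfolding subalgebra_def
  proof (intro conjI ballI subgroup.intro)
    fix p assume "p \<in> ?P"
    then obtain u c where "u \<in> carrier A" "c \<in> carrier B" "p = (u, c, \<pi> u)" by auto
    then show "inv\<^bsub>?X\<^esub> p \<in> ?P" by (simp only: inv)
  qed auto
  show ?thesis
  proof (rule mult_lie_algebra_surj_image [OF mult_lie_algebra_subalgebra [OF X P], of ?f])
    show "?f ` carrier (?X\<lparr>carrier := ?P\<rparr>) = carrier (twisted S)"
    proof
      show "?f ` carrier (?X\<lparr>carrier := ?P\<rparr>) \<subseteq> carrier (twisted S)" by auto
      show "carrier (twisted S) \<subseteq> ?f ` carrier (?X\<lparr>carrier := ?P\<rparr>)"
      proof
        fix u assume "u \<in> carrier (twisted S)"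
        then show "u \<in> ?f ` carrier (?X\<lparr>carrier := ?P\<rparr>)"
          by (intro image_eqI [of _ _ "(u, \<one>\<^bsub>I\<^esub>, \<pi> u)"]) simp_all
      qed
    qed
  next
    fix p q assume pq: "p \<in> carrier (?X\<lparr>carrier := ?P\<rparr>)" "q \<in> carrier (?X\<lparr>carrier := ?P\<rparr>)"
    obtain u c where u: "u \<in> carrier A" "c \<in> carrier B" and p: "p = (u, c, \<pi> u)"
      using pq(1) by (auto simp del: mla_prod_simps)
    obtain v d where v: "v \<in> carrier A" "d \<in> carrier B" and q: "q = (v, d, \<pi> v)"
      using pq(2) by (auto simp del: mla_prod_simps)
    show "?f (p \<otimes>\<^bsub>?X\<lparr>carrier := ?P\<rparr>\<^esub> q) = ?f p \<otimes>\<^bsub>twisted S\<^esub> ?f q"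
      using twist_shift(1) [OF S u(1) v(1) u(2) v(2)] by (simp add: p q del: twist_ext_simps)
    show "?f (\<lbrace>p, q\<rbrace>\<^bsub>?X\<lparr>carrier := ?P\<rparr>\<^esub>) = \<lbrace>?f p, ?f q\<rbrace>\<^bsub>twisted S\<^esub>"
      using twist_shift(2) [OF S u(1) v(1) u(2) v(2)] by (simp add: p q del: twist_ext_simps)
  next
    show "?f \<one>\<^bsub>?X\<lparr>carrier := ?P\<rparr>\<^esub> = \<one>\<^bsub>twisted S\<^esub>" by simp
  qed
qed

text \<open>
  The pairs of an element \<open>u\<close> of \<open>A\<close> and a central multiple
  \<open>\<iota> c\<close> times \<open>u\<close> in the twisted structure form a subalgebra of
  the product, and mapping such a pair to \<open>(c, \<pi> u)\<close> preserves the operations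
  by \<open>twist_shift\<close>.
\<close>

lemma abel_if_twisted:
  assumes S: "S \<in> carrier (cochains B Q)" and "mult_lie_algebra (twisted S)"
  shows "mult_lie_algebra (abel S)"
proof -
  interpret M: mult_lie_algebra "twisted S" by fact
  let ?X = "mla_prod A (twisted S)"
  let ?P = "{(u, v). u \<in> carrier A \<and> (\<exists>c \<in> carrier B. v = \<iota> c \<otimes>\<^bsub>A\<^esub> u)}"
  define f where "f = (\<lambda>(u, v). (incl_inv I E (v \<otimes>\<^bsub>A\<^esub> inv\<^bsub>A\<^esub> u), \<pi> u))"
  note [simp] = cochainsD(1,2) [OF S] A.lie_closed Q.lie_closed
  have f: "f (u, \<iota> c \<otimes>\<^bsub>A\<^esub> u) = (c, \<pi> u)" if "u \<in> carrier A" "c \<in> carrier B" for u c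
    using that by (simp add: f_def A.m_assoc)
  have X: "mult_lie_algebra ?X"
    by (rule mult_lie_algebra_mla_prod) (rule A.mult_lie_algebra_axioms, fact)
  interpret X: mult_lie_algebra ?X by fact
  have "inv\<^bsub>?X\<^esub> (u, \<iota> c \<otimes>\<^bsub>A\<^esub> u) \<in> ?P" if [simp]: "u \<in> carrier A" "c \<in> carrier B" for u c
  proof -
    let ?S = "fst S (\<pi> u, inv\<^bsub>Q\<^esub> \<pi> u)"
    define c' where "c' = sigma \<chi> (inv\<^bsub>Q\<^esub> \<pi> u) (inv\<^bsub>I\<^esub> (c \<otimes>\<^bsub>I\<^esub> ?S))"
    have [simp]: "c' \<in> carrier B" by (simp add: c'_def)
    have "sigma \<chi> (\<pi> u) c' = inv\<^bsub>I\<^esub> (c \<otimes>\<^bsub>I\<^esub> ?S)" by (simp add: c'_def sigma_sigma)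
    then have "c \<otimes>\<^bsub>I\<^esub> sigma \<chi> (\<pi> u) c' \<otimes>\<^bsub>I\<^esub> ?S = \<one>\<^bsub>I\<^esub>"
      using Z_ac(2) [of c ?S] by (simp add: I.inv_mult_group I.m_assoc I.inv_cancel_left)
    then have "(\<iota> c \<otimes>\<^bsub>A\<^esub> u) \<otimes>\<^bsub>twisted S\<^esub> (\<iota> c' \<otimes>\<^bsub>A\<^esub> inv\<^bsub>A\<^esub> u) = \<one>\<^bsub>twisted S\<^esub>"
      using twist_shift(1) [OF S, of u "inv\<^bsub>A\<^esub> u" c c']
      by (simp del: twist_ext_simps(2,4) incl.hom_mult)
    then have "inv\<^bsub>twisted S\<^esub> (\<iota> c' \<otimes>\<^bsub>A\<^esub> inv\<^bsub>A\<^esub> u) = \<iota> c \<otimes>\<^bsub>A\<^esub> u"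
      by (rule M.inv_equality) simp_all
    then have "inv\<^bsub>twisted S\<^esub> (\<iota> c \<otimes>\<^bsub>A\<^esub> u) = \<iota> c' \<otimes>\<^bsub>A\<^esub> inv\<^bsub>A\<^esub> u"
      using M.inv_inv [of "\<iota> c' \<otimes>\<^bsub>A\<^esub> inv\<^bsub>A\<^esub> u"] by simp
    then show ?thesis
      using \<open>c' \<in> carrier B\<close> by (auto simp: inv_mla_prod [OF A.is_group M.is_group])
  qed
  note inv = this
  have mult: "(u, \<iota> c \<otimes>\<^bsub>A\<^esub> u) \<otimes>\<^bsub>?X\<^esub> (v, \<iota> d \<otimes>\<^bsub>A\<^esub> v) \<in> ?P"
    and lie: "\<lbrace>(u, \<iota> c \<otimes>\<^bsub>A\<^esub> u), (v, \<iota> d \<otimes>\<^bsub>A\<^esub> v)\<rbrace>\<^bsub>?X\<^esub> \<in> ?P"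
    if [simp]: "u \<in> carrier A" "c \<in> carrier B" "v \<in> carrier A" "d \<in> carrier B" for u c v d
    unfolding mla_prod_simps twist_shift [OF S that(1,3,2,4)]
    by (auto simp del: incl.hom_mult)
  have PE: thesis
    if "p \<in> ?P" "\<And>u c. u \<in> carrier A \<Longrightarrow> c \<in> carrier B \<Longrightarrow> p = (u, \<iota> c \<otimes>\<^bsub>A\<^esub> u) \<Longrightarrow> thesis" for p thesis
    using that by auto
  have P: "subalgebra ?P ?X"
    unfolding subalgebra_def
  proof (intro conjI ballI subgroup.intro)
    show "?P \<subseteq> carrier ?X" by auto
    show "\<one>\<^bsub>?X\<^esub> \<in> ?P" by (auto intro!: bexI [of _ "\<one>\<^bsub>I\<^esub>"])
  next
    fix p q assume "p \<in> ?P" "q \<in> ?P"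
    then show "p \<otimes>\<^bsub>?X\<^esub> q \<in> ?P" by (elim PE) (simp only: mult)
  next
    fix p q assume "p \<in> ?P" "q \<in> ?P"
    then show "\<lbrace>p, q\<rbrace>\<^bsub>?X\<^esub> \<in> ?P" by (elim PE) (simp only: lie)
  next
    fix p assume "p \<in> ?P"
    then show "inv\<^bsub>?X\<^esub> p \<in> ?P" by (elim PE) (simp only: inv)
  qed
  show ?thesis
  proof (rule mult_lie_algebra_surj_image [OF mult_lie_algebra_subalgebra [OF X P], of f])
    show "f ` carrier (?X\<lparr>carrier := ?P\<rparr>) = carrier (abel S)"
    proof
      show "f ` carrier (?X\<lparr>carrier := ?P\<rparr>) \<subseteq> carrier (abel S)"
        using f by auto
      show "carrier (abel S) \<subseteq> f ` carrier (?X\<lparr>carrier := ?P\<rparr>)"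
      proof
        fix m assume "m \<in> carrier (abel S)"
        then obtain c x where m: "m = (c, x)" "c \<in> carrier B" "x \<in> carrier Q" by auto
        then obtain u where "u \<in> carrier A" "\<pi> u = x" using proj_surjE by blast
        then show "m \<in> f ` carrier (?X\<lparr>carrier := ?P\<rparr>)"
          using m f [of u c] by (intro image_eqI [of _ _ "(u, \<iota> c \<otimes>\<^bsub>A\<^esub> u)"]) auto
      qed
    qed
  next
    fix p q assume pq: "p \<in> carrier (?X\<lparr>carrier := ?P\<rparr>)" "q \<in> carrier (?X\<lparr>carrier := ?P\<rparr>)"
    obtain u c where u: "u \<in> carrier A" "c \<in> carrier B" and p: "p = (u, \<iota> c \<otimes>\<^bsub>A\<^esub> u)"
      using pq(1) by (auto simp del: mla_prod_simps)
    obtain v d where v: "v \<in> carrier A" "d \<in> carrier B" and q: "q = (v, \<iota> d \<otimes>\<^bsub>A\<^esub> v)"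
      using pq(2) by (auto simp del: mla_prod_simps)
    have "f (p \<otimes>\<^bsub>?X\<^esub> q) = (c \<otimes>\<^bsub>I\<^esub> sigma \<chi> (\<pi> u) d \<otimes>\<^bsub>I\<^esub> fst S (\<pi> u, \<pi> v), \<pi> (u \<otimes>\<^bsub>A\<^esub> v))"
      unfolding p q mla_prod_simps twist_shift(1) [OF S u(1) v(1) u(2) v(2)]
      by (rule f) (use u v in simp_all)
    also have "\<dots> = f p \<otimes>\<^bsub>abel S\<^esub> f q" unfolding p q f [OF u] f [OF v] using u v by simp
    finally show "f (p \<otimes>\<^bsub>?X\<lparr>carrier := ?P\<rparr>\<^esub> q) = f p \<otimes>\<^bsub>abel S\<^esub> f q"
      by (simp del: mla_prod_simps)
    have "f (\<lbrace>p, q\<rbrace>\<^bsub>?X\<^esub>) = (lt c (\<pi> u) d (\<pi> v) \<otimes>\<^bsub>I\<^esub> snd S (\<pi> u, \<pi> v), \<pi> \<lbrace>u, v\<rbrace>\<^bsub>A\<^esub>)"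
      unfolding p q mla_prod_simps twist_shift(2) [OF S u(1) v(1) u(2) v(2)]
      by (rule f) (use u v in simp_all)
    also have "\<dots> = \<lbrace>f p, f q\<rbrace>\<^bsub>abel S\<^esub>" unfolding p q f [OF u] f [OF v] using u v by simp
    finally show "f (\<lbrace>p, q\<rbrace>\<^bsub>?X\<lparr>carrier := ?P\<rparr>\<^esub>) = \<lbrace>f p, f q\<rbrace>\<^bsub>abel S\<^esub>"
      by (simp del: mla_prod_simps)
  next
    show "f \<one>\<^bsub>?X\<lparr>carrier := ?P\<rparr>\<^esub> = \<one>\<^bsub>abel S\<^esub>" using f [of "\<one>\<^bsub>A\<^esub>" "\<one>\<^bsub>I\<^esub>"] by simp
  qed
qed

lemma extension_twist:
  assumes S: "S \<in> carrier (cochains B Q)" and "mult_lie_algebra (twisted S)"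
  shows "extension I Q (twist_ext E S)"
proof -
  note [simp] = cochainsD [OF S] A.lie_closed Q.lie_closed
  have "\<iota> \<in> mla_hom I (twisted S)" "\<pi> \<in> mla_hom (twisted S) Q"
    by (auto simp: mla_hom_def hom_def)
  then show ?thesis
    using ext assms(2) by (simp add: extension_def kernel_def)
qed

lemma Z2_iff:
  assumes "S \<in> carrier (cochains B Q)"
  shows "S \<in> carrier (Z2 B Q \<chi>) \<longleftrightarrow> extension I Q (twist_ext E S)"
proof
  assume "S \<in> carrier (Z2 B Q \<chi>)"
  then show "extension I Q (twist_ext E S)"
    using assms by (intro extension_twist twisted_if_abel) (simp_all add: Z2_iff_abelian)
next
  assume "extension I Q (twist_ext E S)"
  then have "mult_lie_algebra (twisted S)" by (simp add: extension_def)
  then show "S \<in> carrier (Z2 B Q \<chi>)"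
    using assms abel_if_twisted by (simp add: Z2_iff_abelian)
qed

end

section \<open>Cocycles, coboundaries and cohomology\<close>

definition coboundary :: "'i mla \<Rightarrow> 'q mla \<Rightarrow> ('i, 'q) act_terms \<Rightarrow> ('q \<Rightarrow> 'i) \<Rightarrow>
    ('q \<times> 'q \<Rightarrow> 'i) \<times> ('q \<times> 'q \<Rightarrow> 'i)" where
  "coboundary B Q \<chi> h =
     (\<lambda>(x, y) \<in> carrier Q \<times> carrier Q.
        h x \<otimes>\<^bsub>B\<^esub> sigma \<chi> x (h y) \<otimes>\<^bsub>B\<^esub> inv\<^bsub>B\<^esub> h (x \<otimes>\<^bsub>Q\<^esub> y),
      \<lambda>(x, y) \<in> carrier Q \<times> carrier Q.
        lie_term B Q \<chi> (h x) x (h y) y \<otimes>\<^bsub>B\<^esub> inv\<^bsub>B\<^esub> h \<lbrace>x, y\<rbrace>\<^bsub>Q\<^esub>)"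

lemma twist_ext_iso:
  assumes "extension I Q E" "extension I Q E'" and f: "ext_iso I E E' f"
    and S: "S \<in> carrier (cochains (alg_center I) Q)"
  shows "ext_iso I (twist_ext E S) (twist_ext E' S) f"
proof -
  interpret E: mla_extension I Q E by unfold_locales fact
  note D = ext_isoD [OF f]
  have "fst S p \<in> carrier I" "snd S p \<in> carrier I" if "p \<in> carrier Q \<times> carrier Q" for p
    using S that by (auto simp: cochains_def intro!: E.I.Z_carrier)
  then show ?thesis
    using D unfolding ext_iso_def by (simp add: E.A.lie_closed)
qed

context mla_extension
begin

lemma cochain_mem:
  assumes "S \<in> carrier (cochains B Q)" "x \<in> carrier Q" "y \<in> carrier Q"
  shows "fst S (x, y) \<in> carrier B" "snd S (x, y) \<in> carrier B"
  using assms by (auto simp: cochains_def)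

lemma cochain_eqI:
  assumes "S \<in> carrier (cochains B Q)" "R \<in> carrier (cochains B Q)"
    and "\<And>x y. x \<in> carrier Q \<Longrightarrow> y \<in> carrier Q \<Longrightarrow>
      fst S (x, y) = fst R (x, y) \<and> snd S (x, y) = snd R (x, y)"
  shows "S = R"
proof (rule prod_eqI)
  have PiE: "fst S \<in> carrier Q \<times> carrier Q \<rightarrow>\<^sub>E carrier B" "snd S \<in> carrier Q \<times> carrier Q \<rightarrow>\<^sub>E carrier B"
    "fst R \<in> carrier Q \<times> carrier Q \<rightarrow>\<^sub>E carrier B" "snd R \<in> carrier Q \<times> carrier Q \<rightarrow>\<^sub>E carrier B"
    using assms(1,2) by (simp_all add: cochains_def case_prod_beta)
  show "fst S = fst R" by (rule PiE_ext [OF PiE(1,3)]) (use assms(3) in auto)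
  show "snd S = snd R" by (rule PiE_ext [OF PiE(2,4)]) (use assms(3) in auto)
qed

lemma cochain_ops:
  assumes "x \<in> carrier Q" "y \<in> carrier Q"
  shows "fst (S \<otimes>\<^bsub>cochains B Q\<^esub> R) (x, y) = fst S (x, y) \<otimes>\<^bsub>I\<^esub> fst R (x, y)"
    "snd (S \<otimes>\<^bsub>cochains B Q\<^esub> R) (x, y) = snd S (x, y) \<otimes>\<^bsub>I\<^esub> snd R (x, y)"
    "fst \<one>\<^bsub>cochains B Q\<^esub> (x, y) = \<one>\<^bsub>I\<^esub>" "snd \<one>\<^bsub>cochains B Q\<^esub> (x, y) = \<one>\<^bsub>I\<^esub>"
  using assms by (simp_all add: cochains_def case_prod_beta)

lemma cochain_mult_closed:
  assumes "S \<in> carrier (cochains B Q)" "R \<in> carrier (cochains B Q)"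
  shows "S \<otimes>\<^bsub>cochains B Q\<^esub> R \<in> carrier (cochains B Q)"
proof -
  have "a \<otimes>\<^bsub>I\<^esub> b \<in> carrier B" if "a \<in> carrier B" "b \<in> carrier B" for a b
    using B.m_closed [OF that] by simp
  then show ?thesis
    using assms by (cases S; cases R) (simp add: cochains_def PiE_iff Pi_iff)
qed

lemma cochain_one_closed: "\<one>\<^bsub>cochains B Q\<^esub> \<in> carrier (cochains B Q)"
  using B.one_closed by (simp add: cochains_def)

lemma comm_group_cochains: "comm_group (cochains B Q)"
proof (rule comm_groupI)
  fix S assume S: "S \<in> carrier (cochains B Q)"
  let ?S' = "(\<lambda>p \<in> carrier Q \<times> carrier Q. inv\<^bsub>B\<^esub> fst S p, \<lambda>p \<in> carrier Q \<times> carrier Q. inv\<^bsub>B\<^esub> snd S p)"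
  have "inv\<^bsub>B\<^esub> \<one>\<^bsub>I\<^esub> = \<one>\<^bsub>I\<^esub>" using B.inv_one by simp
  then have S': "?S' \<in> carrier (cochains B Q)"
    using S by (cases S) (simp add: cochains_def PiE_iff Pi_iff)
  have inv: "inv\<^bsub>B\<^esub> a \<otimes>\<^bsub>I\<^esub> a = \<one>\<^bsub>I\<^esub>" if "a \<in> carrier B" for a
    using B.l_inv [OF that] by simp
  have "?S' \<otimes>\<^bsub>cochains B Q\<^esub> S = \<one>\<^bsub>cochains B Q\<^esub>"
    by (rule cochain_eqI [OF cochain_mult_closed [OF S' S] cochain_one_closed])
      (simp add: cochain_ops inv cochain_mem [OF S])
  then show "\<exists>R \<in> carrier (cochains B Q). R \<otimes>\<^bsub>cochains B Q\<^esub> S = \<one>\<^bsub>cochains B Q\<^esub>"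
    using S' by (rule bexI)
next
  fix S R W
  assume S: "S \<in> carrier (cochains B Q)" and R: "R \<in> carrier (cochains B Q)"
    and W: "W \<in> carrier (cochains B Q)"
  show "S \<otimes>\<^bsub>cochains B Q\<^esub> R \<otimes>\<^bsub>cochains B Q\<^esub> W = S \<otimes>\<^bsub>cochains B Q\<^esub> (R \<otimes>\<^bsub>cochains B Q\<^esub> W)"
    by (rule cochain_eqI) (simp_all add: cochain_ops cochain_mem [OF S] cochain_mem [OF R]
        cochain_mem [OF W] cochain_mult_closed S R W I.m_assoc I.Z_carrier)
next
  fix S R assume S: "S \<in> carrier (cochains B Q)" and R: "R \<in> carrier (cochains B Q)"
  show "S \<otimes>\<^bsub>cochains B Q\<^esub> R = R \<otimes>\<^bsub>cochains B Q\<^esub> S"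
    by (rule cochain_eqI [OF cochain_mult_closed [OF S R] cochain_mult_closed [OF R S]])
      (simp add: cochain_ops cochain_mem [OF S] I.Z_comm [OF cochain_mem(1) [OF S]]
        I.Z_comm [OF cochain_mem(2) [OF S]] cochain_mem [OF R] I.Z_carrier)
next
  fix S assume S: "S \<in> carrier (cochains B Q)"
  show "\<one>\<^bsub>cochains B Q\<^esub> \<otimes>\<^bsub>cochains B Q\<^esub> S = S"
    by (rule cochain_eqI [OF cochain_mult_closed [OF cochain_one_closed S] S])
      (simp add: cochain_ops cochain_mem [OF S] I.Z_carrier)
qed (simp_all add: cochain_mult_closed cochain_one_closed)

sublocale C: comm_group "cochains B Q" by (rule comm_group_cochains)

lemma twist_one_iso: "ext_iso I (twist_ext E \<one>\<^bsub>cochains B Q\<^esub>) E (\<lambda>u. u)"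
  unfolding ext_iso_def by (simp add: cochain_ops A.lie_closed bij_betw_def)

end

context central_action
begin

text \<open>
  The twist changes neither the brackets with \<open>I\<close> nor the conjugation on
  \<open>B\<close>, as cochains are trivial when one argument is \<open>1\<close>.
\<close>

lemma central_action_twist:
  assumes S: "S \<in> carrier (cochains B Q)" and E': "extension I Q (twist_ext E S)"
  shows "central_action I Q (twist_ext E S) \<chi>"
proof -
  interpret E': mla_extension I Q "twist_ext E S" by unfold_locales fact
  note [simp] = cochainsD [OF S]
  show ?thesis
  proof unfold_locales
    fix u b assume u: "u \<in> carrier (mid (twist_ext E S))" and [simp]: "b \<in> carrier B"
    then have [simp]: "u \<in> carrier A" by simp
    have "incl E (sigma \<chi> (\<pi> u) b) \<otimes>\<^bsub>twisted S\<^esub> u = u \<otimes>\<^bsub>twisted S\<^esub> \<iota> b"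
      by (simp add: incl_act cj_def A.group_word)
    moreover have "\<dots> = cj (twisted S) u (\<iota> b) \<otimes>\<^bsub>twisted S\<^esub> u"
      by (rule E'.A.cj_swap) simp_all
    ultimately have "\<iota> (sigma \<chi> (\<pi> u) b) \<otimes>\<^bsub>twisted S\<^esub> u = cj (twisted S) u (\<iota> b) \<otimes>\<^bsub>twisted S\<^esub> u"
      by (rule trans)
    moreover have "cj (twisted S) u (\<iota> b) \<in> carrier A" using E'.A.cj_closed [of u "\<iota> b"] by simp
    ultimately have "\<iota> (sigma \<chi> (\<pi> u) b) = cj (twisted S) u (\<iota> b)"
      by (subst (asm) E'.A.right_cancel) simp_all
    then show "sigma \<chi> (proj (twist_ext E S) u) b \<in> carrier B \<and>
      tau \<chi> (proj (twist_ext E S) u) b \<in> carrier B \<and>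
      nu \<chi> (proj (twist_ext E S) u) b \<in> carrier B \<and>
      incl (twist_ext E S) (sigma \<chi> (proj (twist_ext E S) u) b) =
        cj (twisted S) u (incl (twist_ext E S) b) \<and>
      incl (twist_ext E S) (tau \<chi> (proj (twist_ext E S) u) b) =
        \<lbrace>u, incl (twist_ext E S) b\<rbrace>\<^bsub>twisted S\<^esub> \<and>
      incl (twist_ext E S) (nu \<chi> (proj (twist_ext E S) u) b) =
        \<lbrace>incl (twist_ext E S) b, u\<rbrace>\<^bsub>twisted S\<^esub>"
      by (simp add: incl_act A.lie_closed)
  qed
qed

lemma twist_mult_iso:
  assumes S: "S \<in> carrier (cochains B Q)" and R: "R \<in> carrier (cochains B Q)"
  shows "ext_iso I (twist_ext (twist_ext E S) R) (twist_ext E (S \<otimes>\<^bsub>cochains B Q\<^esub> R)) (\<lambda>u. u)"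
proof -
  note [simp] = cochainsD [OF S] cochainsD [OF R] A.lie_closed Q.lie_closed
  have "fst R (\<pi> u, \<pi> v) \<otimes>\<^bsub>I\<^esub> fst S (\<pi> u, \<pi> v) = fst S (\<pi> u, \<pi> v) \<otimes>\<^bsub>I\<^esub> fst R (\<pi> u, \<pi> v)"
    "snd R (\<pi> u, \<pi> v) \<otimes>\<^bsub>I\<^esub> snd S (\<pi> u, \<pi> v) = snd S (\<pi> u, \<pi> v) \<otimes>\<^bsub>I\<^esub> snd R (\<pi> u, \<pi> v)"
    if "u \<in> carrier A" "v \<in> carrier A" for u v
    using that by (simp_all add: I.Z_comm)
  then show ?thesis
    unfolding ext_iso_def
    by (simp add: bij_betw_def cochain_ops flip: A.m_assoc incl.hom_mult)
qed

lemma tau_nu_cancel: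
  assumes "x \<in> carrier Q" "b \<in> carrier B"
  shows "tau \<chi> x b \<otimes>\<^bsub>I\<^esub> nu \<chi> x b = \<one>\<^bsub>I\<^esub>"
proof -
  obtain u where u: "u \<in> carrier A" "\<pi> u = x" using proj_surjE [OF assms(1)] by blast
  have "\<iota> (tau \<chi> (\<pi> u) b \<otimes>\<^bsub>I\<^esub> nu \<chi> (\<pi> u) b) = \<iota> \<one>\<^bsub>I\<^esub>"
    using u(1) assms by (simp add: incl_act A.lie_antisym [of u] A.lie_closed)
  then show ?thesis by (subst (asm) incl_eq_iff) (use u assms in auto)
qed

lemma tau_nu_one_left [simp]:
  assumes "b \<in> carrier B"
  shows "tau \<chi> \<one>\<^bsub>Q\<^esub> b = \<one>\<^bsub>I\<^esub>" "nu \<chi> \<one>\<^bsub>Q\<^esub> b = \<one>\<^bsub>I\<^esub>"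
proof -
  have "\<iota> (tau \<chi> (\<pi> \<one>\<^bsub>A\<^esub>) b) = \<iota> \<one>\<^bsub>I\<^esub>" "\<iota> (nu \<chi> (\<pi> \<one>\<^bsub>A\<^esub>) b) = \<iota> \<one>\<^bsub>I\<^esub>"
    using assms by (simp_all only: incl_act A.one_closed) simp_all
  then show "tau \<chi> \<one>\<^bsub>Q\<^esub> b = \<one>\<^bsub>I\<^esub>" "nu \<chi> \<one>\<^bsub>Q\<^esub> b = \<one>\<^bsub>I\<^esub>"
    by (subst (asm) (1 2) incl_eq_iff; use assms in auto)+
qed

abbreviation \<delta> where "\<delta> \<equiv> coboundary B Q \<chi>"

lemma \<delta>_simps:
  assumes "h \<in> carrier Q \<rightarrow> carrier B" "x \<in> carrier Q" "y \<in> carrier Q"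
  shows "fst (\<delta> h) (x, y) = h x \<otimes>\<^bsub>I\<^esub> sigma \<chi> x (h y) \<otimes>\<^bsub>I\<^esub> inv\<^bsub>I\<^esub> h (x \<otimes>\<^bsub>Q\<^esub> y)"
    "snd (\<delta> h) (x, y) = lt (h x) x (h y) y \<otimes>\<^bsub>I\<^esub> inv\<^bsub>I\<^esub> h \<lbrace>x, y\<rbrace>\<^bsub>Q\<^esub>"
  using assms by (simp_all add: coboundary_def I.inv_Z Q.lie_closed Pi_iff)

lemma \<delta>_cochain:
  assumes h: "h \<in> carrier Q \<rightarrow> carrier B" "h \<one>\<^bsub>Q\<^esub> = \<one>\<^bsub>I\<^esub>"
  shows "\<delta> h \<in> carrier (cochains B Q)"
proof -
  have [simp]: "h x \<in> carrier B" if "x \<in> carrier Q" for x using h that by auto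
  have "lt (h x) x (h x) x = \<one>\<^bsub>I\<^esub>" "lt (h x) x \<one>\<^bsub>I\<^esub> \<one>\<^bsub>Q\<^esub> = \<one>\<^bsub>I\<^esub>" "lt \<one>\<^bsub>I\<^esub> \<one>\<^bsub>Q\<^esub> (h x) x = \<one>\<^bsub>I\<^esub>"
    if "x \<in> carrier Q" for x
    using that tau_nu_cancel [of x "h x"] Z_ac(2) [of "h x" "inv\<^bsub>I\<^esub> h x \<otimes>\<^bsub>I\<^esub> inv\<^bsub>I\<^esub> h x"]
    by (simp_all add: lt_eq Q.lie_self Z_ac I.inv_cancel_left)
  then show ?thesis
    using h(2)
    by (auto simp: cochains_def coboundary_def I.inv_Z Q.lie_closed Q.lie_self extensional_def)
qed

lemma \<delta>_mult:
  assumes h: "h \<in> carrier Q \<rightarrow> carrier B" "h \<one>\<^bsub>Q\<^esub> = \<one>\<^bsub>I\<^esub>"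
    and k: "k \<in> carrier Q \<rightarrow> carrier B" "k \<one>\<^bsub>Q\<^esub> = \<one>\<^bsub>I\<^esub>"
  shows "\<delta> (\<lambda>x. h x \<otimes>\<^bsub>I\<^esub> k x) = \<delta> h \<otimes>\<^bsub>cochains B Q\<^esub> \<delta> k"
proof (rule cochain_eqI)
  have [simp]: "h x \<in> carrier B" "k x \<in> carrier B" if "x \<in> carrier Q" for x using h k that by auto
  have hk: "(\<lambda>x. h x \<otimes>\<^bsub>I\<^esub> k x) \<in> carrier Q \<rightarrow> carrier B" by simp
  then show "\<delta> (\<lambda>x. h x \<otimes>\<^bsub>I\<^esub> k x) \<in> carrier (cochains B Q)" by (rule \<delta>_cochain) (simp add: h k)
  show "\<delta> h \<otimes>\<^bsub>cochains B Q\<^esub> \<delta> k \<in> carrier (cochains B Q)" by (simp add: \<delta>_cochain h k)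
  fix x y assume xy: "x \<in> carrier Q" "y \<in> carrier Q"
  then show "fst (\<delta> (\<lambda>x. h x \<otimes>\<^bsub>I\<^esub> k x)) (x, y) = fst (\<delta> h \<otimes>\<^bsub>cochains B Q\<^esub> \<delta> k) (x, y) \<and>
    snd (\<delta> (\<lambda>x. h x \<otimes>\<^bsub>I\<^esub> k x)) (x, y) = snd (\<delta> h \<otimes>\<^bsub>cochains B Q\<^esub> \<delta> k) (x, y)"
    by (simp add: cochain_ops \<delta>_simps [OF hk] \<delta>_simps [OF h(1)] \<delta>_simps [OF k(1)] sigma_mult lt_mult
        I.inv_mult_group Q.lie_closed Z_ac)
qed

lemma twist_coboundary_iso:
  assumes S: "S \<in> carrier (cochains B Q)" and h: "h \<in> carrier Q \<rightarrow> carrier B" "h \<one>\<^bsub>Q\<^esub> = \<one>\<^bsub>I\<^esub>"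
  shows "ext_iso I (twist_ext E (S \<otimes>\<^bsub>cochains B Q\<^esub> \<delta> h)) (twist_ext E S) (\<lambda>u. \<iota> (h (\<pi> u)) \<otimes>\<^bsub>A\<^esub> u)"
    (is "ext_iso I ?E' _ ?f")
proof -
  have hc [simp]: "h x \<in> carrier B" if "x \<in> carrier Q" for x using h that by auto
  note [simp] = cochainsD [OF S] A.lie_closed Q.lie_closed
  have "bij_betw ?f (carrier A) (carrier A)"
    by (rule bij_betw_byWitness [where f' = "\<lambda>u. \<iota> (inv\<^bsub>I\<^esub> h (\<pi> u)) \<otimes>\<^bsub>A\<^esub> u"])
      (auto simp: A.inv_cancel_left)
  moreover have "?f (u \<otimes>\<^bsub>mid ?E'\<^esub> v) = ?f u \<otimes>\<^bsub>twisted S\<^esub> ?f v" "u \<otimes>\<^bsub>mid ?E'\<^esub> v \<in> carrier A"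
    if [simp]: "u \<in> carrier A" "v \<in> carrier A" for u v
  proof -
    let ?h = "h (\<pi> u \<otimes>\<^bsub>Q\<^esub> \<pi> v)"
    let ?d = "h (\<pi> u) \<otimes>\<^bsub>I\<^esub> sigma \<chi> (\<pi> u) (h (\<pi> v))" and ?s = "fst S (\<pi> u, \<pi> v)"
    have "?f (u \<otimes>\<^bsub>mid ?E'\<^esub> v) = \<iota> (?h \<otimes>\<^bsub>I\<^esub> (?s \<otimes>\<^bsub>I\<^esub> (?d \<otimes>\<^bsub>I\<^esub> inv\<^bsub>I\<^esub> ?h))) \<otimes>\<^bsub>A\<^esub> (u \<otimes>\<^bsub>A\<^esub> v)"
      by (simp add: cochain_ops \<delta>_simps [OF h(1)] A.m_assoc)
    also have "?h \<otimes>\<^bsub>I\<^esub> (?s \<otimes>\<^bsub>I\<^esub> (?d \<otimes>\<^bsub>I\<^esub> inv\<^bsub>I\<^esub> ?h)) = (?h \<otimes>\<^bsub>I\<^esub> inv\<^bsub>I\<^esub> ?h) \<otimes>\<^bsub>I\<^esub> (?d \<otimes>\<^bsub>I\<^esub> ?s)"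
      by (simp add: Z_ac del: I.r_inv)
    also have "\<dots> = ?d \<otimes>\<^bsub>I\<^esub> ?s" by simp
    finally show "?f (u \<otimes>\<^bsub>mid ?E'\<^esub> v) = ?f u \<otimes>\<^bsub>twisted S\<^esub> ?f v"
      by (simp only: twist_shift(1) [OF S] that hc proj.hom_closed)
    show "u \<otimes>\<^bsub>mid ?E'\<^esub> v \<in> carrier A" by (simp add: cochain_ops \<delta>_simps [OF h(1)])
  qed
  moreover have "?f \<lbrace>u, v\<rbrace>\<^bsub>mid ?E'\<^esub> = \<lbrace>?f u, ?f v\<rbrace>\<^bsub>twisted S\<^esub>" "\<lbrace>u, v\<rbrace>\<^bsub>mid ?E'\<^esub> \<in> carrier A"
    if [simp]: "u \<in> carrier A" "v \<in> carrier A" for u v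
  proof -
    let ?h = "h \<lbrace>\<pi> u, \<pi> v\<rbrace>\<^bsub>Q\<^esub>"
    let ?d = "lt (h (\<pi> u)) (\<pi> u) (h (\<pi> v)) (\<pi> v)" and ?s = "snd S (\<pi> u, \<pi> v)"
    have "?f \<lbrace>u, v\<rbrace>\<^bsub>mid ?E'\<^esub> = \<iota> (?h \<otimes>\<^bsub>I\<^esub> (?s \<otimes>\<^bsub>I\<^esub> (?d \<otimes>\<^bsub>I\<^esub> inv\<^bsub>I\<^esub> ?h))) \<otimes>\<^bsub>A\<^esub> \<lbrace>u, v\<rbrace>\<^bsub>A\<^esub>"
      by (simp add: cochain_ops \<delta>_simps [OF h(1)] A.m_assoc)
    also have "?h \<otimes>\<^bsub>I\<^esub> (?s \<otimes>\<^bsub>I\<^esub> (?d \<otimes>\<^bsub>I\<^esub> inv\<^bsub>I\<^esub> ?h)) = (?h \<otimes>\<^bsub>I\<^esub> inv\<^bsub>I\<^esub> ?h) \<otimes>\<^bsub>I\<^esub> (?d \<otimes>\<^bsub>I\<^esub> ?s)"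
      by (simp add: Z_ac I.inv_cancel_left)
    also have "\<dots> = ?d \<otimes>\<^bsub>I\<^esub> ?s" by simp
    finally show "?f \<lbrace>u, v\<rbrace>\<^bsub>mid ?E'\<^esub> = \<lbrace>?f u, ?f v\<rbrace>\<^bsub>twisted S\<^esub>"
      by (simp only: twist_shift(2) [OF S] that hc proj.hom_closed)
    show "\<lbrace>u, v\<rbrace>\<^bsub>mid ?E'\<^esub> \<in> carrier A" by (simp add: cochain_ops \<delta>_simps [OF h(1)])
  qed
  ultimately show ?thesis
    unfolding ext_iso_def using h(2) by (simp del: twist_ext_simps(2,4))
qed

text \<open>
  Put $f(u) = \iota(h(u))\,u$ with \<open>h\<close> having values in \<open>I\<close>. As
  \<open>f\<close> fixes \<open>\<iota> I\<close>, comparing the two ways to compute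
  \<open>f\<close> on $u\,\iota(a')$, which is also $\iota(a)\,u$, shows that $h(u)$ commutes
  with \<open>I\<close>, and comparing on $\{u,\iota(a)\}$ shows that its brackets with
  \<open>I\<close> are trivial. Hence \<open>h\<close> takes values in \<open>B\<close> and
  depends only on $\pi(u)$; that \<open>f\<close> preserves the operations is then the equation
  between \<open>S\<close> and \<open>R\<close>.
\<close>

lemma twist_iso_form:
  assumes S: "S \<in> carrier (cochains B Q)" and R: "R \<in> carrier (cochains B Q)"
    and f: "ext_iso I (twist_ext E S) (twist_ext E R) f"
  obtains k where "k \<in> carrier Q \<rightarrow>\<^sub>E carrier B" "k \<one>\<^bsub>Q\<^esub> = \<one>\<^bsub>I\<^esub>"
    "\<And>u. u \<in> carrier A \<Longrightarrow> f u = \<iota> (k (\<pi> u)) \<otimes>\<^bsub>A\<^esub> u"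
    "S = R \<otimes>\<^bsub>cochains B Q\<^esub> \<delta> k"
proof -
  note [simp] = cochainsD [OF S] cochainsD [OF R] A.lie_closed Q.lie_closed
  note D = ext_isoD [OF f]
  have fc [simp]: "f u \<in> carrier A" if "u \<in> carrier A" for u using D(2) that by simp
  have fp [simp]: "\<pi> (f u) = \<pi> u" if "u \<in> carrier A" for u using D(11) that by simp
  have fi [simp]: "f (\<iota> a) = \<iota> a" if "a \<in> carrier I" for a using D(10) that by simp
  have f_mult_incl: "f (u \<otimes>\<^bsub>A\<^esub> \<iota> a) = f u \<otimes>\<^bsub>A\<^esub> \<iota> a" "f (\<iota> a \<otimes>\<^bsub>A\<^esub> u) = \<iota> a \<otimes>\<^bsub>A\<^esub> f u"
    "f \<lbrace>u, \<iota> a\<rbrace>\<^bsub>A\<^esub> = \<lbrace>f u, \<iota> a\<rbrace>\<^bsub>A\<^esub>"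
    if "u \<in> carrier A" "a \<in> carrier I" for u a
    using D(4) [of u "\<iota> a"] D(4) [of "\<iota> a" u] D(6) [of u "\<iota> a"] that by simp_all
  define h where "h u = incl_inv I E (f u \<otimes>\<^bsub>A\<^esub> inv\<^bsub>A\<^esub> u)" for u
  have h: "h u \<in> carrier I" "f u = \<iota> (h u) \<otimes>\<^bsub>A\<^esub> u" if [simp]: "u \<in> carrier A" for u
  proof -
    have "\<pi> (f u \<otimes>\<^bsub>A\<^esub> inv\<^bsub>A\<^esub> u) = \<one>\<^bsub>Q\<^esub>" by simp
    then have "h u \<in> carrier I" "\<iota> (h u) = f u \<otimes>\<^bsub>A\<^esub> inv\<^bsub>A\<^esub> u"
      unfolding h_def by (simp_all add: incl_inv_closed del: proj.hom_mult)
    then show "h u \<in> carrier I" "f u = \<iota> (h u) \<otimes>\<^bsub>A\<^esub> u" by (simp_all add: A.m_assoc)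
  qed
  have comm: "h u \<otimes>\<^bsub>I\<^esub> a = a \<otimes>\<^bsub>I\<^esub> h u" if [simp]: "u \<in> carrier A" "a \<in> carrier I" for u a
  proof -
    note [simp] = h(1)
    define a' where "a' = incl_inv I E (cj A (inv\<^bsub>A\<^esub> u) (\<iota> a))"
    have a' [simp]: "a' \<in> carrier I" "\<iota> a' = cj A (inv\<^bsub>A\<^esub> u) (\<iota> a)"
      unfolding a'_def by (simp_all add: incl_inv_closed)
    have swap: "u \<otimes>\<^bsub>A\<^esub> \<iota> a' = \<iota> a \<otimes>\<^bsub>A\<^esub> u" by (simp add: cj_def A.group_word)
    have "\<iota> (h u) \<otimes>\<^bsub>A\<^esub> (\<iota> a \<otimes>\<^bsub>A\<^esub> u) = f (u \<otimes>\<^bsub>A\<^esub> \<iota> a')"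
      unfolding f_mult_incl(1) [OF \<open>u \<in> carrier A\<close> a'(1)] h(2) [OF \<open>u \<in> carrier A\<close>]
      unfolding swap [symmetric] by (simp add: A.m_assoc)
    also have "\<dots> = \<iota> a \<otimes>\<^bsub>A\<^esub> (\<iota> (h u) \<otimes>\<^bsub>A\<^esub> u)"
      unfolding swap by (simp add: f_mult_incl h(2) [symmetric])
    finally have "\<iota> (h u \<otimes>\<^bsub>I\<^esub> a) \<otimes>\<^bsub>A\<^esub> u = \<iota> (a \<otimes>\<^bsub>I\<^esub> h u) \<otimes>\<^bsub>A\<^esub> u" by (simp add: A.m_assoc)
    then have "\<iota> (h u \<otimes>\<^bsub>I\<^esub> a) = \<iota> (a \<otimes>\<^bsub>I\<^esub> h u)" by (subst (asm) A.right_cancel) simp_all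
    then show ?thesis by (subst (asm) incl_eq_iff) simp_all
  qed
  have hB: "h u \<in> carrier B" if [simp]: "u \<in> carrier A" for u
  proof (rule I.ZI)
    note [simp] = h(1)
    fix a assume [simp]: "a \<in> carrier I"
    define t where "t = incl_inv I E \<lbrace>u, \<iota> a\<rbrace>\<^bsub>A\<^esub>"
    have t: "t \<in> carrier I" "\<iota> t = \<lbrace>u, \<iota> a\<rbrace>\<^bsub>A\<^esub>"
      unfolding t_def by (simp_all add: incl_inv_closed)
    note [simp] = t(1)
    have "cj I (h u) t = t" by (simp add: I.cj_eq_self_iff comm)
    then have cj: "cj A (\<iota> (h u)) \<lbrace>u, \<iota> a\<rbrace>\<^bsub>A\<^esub> = \<iota> t" by (simp flip: t(2) incl_cj)
    have "\<iota> t = f \<lbrace>u, \<iota> a\<rbrace>\<^bsub>A\<^esub>" by (simp flip: t(2))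
    also have "\<dots> = \<lbrace>\<iota> (h u) \<otimes>\<^bsub>A\<^esub> u, \<iota> a\<rbrace>\<^bsub>A\<^esub>" by (subst f_mult_incl(3)) (simp_all flip: h(2))
    also have "\<dots> = \<iota> t \<otimes>\<^bsub>A\<^esub> \<lbrace>\<iota> (h u), \<iota> a\<rbrace>\<^bsub>A\<^esub>" by (simp add: A.lie_mult_left cj)
    finally have "\<lbrace>\<iota> (h u), \<iota> a\<rbrace>\<^bsub>A\<^esub> = \<one>\<^bsub>A\<^esub>" by (simp add: t(2))
    then have "\<iota> \<lbrace>h u, a\<rbrace>\<^bsub>I\<^esub> = \<iota> \<one>\<^bsub>I\<^esub>" by simp
    then show "\<lbrace>h u, a\<rbrace>\<^bsub>I\<^esub> = \<one>\<^bsub>I\<^esub>" by (subst (asm) incl_eq_iff) (simp_all add: I.lie_closed)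
  qed (simp_all add: comm h(1))
  \<comment> \<open>\<open>h\<close> is constant on the cosets of \<open>I\<close>, so it descends to \<open>Q\<close>.\<close>
  have h_eq: "h u = h v" if uv [simp]: "u \<in> carrier A" "v \<in> carrier A" and e: "\<pi> u = \<pi> v" for u v
  proof -
    obtain a where a [simp]: "a \<in> carrier I" and u: "u = \<iota> a \<otimes>\<^bsub>A\<^esub> v"
      by (rule proj_eqE [OF uv e])
    note [simp] = h(1)
    have "\<iota> (h u) \<otimes>\<^bsub>A\<^esub> u = \<iota> a \<otimes>\<^bsub>A\<^esub> (\<iota> (h v) \<otimes>\<^bsub>A\<^esub> v)"
      using f_mult_incl(2) [of v a] h(2) [of u] h(2) [of v] u by simp
    also have "\<dots> = \<iota> (a \<otimes>\<^bsub>I\<^esub> h v) \<otimes>\<^bsub>A\<^esub> v" by (simp add: A.m_assoc)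
    also have "a \<otimes>\<^bsub>I\<^esub> h v = h v \<otimes>\<^bsub>I\<^esub> a" by (simp add: comm)
    also have "\<iota> (h v \<otimes>\<^bsub>I\<^esub> a) \<otimes>\<^bsub>A\<^esub> v = \<iota> (h v) \<otimes>\<^bsub>A\<^esub> u" by (simp add: u A.m_assoc)
    finally show ?thesis by simp
  qed
  define k where "k = (\<lambda>x \<in> carrier Q. h (inv_into (carrier A) \<pi> x))"
  have k: "k (\<pi> u) = h u" if [simp]: "u \<in> carrier A" for u
  proof -
    have "\<pi> u \<in> \<pi> ` carrier A" by simp
    then show ?thesis
      unfolding k_def using h_eq [of "inv_into (carrier A) \<pi> (\<pi> u)" u]
      by (simp add: inv_into_into f_inv_into_f)
  qed
  have kB: "k x \<in> carrier B" if "x \<in> carrier Q" for x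
  proof -
    obtain u where "u \<in> carrier A" "\<pi> u = x" by (rule proj_surjE [OF \<open>x \<in> carrier Q\<close>])
    then show ?thesis using k [of u] hB [of u] by simp
  qed
  have k1: "k \<one>\<^bsub>Q\<^esub> = \<one>\<^bsub>I\<^esub>"
    using k [of "\<one>\<^bsub>A\<^esub>"] D(8) incl_inv_incl [of "\<one>\<^bsub>I\<^esub>"] by (simp add: h_def)
  have fk: "f u = \<iota> (k (\<pi> u)) \<otimes>\<^bsub>A\<^esub> u" if "u \<in> carrier A" for u
    using that by (simp add: k flip: h(2))
  have kPi: "k \<in> carrier Q \<rightarrow> carrier B" using kB by blast
  have S_eq: "S = R \<otimes>\<^bsub>cochains B Q\<^esub> \<delta> k"
  proof (rule cochain_eqI [OF S])
    show "R \<otimes>\<^bsub>cochains B Q\<^esub> \<delta> k \<in> carrier (cochains B Q)"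
      using R \<delta>_cochain [OF kPi k1] by (rule C.m_closed)
    fix x y assume xy [simp]: "x \<in> carrier Q" "y \<in> carrier Q"
    obtain u where u [simp]: "u \<in> carrier A" "\<pi> u = x" using proj_surjE [OF xy(1)] by blast
    obtain v where v [simp]: "v \<in> carrier A" "\<pi> v = y" using proj_surjE [OF xy(2)] by blast
    note [simp] = kB
    have "\<iota> (k (x \<otimes>\<^bsub>Q\<^esub> y) \<otimes>\<^bsub>I\<^esub> fst S (x, y)) \<otimes>\<^bsub>A\<^esub> (u \<otimes>\<^bsub>A\<^esub> v) = f (u \<otimes>\<^bsub>twisted S\<^esub> v)"
      by (simp add: fk A.m_assoc)
    also have "\<dots> = f u \<otimes>\<^bsub>twisted R\<^esub> f v" by (rule D(4)) simp_all
    also have "\<dots> = \<iota> (k x \<otimes>\<^bsub>I\<^esub> sigma \<chi> x (k y) \<otimes>\<^bsub>I\<^esub> fst R (x, y)) \<otimes>\<^bsub>A\<^esub> (u \<otimes>\<^bsub>A\<^esub> v)"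
      unfolding fk [OF u(1)] fk [OF v(1)] using twist_shift(1) [OF R u(1) v(1), of "k x" "k y"]
      by (simp only: u v kB xy)
    finally have 1: "k (x \<otimes>\<^bsub>Q\<^esub> y) \<otimes>\<^bsub>I\<^esub> fst S (x, y) = k x \<otimes>\<^bsub>I\<^esub> sigma \<chi> x (k y) \<otimes>\<^bsub>I\<^esub> fst R (x, y)"
      by (subst (asm) A.right_cancel, simp_all del: incl.hom_mult)
    have "\<iota> (k \<lbrace>x, y\<rbrace>\<^bsub>Q\<^esub> \<otimes>\<^bsub>I\<^esub> snd S (x, y)) \<otimes>\<^bsub>A\<^esub> \<lbrace>u, v\<rbrace>\<^bsub>A\<^esub> = f \<lbrace>u, v\<rbrace>\<^bsub>twisted S\<^esub>"
      by (simp add: fk A.m_assoc)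
    also have "\<dots> = \<lbrace>f u, f v\<rbrace>\<^bsub>twisted R\<^esub>" by (rule D(6)) simp_all
    also have "\<dots> = \<iota> (lt (k x) x (k y) y \<otimes>\<^bsub>I\<^esub> snd R (x, y)) \<otimes>\<^bsub>A\<^esub> \<lbrace>u, v\<rbrace>\<^bsub>A\<^esub>"
      unfolding fk [OF u(1)] fk [OF v(1)] using twist_shift(2) [OF R u(1) v(1), of "k x" "k y"]
      by (simp only: u v kB xy)
    finally have 2: "k \<lbrace>x, y\<rbrace>\<^bsub>Q\<^esub> \<otimes>\<^bsub>I\<^esub> snd S (x, y) = lt (k x) x (k y) y \<otimes>\<^bsub>I\<^esub> snd R (x, y)"
      by (subst (asm) A.right_cancel, simp_all del: incl.hom_mult)
    have solve: "s = r \<otimes>\<^bsub>I\<^esub> (d \<otimes>\<^bsub>I\<^esub> inv\<^bsub>I\<^esub> c)"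
      if eq: "c \<otimes>\<^bsub>I\<^esub> s = d \<otimes>\<^bsub>I\<^esub> r" and [simp]: "c \<in> carrier B" "s \<in> carrier B" "d \<in> carrier B" "r \<in> carrier B"
      for c s d r
    proof -
      have "s = inv\<^bsub>I\<^esub> c \<otimes>\<^bsub>I\<^esub> (c \<otimes>\<^bsub>I\<^esub> s)" by (simp add: I.inv_cancel_left)
      also have "\<dots> = r \<otimes>\<^bsub>I\<^esub> (d \<otimes>\<^bsub>I\<^esub> inv\<^bsub>I\<^esub> c)" unfolding eq by (simp add: Z_ac)
      finally show ?thesis .
    qed
    show "fst S (x, y) = fst (R \<otimes>\<^bsub>cochains B Q\<^esub> \<delta> k) (x, y) \<and>
      snd S (x, y) = snd (R \<otimes>\<^bsub>cochains B Q\<^esub> \<delta> k) (x, y)"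
      using solve [OF 1] solve [OF 2] by (simp add: cochain_ops \<delta>_simps [OF kPi])
  qed
  have "k \<in> carrier Q \<rightarrow>\<^sub>E carrier B" using kB by (simp add: PiE_iff k_def)
  then show ?thesis by (rule that [OF _ k1 fk S_eq])
qed

lemma Z2_eq: "Z2 B Q \<chi> = cochains B Q \<lparr>carrier := carrier (Z2 B Q \<chi>)\<rparr>"
  by (simp add: Z2_def cochains_def)

lemma Z2_cochain: "S \<in> carrier (Z2 B Q \<chi>) \<Longrightarrow> S \<in> carrier (cochains B Q)"
  by (simp add: Z2_iff_abelian)

lemma Z2_extension: "S \<in> carrier (Z2 B Q \<chi>) \<Longrightarrow> extension I Q (twist_ext E S)"
  using Z2_iff Z2_cochain by blast

text \<open>
  Twisting twice is twisting by the product, so products and inverses of cocycles are obtained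
  without computing with the cocycle conditions.
\<close>

lemma subgroup_Z2: "subgroup (carrier (Z2 B Q \<chi>)) (cochains B Q)"
proof (rule C.subgroupI)
  have "extension I Q (twist_ext E \<one>\<^bsub>cochains B Q\<^esub>)" by (rule extension_iso [OF twist_one_iso ext])
  then show "carrier (Z2 B Q \<chi>) \<noteq> {}" using Z2_iff C.one_closed by blast
next
  fix S assume S: "S \<in> carrier (Z2 B Q \<chi>)"
  note SC = Z2_cochain [OF S]
  interpret E': central_action I Q "twist_ext E S" \<chi>
    by (rule central_action_twist [OF SC Z2_extension [OF S]])
  have "ext_iso I (twist_ext (twist_ext E S) (inv\<^bsub>cochains B Q\<^esub> S)) (twist_ext E \<one>\<^bsub>cochains B Q\<^esub>) (\<lambda>u. u)"
    using twist_mult_iso [OF SC C.inv_closed [OF SC]] SC by simp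
  then have "extension I Q (twist_ext (twist_ext E S) (inv\<^bsub>cochains B Q\<^esub> S))"
    by (rule extension_iso) (rule extension_iso [OF twist_one_iso ext])
  then show "inv\<^bsub>cochains B Q\<^esub> S \<in> carrier (Z2 B Q \<chi>)" using E'.Z2_iff SC by simp
  fix R assume R: "R \<in> carrier (Z2 B Q \<chi>)"
  note RC = Z2_cochain [OF R]
  have "extension I Q (twist_ext (twist_ext E S) R)" by (rule E'.Z2_extension [OF R])
  then have "extension I Q (twist_ext E (S \<otimes>\<^bsub>cochains B Q\<^esub> R))"
    by (rule extension_iso [OF ext_iso_sym [OF twist_mult_iso [OF SC RC]]])
  then show "S \<otimes>\<^bsub>cochains B Q\<^esub> R \<in> carrier (Z2 B Q \<chi>)" using Z2_iff SC RC by simp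
qed (use Z2_cochain in blast)

lemma comm_group_Z2: "comm_group (Z2 B Q \<chi>)"
proof -
  have "group (Z2 B Q \<chi>)"
    by (subst Z2_eq) (rule subgroup.subgroup_is_group [OF subgroup_Z2 C.is_group])
  moreover have "S \<otimes>\<^bsub>Z2 B Q \<chi>\<^esub> R = R \<otimes>\<^bsub>Z2 B Q \<chi>\<^esub> S"
    if "S \<in> carrier (Z2 B Q \<chi>)" "R \<in> carrier (Z2 B Q \<chi>)" for S R
    using C.m_comm [OF that [THEN Z2_cochain]] by (subst (1 2) Z2_eq) simp
  ultimately show ?thesis by (rule group.group_comm_groupI)
qed

text \<open>
  The twist by a coboundary is isomorphic to the extension itself.
\<close>

lemma \<delta>_Z2:
  assumes h: "h \<in> carrier Q \<rightarrow> carrier B" "h \<one>\<^bsub>Q\<^esub> = \<one>\<^bsub>I\<^esub>"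
  shows "\<delta> h \<in> carrier (Z2 B Q \<chi>)"
proof -
  have "ext_iso I (twist_ext E (\<delta> h)) (twist_ext E \<one>\<^bsub>cochains B Q\<^esub>) (\<lambda>u. \<iota> (h (\<pi> u)) \<otimes>\<^bsub>A\<^esub> u)"
    using twist_coboundary_iso [OF C.one_closed h] \<delta>_cochain [OF h] by simp
  then have "extension I Q (twist_ext E (\<delta> h))"
    by (rule extension_iso) (rule extension_iso [OF twist_one_iso ext])
  then show ?thesis using Z2_iff \<delta>_cochain [OF h] by blast
qed

text \<open>
  Normalization forces $h(1) = 0$, as \<open>h 1\<close> is the value of the coboundary at
  \<open>(1, 1)\<close>.
\<close>

lemma B2_eq: "B2 B Q \<chi> = {\<delta> h | h. h \<in> carrier Q \<rightarrow> carrier B \<and> h \<one>\<^bsub>Q\<^esub> = \<one>\<^bsub>I\<^esub>}"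
proof (intro subset_antisym subsetI)
  fix G assume G: "G \<in> B2 B Q \<chi>"
  then have GZ: "G \<in> carrier (Z2 B Q \<chi>)" by (auto simp: B2_def)
  note GC = Z2_cochain [OF GZ]
  obtain h where h: "h \<in> carrier Q \<rightarrow> carrier B"
    and G': "\<And>x y. x \<in> carrier Q \<Longrightarrow> y \<in> carrier Q \<Longrightarrow>
      fst G (x, y) = fst (\<delta> h) (x, y) \<and> snd G (x, y) = snd (\<delta> h) (x, y)"
    using G by (auto simp: B2_def coboundary_def)
  have h1: "h \<one>\<^bsub>Q\<^esub> \<in> carrier B" using h by auto
  have "fst G (\<one>\<^bsub>Q\<^esub>, \<one>\<^bsub>Q\<^esub>) = h \<one>\<^bsub>Q\<^esub>"
    using G' [of "\<one>\<^bsub>Q\<^esub>" "\<one>\<^bsub>Q\<^esub>"] h1 by (simp add: \<delta>_simps [OF h] I.m_assoc)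
  then have one: "h \<one>\<^bsub>Q\<^esub> = \<one>\<^bsub>I\<^esub>" using cochainsD(3) [OF GC] by simp
  have "G = \<delta> h" by (rule cochain_eqI [OF GC \<delta>_cochain [OF h one]]) (rule G')
  then show "G \<in> {\<delta> h | h. h \<in> carrier Q \<rightarrow> carrier B \<and> h \<one>\<^bsub>Q\<^esub> = \<one>\<^bsub>I\<^esub>}" using h one by blast
next
  fix G assume "G \<in> {\<delta> h | h. h \<in> carrier Q \<rightarrow> carrier B \<and> h \<one>\<^bsub>Q\<^esub> = \<one>\<^bsub>I\<^esub>}"
  then obtain h where h: "h \<in> carrier Q \<rightarrow> carrier B" "h \<one>\<^bsub>Q\<^esub> = \<one>\<^bsub>I\<^esub>" and G: "G = \<delta> h" by blast
  have "\<exists>k \<in> carrier Q \<rightarrow> carrier B. \<forall>x \<in> carrier Q. \<forall>y \<in> carrier Q.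
       fst (\<delta> h) (x, y) = k x \<otimes>\<^bsub>B\<^esub> sigma \<chi> x (k y) \<otimes>\<^bsub>B\<^esub> inv\<^bsub>B\<^esub> k (x \<otimes>\<^bsub>Q\<^esub> y) \<and>
       snd (\<delta> h) (x, y) = lt (k x) x (k y) y \<otimes>\<^bsub>B\<^esub> inv\<^bsub>B\<^esub> k \<lbrace>x, y\<rbrace>\<^bsub>Q\<^esub>"
    by (rule bexI [OF _ h(1)]) (simp add: coboundary_def)
  then show "G \<in> B2 B Q \<chi>"
    using \<delta>_Z2 [OF h] unfolding G B2_def by (simp add: case_prod_beta)
qed

lemma subgroup_B2: "subgroup (B2 B Q \<chi>) (Z2 B Q \<chi>)"
proof -
  interpret Z: comm_group "Z2 B Q \<chi>" by (rule comm_group_Z2)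
  have mult: "S \<otimes>\<^bsub>Z2 B Q \<chi>\<^esub> R = S \<otimes>\<^bsub>cochains B Q\<^esub> R" for S R by (subst Z2_eq) simp
  have one: "\<one>\<^bsub>Z2 B Q \<chi>\<^esub> = \<one>\<^bsub>cochains B Q\<^esub>" by (subst Z2_eq) simp
  have \<delta>1: "\<delta> (\<lambda>x. \<one>\<^bsub>I\<^esub>) = \<one>\<^bsub>cochains B Q\<^esub>"
    by (rule cochain_eqI [OF \<delta>_cochain C.one_closed]) (simp_all add: \<delta>_simps cochain_ops Q.lie_closed)
  show ?thesis
  proof (rule Z.subgroupI)
    show "B2 B Q \<chi> \<subseteq> carrier (Z2 B Q \<chi>)" by (auto simp: B2_def)
    have "\<delta> (\<lambda>x. \<one>\<^bsub>I\<^esub>) \<in> B2 B Q \<chi>"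
      unfolding B2_eq by (intro CollectI exI [of _ "\<lambda>x. \<one>\<^bsub>I\<^esub>"]) simp
    then show "B2 B Q \<chi> \<noteq> {}" by blast
  next
    fix G assume "G \<in> B2 B Q \<chi>"
    then obtain h where h: "h \<in> carrier Q \<rightarrow> carrier B" "h \<one>\<^bsub>Q\<^esub> = \<one>\<^bsub>I\<^esub>" and G: "G = \<delta> h"
      by (auto simp: B2_eq)
    have hi: "(\<lambda>x. inv\<^bsub>I\<^esub> h x) \<in> carrier Q \<rightarrow> carrier B" "inv\<^bsub>I\<^esub> h \<one>\<^bsub>Q\<^esub> = \<one>\<^bsub>I\<^esub>"
      using h by (simp_all add: Pi_iff)
    have "\<delta> (\<lambda>x. inv\<^bsub>I\<^esub> h x) \<otimes>\<^bsub>cochains B Q\<^esub> \<delta> h = \<delta> (\<lambda>x. inv\<^bsub>I\<^esub> h x \<otimes>\<^bsub>I\<^esub> h x)"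
      by (rule \<delta>_mult [OF hi h, symmetric])
    also have "\<dots> = \<delta> (\<lambda>x. \<one>\<^bsub>I\<^esub>)"
    proof (rule cochain_eqI)
      have l_inv: "inv\<^bsub>I\<^esub> h x \<otimes>\<^bsub>I\<^esub> h x = \<one>\<^bsub>I\<^esub>" if "x \<in> carrier Q" for x
        using that h(1) by (simp add: Pi_iff)
      have "(\<lambda>x. inv\<^bsub>I\<^esub> h x \<otimes>\<^bsub>I\<^esub> h x) \<in> carrier Q \<rightarrow> carrier B"
        "(\<lambda>x. \<one>\<^bsub>I\<^esub>) \<in> carrier Q \<rightarrow> carrier B" by (simp_all add: l_inv)
      then show "\<delta> (\<lambda>x. inv\<^bsub>I\<^esub> h x \<otimes>\<^bsub>I\<^esub> h x) \<in> carrier (cochains B Q)"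
        "\<delta> (\<lambda>x. \<one>\<^bsub>I\<^esub>) \<in> carrier (cochains B Q)"
        "\<And>x y. x \<in> carrier Q \<Longrightarrow> y \<in> carrier Q \<Longrightarrow>
          fst (\<delta> (\<lambda>x. inv\<^bsub>I\<^esub> h x \<otimes>\<^bsub>I\<^esub> h x)) (x, y) = fst (\<delta> (\<lambda>x. \<one>\<^bsub>I\<^esub>)) (x, y) \<and>
          snd (\<delta> (\<lambda>x. inv\<^bsub>I\<^esub> h x \<otimes>\<^bsub>I\<^esub> h x)) (x, y) = snd (\<delta> (\<lambda>x. \<one>\<^bsub>I\<^esub>)) (x, y)"
        by (simp_all add: \<delta>_cochain \<delta>_simps l_inv Q.lie_closed)
    qed
    finally have "inv\<^bsub>Z2 B Q \<chi>\<^esub> G = \<delta> (\<lambda>x. inv\<^bsub>I\<^esub> h x)"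
      using \<delta>_Z2 [OF h] \<delta>_Z2 [OF hi] by (intro Z.inv_equality) (simp_all add: G mult one \<delta>1)
    then show "inv\<^bsub>Z2 B Q \<chi>\<^esub> G \<in> B2 B Q \<chi>" unfolding B2_eq using hi by blast
    fix G' assume "G' \<in> B2 B Q \<chi>"
    then obtain k where k: "k \<in> carrier Q \<rightarrow> carrier B" "k \<one>\<^bsub>Q\<^esub> = \<one>\<^bsub>I\<^esub>" and G': "G' = \<delta> k"
      by (auto simp: B2_eq)
    have "(\<lambda>x. h x \<otimes>\<^bsub>I\<^esub> k x) \<in> carrier Q \<rightarrow> carrier B" using h(1) k(1) by (simp add: Pi_iff)
    moreover have "h \<one>\<^bsub>Q\<^esub> \<otimes>\<^bsub>I\<^esub> k \<one>\<^bsub>Q\<^esub> = \<one>\<^bsub>I\<^esub>" using h(2) k(2) by simp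
    ultimately show "G \<otimes>\<^bsub>Z2 B Q \<chi>\<^esub> G' \<in> B2 B Q \<chi>"
      unfolding mult G G' \<delta>_mult [OF h k, symmetric] B2_eq by blast
  qed
qed

lemma normal_B2: "B2 B Q \<chi> \<lhd> Z2 B Q \<chi>"
  by (rule comm_group.subgroup_imp_normal [OF comm_group_Z2 subgroup_B2])

lemma group_H2: "group (H2 B Q \<chi>)"
  unfolding H2_def by (rule normal.factorgroup_is_group [OF normal_B2])

lemma twist_iso_iff:
  assumes S: "S \<in> carrier (Z2 B Q \<chi>)" and R: "R \<in> carrier (Z2 B Q \<chi>)"
  shows "(\<exists>f. ext_iso I (twist_ext E S) (twist_ext E R) f) \<longleftrightarrow> S \<in> B2 B Q \<chi> #>\<^bsub>Z2 B Q \<chi>\<^esub> R"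
proof -
  interpret Z: comm_group "Z2 B Q \<chi>" by (rule comm_group_Z2)
  have mult: "S \<otimes>\<^bsub>Z2 B Q \<chi>\<^esub> R = S \<otimes>\<^bsub>cochains B Q\<^esub> R" for S R by (subst Z2_eq) simp
  note SC = Z2_cochain [OF S] and RC = Z2_cochain [OF R]
  have eq: "\<delta> h \<otimes>\<^bsub>Z2 B Q \<chi>\<^esub> R = R \<otimes>\<^bsub>cochains B Q\<^esub> \<delta> h"
    if "h \<in> carrier Q \<rightarrow> carrier B" "h \<one>\<^bsub>Q\<^esub> = \<one>\<^bsub>I\<^esub>" for h
    unfolding mult by (rule C.m_comm [OF \<delta>_cochain [OF that] RC])
  show ?thesis
  proof
    assume "\<exists>f. ext_iso I (twist_ext E S) (twist_ext E R) f"
    then obtain f where f: "ext_iso I (twist_ext E S) (twist_ext E R) f" by blast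
    obtain k where k: "k \<in> carrier Q \<rightarrow>\<^sub>E carrier B" "k \<one>\<^bsub>Q\<^esub> = \<one>\<^bsub>I\<^esub>" "S = R \<otimes>\<^bsub>cochains B Q\<^esub> \<delta> k"
      using twist_iso_form [OF SC RC f] by blast
    have kp: "k \<in> carrier Q \<rightarrow> carrier B" using k(1) by auto
    then have "\<delta> k \<in> B2 B Q \<chi>" unfolding B2_eq using k(2) by blast
    moreover have "S = \<delta> k \<otimes>\<^bsub>Z2 B Q \<chi>\<^esub> R" using eq [OF kp k(2)] k(3) by simp
    ultimately show "S \<in> B2 B Q \<chi> #>\<^bsub>Z2 B Q \<chi>\<^esub> R" by (auto simp: r_coset_def)
  next
    assume "S \<in> B2 B Q \<chi> #>\<^bsub>Z2 B Q \<chi>\<^esub> R"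
    then obtain h where h: "h \<in> carrier Q \<rightarrow> carrier B" "h \<one>\<^bsub>Q\<^esub> = \<one>\<^bsub>I\<^esub>"
      and "S = \<delta> h \<otimes>\<^bsub>Z2 B Q \<chi>\<^esub> R"
      unfolding r_coset_def B2_eq by blast
    then have "S = R \<otimes>\<^bsub>cochains B Q\<^esub> \<delta> h" using eq by simp
    then show "\<exists>f. ext_iso I (twist_ext E S) (twist_ext E R) f"
      using twist_coboundary_iso [OF RC h] by blast
  qed
qed

end

section \<open>Sections and their cocycles\<close>

lemma section_cocycle_simps [simp]:
  "sigma (section_cocycle I Q E l) = sigma (section_action I Q E l)"
  "tau (section_cocycle I Q E l) = tau (section_action I Q E l)"
  "nu (section_cocycle I Q E l) = nu (section_action I Q E l)"
  "act_terms.truncate (section_cocycle I Q E l) = section_action I Q E l"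
  by (simp_all add: section_cocycle_def section_action_def act_terms.defs cocycle.defs)

lemma cocycle_shift_simps [simp]:
  "sigma (cocycle_shift I Q R S) = sigma R"
  "tau (cocycle_shift I Q R S) = tau R"
  "nu (cocycle_shift I Q R S) = nu R"
  "p \<in> carrier Q \<times> carrier Q \<Longrightarrow> coc (cocycle_shift I Q R S) p = coc R p \<otimes>\<^bsub>I\<^esub> fst S p"
  "p \<in> carrier Q \<times> carrier Q \<Longrightarrow> coc_f (cocycle_shift I Q R S) p = coc_f R p \<otimes>\<^bsub>I\<^esub> snd S p"
  by (simp_all add: cocycle_shift_def case_prod_beta)

lemma cocycle_ext_simps [simp]:
  "carrier (mid (cocycle_ext I Q T)) = carrier I \<times> carrier Q"
  "(a, x) \<otimes>\<^bsub>mid (cocycle_ext I Q T)\<^esub> (b, y) =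
    (a \<otimes>\<^bsub>I\<^esub> sigma T x b \<otimes>\<^bsub>I\<^esub> coc T (x, y), x \<otimes>\<^bsub>Q\<^esub> y)"
  "\<one>\<^bsub>mid (cocycle_ext I Q T)\<^esub> = (\<one>\<^bsub>I\<^esub>, \<one>\<^bsub>Q\<^esub>)"
  "\<lbrace>(a, x), (b, y)\<rbrace>\<^bsub>mid (cocycle_ext I Q T)\<^esub> =
    (cj I a (tau T x b) \<otimes>\<^bsub>I\<^esub> \<lbrace>a, b\<rbrace>\<^bsub>I\<^esub> \<otimes>\<^bsub>I\<^esub> b \<otimes>\<^bsub>I\<^esub> a \<otimes>\<^bsub>I\<^esub> coc_f T (x, y) \<otimes>\<^bsub>I\<^esub>
       sigma T \<lbrace>x, y\<rbrace>\<^bsub>Q\<^esub> (inv\<^bsub>I\<^esub> a \<otimes>\<^bsub>I\<^esub> nu T y a \<otimes>\<^bsub>I\<^esub> inv\<^bsub>I\<^esub> b), \<lbrace>x, y\<rbrace>\<^bsub>Q\<^esub>)"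
  "incl (cocycle_ext I Q T) a = (a, \<one>\<^bsub>Q\<^esub>)"
  "proj (cocycle_ext I Q T) = snd"
  by (simp_all add: cocycle_ext_def)

locale ext_section = mla_extension I Q E
  for I :: "'i mla" and Q :: "'q mla" and E :: "('i, 'a, 'q) mla_ext" +
  fixes l :: "'q \<Rightarrow> 'a"
  assumes sec: "is_section Q E l"
begin

lemma section_simps [simp]:
  "x \<in> carrier Q \<Longrightarrow> l x \<in> carrier A" "x \<in> carrier Q \<Longrightarrow> \<pi> (l x) = x" "l \<one>\<^bsub>Q\<^esub> = \<one>\<^bsub>A\<^esub>"
  using sec by (auto simp: is_section_def)

abbreviation \<alpha> where "\<alpha> \<equiv> section_action I Q E l"
abbreviation R where "R \<equiv> section_cocycle I Q E l"

lemma incl_section_action: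
  assumes "x \<in> carrier Q" "a \<in> carrier I"
  shows "\<iota> (sigma \<alpha> x a) = cj A (l x) (\<iota> a)" "\<iota> (tau \<alpha> x a) = \<lbrace>l x, \<iota> a\<rbrace>\<^bsub>A\<^esub>"
    "\<iota> (nu \<alpha> x a) = \<lbrace>\<iota> a, l x\<rbrace>\<^bsub>A\<^esub>"
  using assms by (simp_all add: section_action_def incl_inv_closed A.lie_closed)

lemma section_action_closed [simp]:
  assumes "x \<in> carrier Q" "a \<in> carrier I"
  shows "sigma \<alpha> x a \<in> carrier I" "tau \<alpha> x a \<in> carrier I" "nu \<alpha> x a \<in> carrier I"
  using assms by (simp_all add: section_action_def incl_inv_closed A.lie_closed)

lemma incl_section_cocycle:
  assumes "x \<in> carrier Q" "y \<in> carrier Q"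
  shows "\<iota> (coc R (x, y)) = l x \<otimes>\<^bsub>A\<^esub> l y \<otimes>\<^bsub>A\<^esub> inv\<^bsub>A\<^esub> l (x \<otimes>\<^bsub>Q\<^esub> y)"
    "\<iota> (coc_f R (x, y)) = \<lbrace>l x, l y\<rbrace>\<^bsub>A\<^esub> \<otimes>\<^bsub>A\<^esub> inv\<^bsub>A\<^esub> l \<lbrace>x, y\<rbrace>\<^bsub>Q\<^esub>"
  using assms by (simp_all add: section_cocycle_def act_terms.defs cocycle.defs incl_inv_closed
      A.lie_closed Q.lie_closed)

lemma section_cocycle_closed [simp]:
  assumes "x \<in> carrier Q" "y \<in> carrier Q"
  shows "coc R (x, y) \<in> carrier I" "coc_f R (x, y) \<in> carrier I"
  using assms by (simp_all add: section_cocycle_def act_terms.defs cocycle.defs incl_inv_closed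
      A.lie_closed Q.lie_closed)

lemma decompose:
  assumes "u \<in> carrier A"
  obtains a where "a \<in> carrier I" "u = \<iota> a \<otimes>\<^bsub>A\<^esub> l (\<pi> u)"
  by (rule proj_eqE [of u "l (\<pi> u)"]) (use assms in auto)

lemma section_action_one:
  assumes "a \<in> carrier I"
  shows "sigma \<alpha> \<one>\<^bsub>Q\<^esub> a = a" "tau \<alpha> \<one>\<^bsub>Q\<^esub> a = \<one>\<^bsub>I\<^esub>" "nu \<alpha> \<one>\<^bsub>Q\<^esub> a = \<one>\<^bsub>I\<^esub>"
  using assms incl_inv_incl [of "\<one>\<^bsub>I\<^esub>"] by (simp_all add: section_action_def del: incl_inv_incl)
    (simp_all)

lemma sigma_auto: 
  assumes x: "x \<in> carrier Q"
  shows "sigma \<alpha> x \<in> mla_auto I"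
proof -
  note [simp] = x
  have inj: "a = b" if "sigma \<alpha> x a = sigma \<alpha> x b" "a \<in> carrier I" "b \<in> carrier I" for a b
  proof -
    have "cj A (inv\<^bsub>A\<^esub> (l x)) (cj A (l x) (\<iota> a)) = cj A (inv\<^bsub>A\<^esub> (l x)) (cj A (l x) (\<iota> b))"
      using that by (simp flip: incl_section_action)
    then show ?thesis using that by simp
  qed
  have surj: "\<exists>b \<in> carrier I. a = sigma \<alpha> x b" if [simp]: "a \<in> carrier I" for a
  proof
    let ?b = "incl_inv I E (cj A (inv\<^bsub>A\<^esub> (l x)) (\<iota> a))"
    show b: "?b \<in> carrier I" by (simp add: incl_inv_closed)
    have "\<iota> (sigma \<alpha> x ?b) = \<iota> a" using b by (simp add: incl_section_action incl_inv_closed)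
    then show "a = sigma \<alpha> x ?b" using b by simp
  qed
  have "\<iota> (sigma \<alpha> x (a \<otimes>\<^bsub>I\<^esub> b)) = \<iota> (sigma \<alpha> x a \<otimes>\<^bsub>I\<^esub> sigma \<alpha> x b)"
    "\<iota> (sigma \<alpha> x \<lbrace>a, b\<rbrace>\<^bsub>I\<^esub>) = \<iota> \<lbrace>sigma \<alpha> x a, sigma \<alpha> x b\<rbrace>\<^bsub>I\<^esub>"
    if "a \<in> carrier I" "b \<in> carrier I" for a b
    using that by (simp_all add: incl_section_action A.cj_mult A.lie_conj I.lie_closed)
  then have "sigma \<alpha> x (a \<otimes>\<^bsub>I\<^esub> b) = sigma \<alpha> x a \<otimes>\<^bsub>I\<^esub> sigma \<alpha> x b"
    "sigma \<alpha> x \<lbrace>a, b\<rbrace>\<^bsub>I\<^esub> = \<lbrace>sigma \<alpha> x a, sigma \<alpha> x b\<rbrace>\<^bsub>I\<^esub>"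
    if "a \<in> carrier I" "b \<in> carrier I" for a b
    using that x
    by (simp_all only: incl_eq_iff section_action_closed I.m_closed I.lie_closed)
  then have hom: "sigma \<alpha> x \<in> mla_hom I I"
    by (auto simp: mla_hom_def hom_def I.lie_closed)
  have "sigma \<alpha> x ` carrier I = carrier I"
    using surj by (auto simp: image_iff)
  moreover have "inj_on (sigma \<alpha> x) (carrier I)" by (rule inj_onI) (rule inj)
  ultimately have "bij_betw (sigma \<alpha> x) (carrier I) (carrier I)" by (simp add: bij_betw_def)
  moreover have "sigma \<alpha> x \<in> extensional (carrier I)" by (simp add: section_action_def)
  ultimately show ?thesis using hom by (simp add: mla_auto_def Bij_def)
qed

lemma action_terms_section: "action_terms I Q \<alpha>"
proof -
  have "sigma \<alpha> \<in> carrier Q \<rightarrow>\<^sub>E mla_auto I"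
    using sigma_auto by (auto simp: section_action_def PiE_iff)
  moreover have "tau \<alpha> \<in> carrier Q \<rightarrow>\<^sub>E (carrier I \<rightarrow>\<^sub>E carrier I)"
    "nu \<alpha> \<in> carrier Q \<rightarrow>\<^sub>E (carrier I \<rightarrow>\<^sub>E carrier I)"
    by (simp_all add: section_action_def PiE_iff incl_inv_closed A.lie_closed)
  moreover have "\<iota> (tau \<alpha> x \<one>\<^bsub>I\<^esub>) = \<iota> \<one>\<^bsub>I\<^esub>" "\<iota> (nu \<alpha> x \<one>\<^bsub>I\<^esub>) = \<iota> \<one>\<^bsub>I\<^esub>" if "x \<in> carrier Q" for x
    using that by (simp_all only: incl_section_action I.one_closed) simp_all
  then have "tau \<alpha> x \<one>\<^bsub>I\<^esub> = \<one>\<^bsub>I\<^esub>" "nu \<alpha> x \<one>\<^bsub>I\<^esub> = \<one>\<^bsub>I\<^esub>" if "x \<in> carrier Q" for x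
    using that by (simp_all only: incl_eq_iff section_action_closed I.one_closed)
  ultimately show ?thesis by (simp add: action_terms_def)
qed

text \<open>
  The action on \<open>B\<close> does not depend on the element over \<open>x\<close>: changing
  it by an element of \<open>I\<close> has no effect on central elements.
\<close>

lemma central_action_section: "central_action I Q E (act_restrict B Q \<alpha>)"
proof unfold_locales
  fix u b assume [simp]: "u \<in> carrier A" and b: "b \<in> carrier B"
  note [simp] = I.Z_carrier [OF b]
  obtain a where [simp]: "a \<in> carrier I" and u: "u = \<iota> a \<otimes>\<^bsub>A\<^esub> l (\<pi> u)"
    using decompose [OF \<open>u \<in> carrier A\<close>] .
  define s t n where "s = sigma \<alpha> (\<pi> u) b" and "t = tau \<alpha> (\<pi> u) b" and "n = nu \<alpha> (\<pi> u) b"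
  have stn: "s \<in> carrier B" "t \<in> carrier B" "n \<in> carrier B"
    using center_stable [of "l (\<pi> u)" b] b by (simp_all add: s_def t_def n_def section_action_def)
  have incl: "\<iota> s = cj A (l (\<pi> u)) (\<iota> b)" "\<iota> t = \<lbrace>l (\<pi> u), \<iota> b\<rbrace>\<^bsub>A\<^esub>" "\<iota> n = \<lbrace>\<iota> b, l (\<pi> u)\<rbrace>\<^bsub>A\<^esub>"
    by (simp_all add: s_def t_def n_def incl_section_action)
  have fixed: "cj A (\<iota> a) (\<iota> c) = \<iota> c" if "c \<in> carrier B" for c
    using I.Z_cj [OF that \<open>a \<in> carrier I\<close>] I.Z_carrier [OF that] by (simp flip: incl_cj)
  have "\<lbrace>\<iota> a, \<iota> b\<rbrace>\<^bsub>A\<^esub> = \<one>\<^bsub>A\<^esub>" "\<lbrace>\<iota> b, \<iota> a\<rbrace>\<^bsub>A\<^esub> = \<one>\<^bsub>A\<^esub>"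
    using I.Z_lie [OF b, of a] by (simp_all flip: incl_lie)
  moreover have "cj A u (\<iota> b) = cj A (\<iota> a) (\<iota> s)" by (subst u) (simp add: incl flip: A.cj_cj)
  moreover have "\<lbrace>u, \<iota> b\<rbrace>\<^bsub>A\<^esub> = cj A (\<iota> a) (\<iota> t) \<otimes>\<^bsub>A\<^esub> \<lbrace>\<iota> a, \<iota> b\<rbrace>\<^bsub>A\<^esub>"
    by (subst u) (simp add: A.lie_mult_left incl)
  moreover have "\<lbrace>\<iota> b, u\<rbrace>\<^bsub>A\<^esub> = \<lbrace>\<iota> b, \<iota> a\<rbrace>\<^bsub>A\<^esub> \<otimes>\<^bsub>A\<^esub> cj A (\<iota> a) (\<iota> n)"
    by (subst u) (simp add: A.lie_mult_right incl)
  ultimately have "cj A u (\<iota> b) = \<iota> s" "\<lbrace>u, \<iota> b\<rbrace>\<^bsub>A\<^esub> = \<iota> t" "\<lbrace>\<iota> b, u\<rbrace>\<^bsub>A\<^esub> = \<iota> n"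
    using fixed stn by (simp_all add: I.Z_carrier)
  then show "sigma (act_restrict B Q \<alpha>) (\<pi> u) b \<in> carrier B \<and>
    tau (act_restrict B Q \<alpha>) (\<pi> u) b \<in> carrier B \<and>
    nu (act_restrict B Q \<alpha>) (\<pi> u) b \<in> carrier B \<and>
    \<iota> (sigma (act_restrict B Q \<alpha>) (\<pi> u) b) = cj A u (\<iota> b) \<and>
    \<iota> (tau (act_restrict B Q \<alpha>) (\<pi> u) b) = \<lbrace>u, \<iota> b\<rbrace>\<^bsub>A\<^esub> \<and>
    \<iota> (nu (act_restrict B Q \<alpha>) (\<pi> u) b) = \<lbrace>\<iota> b, u\<rbrace>\<^bsub>A\<^esub>"
    using stn b by (simp add: act_restrict_def s_def t_def n_def)
qed

lemma bij_decode: "bij_betw (decode E l) (carrier I \<times> carrier Q) (carrier A)"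
proof (rule bij_betwI')
  fix p q assume "p \<in> carrier I \<times> carrier Q" "q \<in> carrier I \<times> carrier Q"
  then obtain a x b y where p: "p = (a, x)" "q = (b, y)"
    and [simp]: "a \<in> carrier I" "x \<in> carrier Q" "b \<in> carrier I" "y \<in> carrier Q" by auto
  show "(decode E l p = decode E l q) = (p = q)"
  proof
    assume eq: "decode E l p = decode E l q"
    then have "\<pi> (decode E l p) = \<pi> (decode E l q)" by simp
    then have "x = y" by (simp add: decode_def p)
    then show "p = q" using eq by (simp add: decode_def p)
  qed simp
next
  fix p assume "p \<in> carrier I \<times> carrier Q"
  then show "decode E l p \<in> carrier A" by (auto simp: decode_def)
next
  fix u assume u: "u \<in> carrier A"
  obtain a where "a \<in> carrier I" "u = \<iota> a \<otimes>\<^bsub>A\<^esub> l (\<pi> u)" using decompose [OF u] .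
  then show "\<exists>p \<in> carrier I \<times> carrier Q. u = decode E l p"
    using u by (intro bexI [of _ "(a, \<pi> u)"]) (simp_all add: decode_def)
qed

text \<open>
  For trivial \<open>S\<close> this is the isomorphism of $I \rtimes_R Q$ with \<open>A\<close>;
  the formula for its bracket is \<open>lie_expand_sorted\<close>.
\<close>

lemma decode_iso:
  assumes S: "S \<in> carrier (cochains B Q)"
  shows "ext_iso I (cocycle_ext I Q (cocycle_shift I Q R S)) (twist_ext E S) (decode E l)"
    (is "ext_iso I ?E' _ _")
proof -
  have S' [simp]: "fst S (x, y) \<in> carrier B" "snd S (x, y) \<in> carrier B"
    "fst S (x, y) \<in> carrier I" "snd S (x, y) \<in> carrier I"
    if "x \<in> carrier Q" "y \<in> carrier Q" for x y
    using cochain_mem [OF S that] by (simp_all add: I.Z_carrier)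
  note [simp] = A.lie_closed I.lie_closed Q.lie_closed
  have "p \<otimes>\<^bsub>mid ?E'\<^esub> q \<in> carrier I \<times> carrier Q \<and>
      decode E l (p \<otimes>\<^bsub>mid ?E'\<^esub> q) = decode E l p \<otimes>\<^bsub>mid (twist_ext E S)\<^esub> decode E l q \<and>
      \<lbrace>p, q\<rbrace>\<^bsub>mid ?E'\<^esub> \<in> carrier I \<times> carrier Q \<and>
      decode E l \<lbrace>p, q\<rbrace>\<^bsub>mid ?E'\<^esub> = \<lbrace>decode E l p, decode E l q\<rbrace>\<^bsub>mid (twist_ext E S)\<^esub>"
    if pq: "p \<in> carrier I \<times> carrier Q" "q \<in> carrier I \<times> carrier Q" for p q
  proof -
    obtain a x b y where p: "p = (a, x)" and q: "q = (b, y)"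
      and [simp]: "a \<in> carrier I" "x \<in> carrier Q" "b \<in> carrier I" "y \<in> carrier Q" using pq by auto
    let ?s = "fst S (x, y)" and ?s' = "snd S (x, y)"
    \<comment> \<open>The value of the central cochain can be moved to the front.\<close>
    have front: "c \<otimes>\<^bsub>I\<^esub> (d \<otimes>\<^bsub>I\<^esub> s) = s \<otimes>\<^bsub>I\<^esub> (c \<otimes>\<^bsub>I\<^esub> d)"
      if "c \<in> carrier I" "d \<in> carrier I" "s \<in> carrier B" for c d s
      using that I.Z_comm [of s "c \<otimes>\<^bsub>I\<^esub> d"] by (simp add: I.m_assoc I.Z_carrier)
    have "a \<otimes>\<^bsub>I\<^esub> sigma \<alpha> x b \<otimes>\<^bsub>I\<^esub> (coc R (x, y) \<otimes>\<^bsub>I\<^esub> ?s) =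
        ?s \<otimes>\<^bsub>I\<^esub> (a \<otimes>\<^bsub>I\<^esub> sigma \<alpha> x b \<otimes>\<^bsub>I\<^esub> coc R (x, y))"
      by (rule front) simp_all
    then have mult: "decode E l (p \<otimes>\<^bsub>mid ?E'\<^esub> q) =
        decode E l p \<otimes>\<^bsub>mid (twist_ext E S)\<^esub> decode E l q"
      by (simp add: p q decode_def incl_section_action incl_section_cocycle cj_def A.group_word)
    define X where "X = inv\<^bsub>I\<^esub> a \<otimes>\<^bsub>I\<^esub> nu \<alpha> y a \<otimes>\<^bsub>I\<^esub> inv\<^bsub>I\<^esub> b"
    have X [simp]: "X \<in> carrier I"
      and \<iota>X: "\<iota> X = inv\<^bsub>A\<^esub> \<iota> a \<otimes>\<^bsub>A\<^esub> \<lbrace>\<iota> a, l y\<rbrace>\<^bsub>A\<^esub> \<otimes>\<^bsub>A\<^esub> inv\<^bsub>A\<^esub> \<iota> b"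
      by (simp_all add: X_def incl_section_action)
    define P where "P = cj I a (tau \<alpha> x b) \<otimes>\<^bsub>I\<^esub> \<lbrace>a, b\<rbrace>\<^bsub>I\<^esub> \<otimes>\<^bsub>I\<^esub> b \<otimes>\<^bsub>I\<^esub> a"
    have P [simp]: "P \<in> carrier I"
      and \<iota>P: "\<iota> P = cj A (\<iota> a) \<lbrace>l x, \<iota> b\<rbrace>\<^bsub>A\<^esub> \<otimes>\<^bsub>A\<^esub> \<lbrace>\<iota> a, \<iota> b\<rbrace>\<^bsub>A\<^esub> \<otimes>\<^bsub>A\<^esub> \<iota> b \<otimes>\<^bsub>A\<^esub> \<iota> a"
      by (simp_all add: P_def incl_section_action)
    have "P \<otimes>\<^bsub>I\<^esub> (coc_f R (x, y) \<otimes>\<^bsub>I\<^esub> ?s') = ?s' \<otimes>\<^bsub>I\<^esub> (P \<otimes>\<^bsub>I\<^esub> coc_f R (x, y))"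
      by (rule front) simp_all
    then have "\<lbrace>p, q\<rbrace>\<^bsub>mid ?E'\<^esub> =
        (?s' \<otimes>\<^bsub>I\<^esub> (P \<otimes>\<^bsub>I\<^esub> coc_f R (x, y)) \<otimes>\<^bsub>I\<^esub> sigma \<alpha> \<lbrace>x, y\<rbrace>\<^bsub>Q\<^esub> X, \<lbrace>x, y\<rbrace>\<^bsub>Q\<^esub>)"
      by (simp add: p q X_def P_def)
    then have "decode E l \<lbrace>p, q\<rbrace>\<^bsub>mid ?E'\<^esub> = \<iota> ?s' \<otimes>\<^bsub>A\<^esub>
        (\<iota> P \<otimes>\<^bsub>A\<^esub> cj A \<lbrace>l x, l y\<rbrace>\<^bsub>A\<^esub> (\<iota> X) \<otimes>\<^bsub>A\<^esub> \<lbrace>l x, l y\<rbrace>\<^bsub>A\<^esub>)"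
      by (simp add: decode_def incl_section_action incl_section_cocycle cj_def A.group_word)
    also have "\<dots> = \<iota> ?s' \<otimes>\<^bsub>A\<^esub> \<lbrace>\<iota> a \<otimes>\<^bsub>A\<^esub> l x, \<iota> b \<otimes>\<^bsub>A\<^esub> l y\<rbrace>\<^bsub>A\<^esub>"
      unfolding \<iota>X \<iota>P by (subst A.lie_expand_sorted) simp_all
    finally have lie: "decode E l \<lbrace>p, q\<rbrace>\<^bsub>mid ?E'\<^esub> =
        \<lbrace>decode E l p, decode E l q\<rbrace>\<^bsub>mid (twist_ext E S)\<^esub>"
      by (simp add: p q decode_def)
    show ?thesis using mult lie by (simp add: p q)
  qed
  moreover have "\<pi> (decode E l p) = snd p" if "p \<in> carrier I \<times> carrier Q" for p
    using that by (auto simp: decode_def)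
  ultimately show ?thesis
    using bij_decode unfolding ext_iso_def by (simp add: decode_def)
qed

lemma cocycle_shift_one: "cocycle_shift I Q R \<one>\<^bsub>cochains B Q\<^esub> = R"
  unfolding cocycle_shift_def cochains_def
  by (rule cocycle.equality)
    (auto simp: section_cocycle_def section_action_def act_terms.defs cocycle.defs fun_eq_iff
      incl_inv_closed A.lie_closed Q.lie_closed)

lemma decode_iso_one: "ext_iso I (cocycle_ext I Q R) E (decode E l)"
  using ext_iso_trans [OF decode_iso [OF C.one_closed] twist_one_iso]
  by (simp add: cocycle_shift_one comp_def)

lemma section_transport:
  assumes f: "ext_iso I E E' f" and E': "extension I Q E'"
  shows "is_section Q E' (f \<circ> l)" "section_cocycle I Q E' (f \<circ> l) = R"
    "section_action I Q E' (f \<circ> l) = \<alpha>"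
proof -
  interpret E': mla_extension I Q E' by unfold_locales fact
  note D = ext_isoD [OF f]
  interpret f: group_hom "mid E" "mid E'" f
    using D(2,4) by unfold_locales (simp add: hom_def)
  show "is_section Q E' (f \<circ> l)" by (simp add: is_section_def D)
  have inv: "incl_inv I E' (f u) = incl_inv I E u" if "u \<in> carrier A" "\<pi> u = \<one>\<^bsub>Q\<^esub>" for u
    by (rule proj_oneE [OF that]) (simp add: D)
  have "incl_inv I E' (cj (mid E') (f (l x)) (incl E' a)) = incl_inv I E (cj A (l x) (\<iota> a))"
    "incl_inv I E' \<lbrace>f (l x), incl E' a\<rbrace>\<^bsub>mid E'\<^esub> = incl_inv I E \<lbrace>l x, \<iota> a\<rbrace>\<^bsub>A\<^esub>"
    "incl_inv I E' \<lbrace>incl E' a, f (l x)\<rbrace>\<^bsub>mid E'\<^esub> = incl_inv I E \<lbrace>\<iota> a, l x\<rbrace>\<^bsub>A\<^esub>"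
    if "x \<in> carrier Q" "a \<in> carrier I" for x a
    using that inv [of "cj A (l x) (\<iota> a)"] inv [of "\<lbrace>l x, \<iota> a\<rbrace>\<^bsub>A\<^esub>"] inv [of "\<lbrace>\<iota> a, l x\<rbrace>\<^bsub>A\<^esub>"]
    by (simp_all add: D cj_def A.lie_closed)
  then show act: "section_action I Q E' (f \<circ> l) = \<alpha>"
    by (simp add: section_action_def cong: restrict_cong)
  have "incl_inv I E' (f (l x) \<otimes>\<^bsub>mid E'\<^esub> f (l y) \<otimes>\<^bsub>mid E'\<^esub> inv\<^bsub>mid E'\<^esub> f (l (x \<otimes>\<^bsub>Q\<^esub> y))) =
      incl_inv I E (l x \<otimes>\<^bsub>A\<^esub> l y \<otimes>\<^bsub>A\<^esub> inv\<^bsub>A\<^esub> l (x \<otimes>\<^bsub>Q\<^esub> y))"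
    "incl_inv I E' (\<lbrace>f (l x), f (l y)\<rbrace>\<^bsub>mid E'\<^esub> \<otimes>\<^bsub>mid E'\<^esub> inv\<^bsub>mid E'\<^esub> f (l \<lbrace>x, y\<rbrace>\<^bsub>Q\<^esub>)) =
      incl_inv I E (\<lbrace>l x, l y\<rbrace>\<^bsub>A\<^esub> \<otimes>\<^bsub>A\<^esub> inv\<^bsub>A\<^esub> l \<lbrace>x, y\<rbrace>\<^bsub>Q\<^esub>)"
    if "x \<in> carrier Q" "y \<in> carrier Q" for x y
    using that inv [of "l x \<otimes>\<^bsub>A\<^esub> l y \<otimes>\<^bsub>A\<^esub> inv\<^bsub>A\<^esub> l (x \<otimes>\<^bsub>Q\<^esub> y)"]
      inv [of "\<lbrace>l x, l y\<rbrace>\<^bsub>A\<^esub> \<otimes>\<^bsub>A\<^esub> inv\<^bsub>A\<^esub> l \<lbrace>x, y\<rbrace>\<^bsub>Q\<^esub>"]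
    by (simp_all add: D A.lie_closed Q.lie_closed)
  then show "section_cocycle I Q E' (f \<circ> l) = R"
    unfolding section_cocycle_def act
    by (simp add: case_prod_beta mem_Times_iff cong: restrict_cong)
qed

text \<open>
  The middle term can be transported to \<open>'i \<times> 'q\<close>, the type that
  \<^const>\<open>two_cocycle\<close> asks for: the section \<open>x \<mapsto> (1, x)\<close> of
  $I \rtimes_R Q$ corresponds to \<open>l\<close> under \<open>decode\<close>.
\<close>

lemma two_cocycle_section: "two_cocycle I Q R"
proof -
  have E': "extension I Q (cocycle_ext I Q R)" by (rule extension_iso [OF decode_iso_one ext])
  have "is_section Q (cocycle_ext I Q R) (\<lambda>x. (\<one>\<^bsub>I\<^esub>, x))" by (simp add: is_section_def)
  then interpret E': ext_section I Q "cocycle_ext I Q R" "\<lambda>x. (\<one>\<^bsub>I\<^esub>, x)"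
    by unfold_locales (rule E')
  have "section_cocycle I Q (cocycle_ext I Q R) (\<lambda>x. (\<one>\<^bsub>I\<^esub>, x)) =
      section_cocycle I Q E (decode E l \<circ> (\<lambda>x. (\<one>\<^bsub>I\<^esub>, x)))"
    by (rule E'.section_transport(2) [OF decode_iso_one ext, symmetric])
  also have "\<dots> = R"
    by (simp add: section_cocycle_def section_action_def decode_def Q.lie_closed case_prod_beta
        mem_Times_iff cong: restrict_cong)
  finally show ?thesis
    unfolding two_cocycle_def using E' E'.sec by (intro exI conjI) (assumption, assumption, rule sym)
qed

lemma change_section:
  assumes l': "is_section Q E l'"
  shows "act_equiv I Q \<alpha> (section_action I Q E l')"
proof -
  interpret S': ext_section I Q E l' by unfold_locales fact
  define h where "h x = incl_inv I E (l x \<otimes>\<^bsub>A\<^esub> inv\<^bsub>A\<^esub> l' x)" for x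
  have h: "h x \<in> carrier I" "\<iota> (h x) = l x \<otimes>\<^bsub>A\<^esub> inv\<^bsub>A\<^esub> l' x" if "x \<in> carrier Q" for x
    using that by (simp_all add: h_def incl_inv_closed)
  have l: "l x = \<iota> (h x) \<otimes>\<^bsub>A\<^esub> l' x" if "x \<in> carrier Q" for x
    using that by (simp add: h A.m_assoc)
  note [simp] = h(1)
  have "\<iota> (sigma \<alpha> x a) = \<iota> (cj I (h x) (sigma S'.\<alpha> x a))"
    "\<iota> (tau \<alpha> x a) = \<iota> (cj I (h x) (tau S'.\<alpha> x a) \<otimes>\<^bsub>I\<^esub> \<lbrace>h x, a\<rbrace>\<^bsub>I\<^esub>)"
    "\<iota> (nu \<alpha> x a) = \<iota> (\<lbrace>a, h x\<rbrace>\<^bsub>I\<^esub> \<otimes>\<^bsub>I\<^esub> cj I (h x) (nu S'.\<alpha> x a))"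
    if x: "x \<in> carrier Q" and a: "a \<in> carrier I" for x a
    unfolding incl_section_action [OF x a] l [OF x]
    using x a by (simp_all add: S'.incl_section_action A.cj_cj A.lie_mult_left A.lie_mult_right
        I.lie_closed)
  then have "sigma \<alpha> x a = cj I (h x) (sigma S'.\<alpha> x a) \<and>
    tau \<alpha> x a = cj I (h x) (tau S'.\<alpha> x a) \<otimes>\<^bsub>I\<^esub> \<lbrace>h x, a\<rbrace>\<^bsub>I\<^esub> \<and>
    nu \<alpha> x a = \<lbrace>a, h x\<rbrace>\<^bsub>I\<^esub> \<otimes>\<^bsub>I\<^esub> cj I (h x) (nu S'.\<alpha> x a)"
    if "x \<in> carrier Q" "a \<in> carrier I" for x a
    using that by (simp_all only: incl_eq_iff section_action_closed S'.section_action_closed h(1)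
        I.cj_closed I.m_closed I.lie_closed simp_thms)
  then show ?thesis
    unfolding act_equiv_def by (intro bexI [of _ h]) auto
qed

end

lemma ext_sectionI: "extension I Q E \<Longrightarrow> is_section Q E l \<Longrightarrow> ext_section I Q E l"
  by (simp add: ext_section_def mla_extension_def ext_section_axioms_def)

text \<open>
  Multiply the section by the function \<open>h\<close> that witnesses the equivalence. At
  \<open>1\<close> the value is replaced by \<open>1\<close>, which is harmless because all
  action terms of sections agree there.
\<close>

lemma section_with_action:
  assumes "ext_section I Q E l" "ext_section I Q E' l'"
    and eq: "act_equiv I Q (section_action I Q E' l') (section_action I Q E l)"
  obtains m where "is_section Q E m" "section_action I Q E m = section_action I Q E' l'"
proof -
  interpret E: ext_section I Q E l by fact
  interpret E': ext_section I Q E' l' by fact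
  obtain h where h: "h \<in> carrier Q \<rightarrow> carrier I"
    and eq: "\<And>x a. x \<in> carrier Q \<Longrightarrow> a \<in> carrier I \<Longrightarrow>
        sigma E'.\<alpha> x a = cj I (h x) (sigma E.\<alpha> x a) \<and>
        tau E'.\<alpha> x a = cj I (h x) (tau E.\<alpha> x a) \<otimes>\<^bsub>I\<^esub> \<lbrace>h x, a\<rbrace>\<^bsub>I\<^esub> \<and>
        nu E'.\<alpha> x a = \<lbrace>a, h x\<rbrace>\<^bsub>I\<^esub> \<otimes>\<^bsub>I\<^esub> cj I (h x) (nu E.\<alpha> x a)"
    using eq unfolding act_equiv_def by (elim bexE) blast
  have [simp]: "h x \<in> carrier I" if "x \<in> carrier Q" for x using h that by auto
  define m where "m x = (if x = \<one>\<^bsub>Q\<^esub> then \<one>\<^bsub>mid E\<^esub> else incl E (h x) \<otimes>\<^bsub>mid E\<^esub> l x)" for x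
  have m: "is_section Q E m" by (simp add: is_section_def m_def)
  interpret M: ext_section I Q E m by unfold_locales (rule m)
  have "sigma M.\<alpha> x a = sigma E'.\<alpha> x a \<and> tau M.\<alpha> x a = tau E'.\<alpha> x a \<and> nu M.\<alpha> x a = nu E'.\<alpha> x a"
    if x: "x \<in> carrier Q" and a: "a \<in> carrier I" for x a
  proof (cases "x = \<one>\<^bsub>Q\<^esub>")
    case True
    then show ?thesis using a by (simp add: M.section_action_one E'.section_action_one)
  next
    case False
    then have "incl E (sigma M.\<alpha> x a) = incl E (sigma E'.\<alpha> x a)"
      "incl E (tau M.\<alpha> x a) = incl E (tau E'.\<alpha> x a)"
      "incl E (nu M.\<alpha> x a) = incl E (nu E'.\<alpha> x a)"
      unfolding M.incl_section_action [OF x a] using x a eq [OF x a]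
      by (simp_all add: m_def E.incl_section_action E.A.cj_cj E.A.lie_mult_left E.A.lie_mult_right
          E.I.lie_closed)
    then show ?thesis using x a by simp
  qed
  then have "section_action I Q E m = section_action I Q E' l'"
    by (intro act_terms.equality)
      (simp_all add: section_action_def fun_eq_iff restrict_def)
  then show ?thesis by (rule that [OF m])
qed

text \<open>
  In the product of the two middle terms, both the diagonal \<open>J\<close> of \<open>I\<close>
  and the pairs of values of the sections lie in the idealizer of \<open>J\<close>, the latter
  because the action terms agree. The idealizer is a subalgebra, so it contains the pairs
  $(\iota_1(T_1(x,y)), \iota_2(T_2(x,y)))$ and those for the bracket. A pair $(\iota_1(a),
  \iota_2(b))$ in it means that \<open>a\<close> and \<open>b\<close> act in the same way on
  \<open>I\<close>, so $a^{-1}b$ is central.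
\<close>

lemma same_action_cocycle:
  assumes "ext_section I Q E\<^sub>1 l\<^sub>1" "ext_section I Q E\<^sub>2 l\<^sub>2"
    and act: "section_action I Q E\<^sub>1 l\<^sub>1 = section_action I Q E\<^sub>2 l\<^sub>2"
  obtains S where "S \<in> carrier (cochains (alg_center I) Q)"
    "section_cocycle I Q E\<^sub>2 l\<^sub>2 = cocycle_shift I Q (section_cocycle I Q E\<^sub>1 l\<^sub>1) S"
proof -
  interpret E\<^sub>1: ext_section I Q E\<^sub>1 l\<^sub>1 by fact
  interpret E\<^sub>2: ext_section I Q E\<^sub>2 l\<^sub>2 by fact
  let ?X = "mla_prod (mid E\<^sub>1) (mid E\<^sub>2)"
  let ?j = "\<lambda>a. (incl E\<^sub>1 a, incl E\<^sub>2 a)"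
  let ?J = "?j ` carrier I"
  interpret X: mult_lie_algebra ?X
    by (rule mult_lie_algebra_mla_prod) (rule E\<^sub>1.A.mult_lie_algebra_axioms E\<^sub>2.A.mult_lie_algebra_axioms)+
  note X_inv = inv_mla_prod [OF E\<^sub>1.A.is_group E\<^sub>2.A.is_group]
    and X_cj = cj_mla_prod [OF E\<^sub>1.A.is_group E\<^sub>2.A.is_group]
  have j_ops: "?j a \<otimes>\<^bsub>?X\<^esub> ?j b = ?j (a \<otimes>\<^bsub>I\<^esub> b)" "\<lbrace>?j a, ?j b\<rbrace>\<^bsub>?X\<^esub> = ?j \<lbrace>a, b\<rbrace>\<^bsub>I\<^esub>"
    "inv\<^bsub>?X\<^esub> ?j a = ?j (inv\<^bsub>I\<^esub> a)" "cj ?X (?j a) (?j b) = ?j (cj I a b)"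
    if "a \<in> carrier I" "b \<in> carrier I" for a b
    using that by (simp_all add: X_inv X_cj)
  have JE: thesis if "p \<in> ?J" "\<And>a. a \<in> carrier I \<Longrightarrow> p = ?j a \<Longrightarrow> thesis" for p thesis
    using that by blast
  have j_in: "?j a \<in> ?J" if "a \<in> carrier I" for a using that by (rule imageI)
  have J: "subalgebra ?J ?X"
    unfolding subalgebra_def
  proof (intro conjI ballI subgroup.intro)
    show "?J \<subseteq> carrier ?X" by auto
    show "\<one>\<^bsub>?X\<^esub> \<in> ?J" using j_in [of "\<one>\<^bsub>I\<^esub>"] by simp
  next
    fix p q assume "p \<in> ?J" "q \<in> ?J"
    then show "p \<otimes>\<^bsub>?X\<^esub> q \<in> ?J" by (elim JE) (simp only: j_ops j_in E\<^sub>1.I.m_closed)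
  next
    fix p q assume "p \<in> ?J" "q \<in> ?J"
    then show "\<lbrace>p, q\<rbrace>\<^bsub>?X\<^esub> \<in> ?J" by (elim JE) (simp only: j_ops j_in E\<^sub>1.I.lie_closed)
  next
    fix p assume "p \<in> ?J"
    then show "inv\<^bsub>?X\<^esub> p \<in> ?J" by (elim JE) (simp only: j_ops j_in E\<^sub>1.I.inv_closed)
  qed
  let ?N = "idealizer ?J ?X"
  have N: "subalgebra ?N ?X" by (rule X.subalgebra_idealizer [OF J])
  interpret N: subgroup ?N ?X using N by (simp add: subalgebra_def)
  have N_lie: "\<lbrace>p, q\<rbrace>\<^bsub>?X\<^esub> \<in> ?N" if "p \<in> ?N" "q \<in> ?N" for p q
    using N that by (simp add: subalgebra_def)
  have jN: "?j a \<in> ?N" if a: "a \<in> carrier I" for a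
    using X.subalgebra_le_idealizer [OF J] j_in [OF a] by (rule subsetD)
  have lN: "(l\<^sub>1 x, l\<^sub>2 x) \<in> ?N" if x: "x \<in> carrier Q" for x
    unfolding idealizer_def
  proof (intro CollectI conjI ballI)
    show "(l\<^sub>1 x, l\<^sub>2 x) \<in> carrier ?X" using x by simp
    fix p assume "p \<in> ?J"
    then obtain a where a: "a \<in> carrier I" and p: "p = ?j a" by (rule JE)
    have "sigma E\<^sub>1.\<alpha> x ` carrier I = carrier I"
      using E\<^sub>1.sigma_auto [OF x] by (simp add: mla_auto_def Bij_def bij_betw_def)
    then obtain b where b: "b \<in> carrier I" "a = sigma E\<^sub>1.\<alpha> x b" using a by blast
    have "cj ?X (l\<^sub>1 x, l\<^sub>2 x) p = ?j (sigma E\<^sub>1.\<alpha> x a)"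
      using x a E\<^sub>2.incl_section_action(1) [of x a, folded act]
      by (simp add: p X_cj E\<^sub>1.incl_section_action)
    then show "cj ?X (l\<^sub>1 x, l\<^sub>2 x) p \<in> ?J" using x a by (simp only: j_in E\<^sub>1.section_action_closed)
    have "cj ?X (inv\<^bsub>?X\<^esub> (l\<^sub>1 x, l\<^sub>2 x)) p = ?j b"
      using x b E\<^sub>1.incl_section_action(1) [of x b] E\<^sub>2.incl_section_action(1) [of x b, folded act]
      by (simp add: p X_cj X_inv)
    then show "cj ?X (inv\<^bsub>?X\<^esub> (l\<^sub>1 x, l\<^sub>2 x)) p \<in> ?J" using b by (simp only: j_in)
    have "\<lbrace>(l\<^sub>1 x, l\<^sub>2 x), p\<rbrace>\<^bsub>?X\<^esub> = ?j (tau E\<^sub>1.\<alpha> x a)"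
      using x a E\<^sub>2.incl_section_action(2) [of x a, folded act]
      by (simp add: p E\<^sub>1.incl_section_action)
    then show "\<lbrace>(l\<^sub>1 x, l\<^sub>2 x), p\<rbrace>\<^bsub>?X\<^esub> \<in> ?J" using x a by (simp only: j_in E\<^sub>1.section_action_closed)
  qed
  have central: "inv\<^bsub>I\<^esub> a \<otimes>\<^bsub>I\<^esub> b \<in> E\<^sub>1.I.Z"
    if ab: "(incl E\<^sub>1 a, incl E\<^sub>2 b) \<in> ?N" and [simp]: "a \<in> carrier I" "b \<in> carrier I" for a b
  proof (rule E\<^sub>1.I.ZI)
    let ?s = "inv\<^bsub>I\<^esub> a \<otimes>\<^bsub>I\<^esub> b"
    have "?j (inv\<^bsub>I\<^esub> a) \<otimes>\<^bsub>?X\<^esub> (incl E\<^sub>1 a, incl E\<^sub>2 b) \<in> ?N"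
      by (intro N.m_closed jN ab) simp
    then have s: "(\<one>\<^bsub>mid E\<^sub>1\<^esub>, incl E\<^sub>2 ?s) \<in> ?N" by simp
    fix c assume [simp]: "c \<in> carrier I"
    have "cj ?X (\<one>\<^bsub>mid E\<^sub>1\<^esub>, incl E\<^sub>2 ?s) (?j c) \<in> ?J" "\<lbrace>(\<one>\<^bsub>mid E\<^sub>1\<^esub>, incl E\<^sub>2 ?s), ?j c\<rbrace>\<^bsub>?X\<^esub> \<in> ?J"
      by (rule idealizerD [OF s j_in], simp)+
    then have J: "(incl E\<^sub>1 c, incl E\<^sub>2 (cj I ?s c)) \<in> ?J" "(incl E\<^sub>1 \<one>\<^bsub>I\<^esub>, incl E\<^sub>2 \<lbrace>?s, c\<rbrace>\<^bsub>I\<^esub>) \<in> ?J"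
      by (simp_all add: X_cj)
    have diag: "d = e" if "(incl E\<^sub>1 d, incl E\<^sub>2 e) \<in> ?J" "d \<in> carrier I" "e \<in> carrier I" for d e
      using that by (elim JE) simp
    show "?s \<otimes>\<^bsub>I\<^esub> c = c \<otimes>\<^bsub>I\<^esub> ?s"
      using diag [OF J(1)] by (simp add: E\<^sub>1.I.cj_eq_self_iff [symmetric])
    show "\<lbrace>?s, c\<rbrace>\<^bsub>I\<^esub> = \<one>\<^bsub>I\<^esub>" using diag [OF J(2)] by (simp add: E\<^sub>1.I.lie_closed)
  qed simp
  have mem: "inv\<^bsub>I\<^esub> coc E\<^sub>1.R (x, y) \<otimes>\<^bsub>I\<^esub> coc E\<^sub>2.R (x, y) \<in> E\<^sub>1.I.Z"
    "inv\<^bsub>I\<^esub> coc_f E\<^sub>1.R (x, y) \<otimes>\<^bsub>I\<^esub> coc_f E\<^sub>2.R (x, y) \<in> E\<^sub>1.I.Z"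
    if x: "x \<in> carrier Q" and y: "y \<in> carrier Q" for x y
  proof -
    have "(l\<^sub>1 x, l\<^sub>2 x) \<otimes>\<^bsub>?X\<^esub> (l\<^sub>1 y, l\<^sub>2 y) \<otimes>\<^bsub>?X\<^esub> inv\<^bsub>?X\<^esub> (l\<^sub>1 (x \<otimes>\<^bsub>Q\<^esub> y), l\<^sub>2 (x \<otimes>\<^bsub>Q\<^esub> y)) \<in> ?N"
      using x y by (intro N.m_closed N.m_inv_closed lN) simp_all
    then have "(incl E\<^sub>1 (coc E\<^sub>1.R (x, y)), incl E\<^sub>2 (coc E\<^sub>2.R (x, y))) \<in> ?N"
      using x y by (simp add: X_inv E\<^sub>1.incl_section_cocycle E\<^sub>2.incl_section_cocycle)
    then show "inv\<^bsub>I\<^esub> coc E\<^sub>1.R (x, y) \<otimes>\<^bsub>I\<^esub> coc E\<^sub>2.R (x, y) \<in> E\<^sub>1.I.Z"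
      using x y by (intro central) simp_all
    have "\<lbrace>(l\<^sub>1 x, l\<^sub>2 x), (l\<^sub>1 y, l\<^sub>2 y)\<rbrace>\<^bsub>?X\<^esub> \<otimes>\<^bsub>?X\<^esub> inv\<^bsub>?X\<^esub> (l\<^sub>1 \<lbrace>x, y\<rbrace>\<^bsub>Q\<^esub>, l\<^sub>2 \<lbrace>x, y\<rbrace>\<^bsub>Q\<^esub>) \<in> ?N"
      using x y by (intro N.m_closed N.m_inv_closed N_lie lN E\<^sub>1.Q.lie_closed)
    then have "(incl E\<^sub>1 (coc_f E\<^sub>1.R (x, y)), incl E\<^sub>2 (coc_f E\<^sub>2.R (x, y))) \<in> ?N"
      using x y by (simp add: X_inv E\<^sub>1.incl_section_cocycle E\<^sub>2.incl_section_cocycle E\<^sub>1.Q.lie_closed)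
    then show "inv\<^bsub>I\<^esub> coc_f E\<^sub>1.R (x, y) \<otimes>\<^bsub>I\<^esub> coc_f E\<^sub>2.R (x, y) \<in> E\<^sub>1.I.Z"
      using x y by (intro central) simp_all
  qed
  have "coc E\<^sub>1.R (x, \<one>\<^bsub>Q\<^esub>) = \<one>\<^bsub>I\<^esub>" "coc E\<^sub>1.R (\<one>\<^bsub>Q\<^esub>, x) = \<one>\<^bsub>I\<^esub>" "coc_f E\<^sub>1.R (x, x) = \<one>\<^bsub>I\<^esub>"
    "coc_f E\<^sub>1.R (x, \<one>\<^bsub>Q\<^esub>) = \<one>\<^bsub>I\<^esub>" "coc_f E\<^sub>1.R (\<one>\<^bsub>Q\<^esub>, x) = \<one>\<^bsub>I\<^esub>"
    "coc E\<^sub>2.R (x, \<one>\<^bsub>Q\<^esub>) = \<one>\<^bsub>I\<^esub>" "coc E\<^sub>2.R (\<one>\<^bsub>Q\<^esub>, x) = \<one>\<^bsub>I\<^esub>" "coc_f E\<^sub>2.R (x, x) = \<one>\<^bsub>I\<^esub>"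
    "coc_f E\<^sub>2.R (x, \<one>\<^bsub>Q\<^esub>) = \<one>\<^bsub>I\<^esub>" "coc_f E\<^sub>2.R (\<one>\<^bsub>Q\<^esub>, x) = \<one>\<^bsub>I\<^esub>"
    if x: "x \<in> carrier Q" for x
    using x E\<^sub>1.incl_inv_incl [of "\<one>\<^bsub>I\<^esub>"] E\<^sub>2.incl_inv_incl [of "\<one>\<^bsub>I\<^esub>"]
    by (simp_all add: section_cocycle_def act_terms.defs cocycle.defs E\<^sub>1.A.lie_self E\<^sub>2.A.lie_self
        E\<^sub>1.Q.lie_self del: E\<^sub>1.incl_inv_incl E\<^sub>2.incl_inv_incl)
  note norm = this
  define S where "S =
    (\<lambda>p \<in> carrier Q \<times> carrier Q. inv\<^bsub>I\<^esub> coc E\<^sub>1.R p \<otimes>\<^bsub>I\<^esub> coc E\<^sub>2.R p,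
     \<lambda>p \<in> carrier Q \<times> carrier Q. inv\<^bsub>I\<^esub> coc_f E\<^sub>1.R p \<otimes>\<^bsub>I\<^esub> coc_f E\<^sub>2.R p)"
  have "S \<in> carrier (cochains (alg_center I) Q)"
    using mem norm by (simp add: S_def cochains_def PiE_iff Pi_iff)
  moreover have "coc E\<^sub>1.R p \<otimes>\<^bsub>I\<^esub> (inv\<^bsub>I\<^esub> coc E\<^sub>1.R p \<otimes>\<^bsub>I\<^esub> coc E\<^sub>2.R p) = coc E\<^sub>2.R p"
    "coc_f E\<^sub>1.R p \<otimes>\<^bsub>I\<^esub> (inv\<^bsub>I\<^esub> coc_f E\<^sub>1.R p \<otimes>\<^bsub>I\<^esub> coc_f E\<^sub>2.R p) = coc_f E\<^sub>2.R p"
    if "p \<in> carrier Q \<times> carrier Q" for p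
    using that by (auto simp: E\<^sub>1.I.inv_cancel_left)
  then have "coc (cocycle_shift I Q E\<^sub>1.R S) = restrict (coc E\<^sub>2.R) (carrier Q \<times> carrier Q)"
    "coc_f (cocycle_shift I Q E\<^sub>1.R S) = restrict (coc_f E\<^sub>2.R) (carrier Q \<times> carrier Q)"
    by (simp_all add: cocycle_shift_def S_def cong: restrict_cong)
  moreover have "restrict (coc E\<^sub>2.R) (carrier Q \<times> carrier Q) = coc E\<^sub>2.R"
    "restrict (coc_f E\<^sub>2.R) (carrier Q \<times> carrier Q) = coc_f E\<^sub>2.R"
    by (simp_all add: section_cocycle_def act_terms.defs cocycle.defs)
  ultimately have "E\<^sub>2.R = cocycle_shift I Q E\<^sub>1.R S"
    by (intro cocycle.equality) (simp_all add: act)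
  then show ?thesis by (rule that [OF \<open>S \<in> carrier (cochains (alg_center I) Q)\<close>])
qed

section \<open>Automorphism groups\<close>

lemma mla_autoD:
  assumes "f \<in> mla_auto G"
  shows "f \<in> Bij (carrier G)" "f \<in> extensional (carrier G)" "bij_betw f (carrier G) (carrier G)"
    "x \<in> carrier G \<Longrightarrow> f x \<in> carrier G"
    "x \<in> carrier G \<Longrightarrow> y \<in> carrier G \<Longrightarrow> f (x \<otimes>\<^bsub>G\<^esub> y) = f x \<otimes>\<^bsub>G\<^esub> f y"
    "x \<in> carrier G \<Longrightarrow> y \<in> carrier G \<Longrightarrow> f \<lbrace>x, y\<rbrace>\<^bsub>G\<^esub> = \<lbrace>f x, f y\<rbrace>\<^bsub>G\<^esub>"
    "x \<in> carrier G \<Longrightarrow> inv_into (carrier G) f x \<in> carrier G"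
    "x \<in> carrier G \<Longrightarrow> f (inv_into (carrier G) f x) = x"
    "x \<in> carrier G \<Longrightarrow> inv_into (carrier G) f (f x) = x"
    "x \<in> carrier G \<Longrightarrow> y \<in> carrier G \<Longrightarrow> f x = f y \<longleftrightarrow> x = y"
proof -
  show bij: "f \<in> Bij (carrier G)" and ext: "f \<in> extensional (carrier G)"
    and bb: "bij_betw f (carrier G) (carrier G)"
    using assms by (auto simp: mla_auto_def Bij_def)
  show "x \<in> carrier G \<Longrightarrow> f x \<in> carrier G" using bb bij_betwE by blast
  show "x \<in> carrier G \<Longrightarrow> y \<in> carrier G \<Longrightarrow> f (x \<otimes>\<^bsub>G\<^esub> y) = f x \<otimes>\<^bsub>G\<^esub> f y"
    "x \<in> carrier G \<Longrightarrow> y \<in> carrier G \<Longrightarrow> f \<lbrace>x, y\<rbrace>\<^bsub>G\<^esub> = \<lbrace>f x, f y\<rbrace>\<^bsub>G\<^esub>"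
    using assms by (auto simp: mla_auto_def mla_hom_def hom_def)
  show "x \<in> carrier G \<Longrightarrow> inv_into (carrier G) f x \<in> carrier G" by (rule Bij_inv_into_mem [OF bij])
  show "x \<in> carrier G \<Longrightarrow> f (inv_into (carrier G) f x) = x" by (rule bij_betw_inv_into_right [OF bb])
  show "x \<in> carrier G \<Longrightarrow> inv_into (carrier G) f (f x) = x" by (rule bij_betw_inv_into_left [OF bb])
  show "x \<in> carrier G \<Longrightarrow> y \<in> carrier G \<Longrightarrow> f x = f y \<longleftrightarrow> x = y"
    using bb inj_on_eq_iff [of f "carrier G" x y] by (simp add: bij_betw_def)
qed

lemma mla_autoI:
  assumes "f \<in> extensional (carrier G)" "bij_betw f (carrier G) (carrier G)"
    "\<And>x y. x \<in> carrier G \<Longrightarrow> y \<in> carrier G \<Longrightarrow>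
      f (x \<otimes>\<^bsub>G\<^esub> y) = f x \<otimes>\<^bsub>G\<^esub> f y \<and> f \<lbrace>x, y\<rbrace>\<^bsub>G\<^esub> = \<lbrace>f x, f y\<rbrace>\<^bsub>G\<^esub>"
  shows "f \<in> mla_auto G"
  using assms bij_betwE [OF assms(2)] by (simp add: mla_auto_def Bij_def mla_hom_def hom_def Pi_iff)

lemma mla_AutoGroup_simps:
  "carrier (mla_AutoGroup G) = mla_auto G"
  "f \<in> mla_auto G \<Longrightarrow> g \<in> mla_auto G \<Longrightarrow> f \<otimes>\<^bsub>mla_AutoGroup G\<^esub> g = compose (carrier G) f g"
  "\<one>\<^bsub>mla_AutoGroup G\<^esub> = (\<lambda>x \<in> carrier G. x)"
  by (simp_all add: mla_AutoGroup_def BijGroup_def mla_autoD(1))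

context mult_lie_algebra
begin

lemma subgroup_mla_auto: "subgroup (mla_auto A) (BijGroup (carrier A))"
proof (rule subgroup.intro)
  show "mla_auto A \<subseteq> carrier (BijGroup (carrier A))" by (auto simp: BijGroup_def mla_autoD(1))
  show "\<one>\<^bsub>BijGroup (carrier A)\<^esub> \<in> mla_auto A"
    by (simp add: BijGroup_def) (rule mla_autoI, auto simp: lie_closed bij_betw_def)
next
  fix f g assume f: "f \<in> mla_auto A" and g: "g \<in> mla_auto A"
  note [simp] = mla_autoD(1,4-6) [OF f] mla_autoD(1,4-6) [OF g]
  have "compose (carrier A) f g \<in> mla_auto A"
    by (rule mla_autoI [OF compose_extensional
          bij_betw_compose [OF mla_autoD(3) [OF g] mla_autoD(3) [OF f]]])
      (simp add: compose_def lie_closed)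
  then show "f \<otimes>\<^bsub>BijGroup (carrier A)\<^esub> g \<in> mla_auto A" by (simp add: BijGroup_def)
next
  fix f assume f: "f \<in> mla_auto A"
  note D = mla_autoD [OF f]
  have "restrict (inv_into (carrier A) f) (carrier A) \<in> mla_auto A"
  proof (rule mla_autoI)
    show "bij_betw (restrict (inv_into (carrier A) f) (carrier A)) (carrier A) (carrier A)"
      using bij_betw_inv_into [OF D(3)] by simp
    fix x y assume [simp]: "x \<in> carrier A" "y \<in> carrier A"
    show "restrict (inv_into (carrier A) f) (carrier A) (x \<otimes> y) =
        restrict (inv_into (carrier A) f) (carrier A) x \<otimes> restrict (inv_into (carrier A) f) (carrier A) y \<and>
      restrict (inv_into (carrier A) f) (carrier A) \<lbrace>x, y\<rbrace> =
        \<lbrace>restrict (inv_into (carrier A) f) (carrier A) x, restrict (inv_into (carrier A) f) (carrier A) y\<rbrace>"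
      by (simp add: lie_closed D(7) D(8) D(5,6) flip: D(10))
  qed simp
  then show "inv\<^bsub>BijGroup (carrier A)\<^esub> f \<in> mla_auto A" by (simp only: inv_BijGroup [OF D(1)])
qed

lemma group_mla_AutoGroup: "group (mla_AutoGroup A)"
  unfolding mla_AutoGroup_def
  by (rule subgroup.subgroup_is_group [OF subgroup_mla_auto group_BijGroup])

lemma lie_inv_right:
  assumes [simp]: "x \<in> carrier A" "y \<in> carrier A"
  shows "\<lbrace>y, inv x\<rbrace> = inv (cj A (inv x) \<lbrace>y, x\<rbrace>)"
  using lie_antisym [of "inv x" y] lie_antisym [of x y]
  by (simp add: lie_inv_left lie_closed cj_inv)

end

section \<open>Equivalence of action terms and compatible automorphisms\<close>

text \<open>
  The part of \<^const>\<open>action_terms\<close> that matters for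
  \<^const>\<open>act_equiv\<close>; unlike \<open>action_terms\<close>, it is immediate for
  twisted action terms.
\<close>

definition action_maps :: "'i mla \<Rightarrow> 'q mla \<Rightarrow> ('i, 'q) act_terms \<Rightarrow> bool" where
  "action_maps I Q \<chi> \<longleftrightarrow> (\<forall>x \<in> carrier Q. \<forall>a \<in> carrier I.
     sigma \<chi> x a \<in> carrier I \<and> tau \<chi> x a \<in> carrier I \<and> nu \<chi> x a \<in> carrier I)"

lemma action_maps_terms: "action_terms I Q \<chi> \<Longrightarrow> action_maps I Q \<chi>"
  unfolding action_terms_def action_maps_def by (auto dest: PiE_mem mla_autoD(4))

lemma act_equiv_refl:
  assumes "mult_lie_algebra I" "action_maps I Q \<chi>"
  shows "act_equiv I Q \<chi> \<chi>"
proof -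
  interpret I: mult_lie_algebra I by fact
  show ?thesis
    unfolding act_equiv_def
    by (rule bexI [of _ "\<lambda>x. \<one>\<^bsub>I\<^esub>"]) (use assms(2) in \<open>simp_all add: action_maps_def\<close>)
qed

lemma act_equiv_sym:
  assumes "mult_lie_algebra I" "action_maps I Q \<chi>'" "act_equiv I Q \<chi> \<chi>'"
  shows "act_equiv I Q \<chi>' \<chi>"
proof -
  interpret I: mult_lie_algebra I by fact
  obtain h where h: "h \<in> carrier Q \<rightarrow> carrier I"
    and eq: "\<forall>x \<in> carrier Q. \<forall>a \<in> carrier I. sigma \<chi> x a = cj I (h x) (sigma \<chi>' x a) \<and>
        tau \<chi> x a = cj I (h x) (tau \<chi>' x a) \<otimes>\<^bsub>I\<^esub> \<lbrace>h x, a\<rbrace>\<^bsub>I\<^esub> \<and>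
        nu \<chi> x a = \<lbrace>a, h x\<rbrace>\<^bsub>I\<^esub> \<otimes>\<^bsub>I\<^esub> cj I (h x) (nu \<chi>' x a)"
    using assms(3) unfolding act_equiv_def by (elim bexE)
  show ?thesis
    unfolding act_equiv_def
  proof (intro bexI [of _ "\<lambda>x. inv\<^bsub>I\<^esub> h x"] ballI)
    fix x a assume x: "x \<in> carrier Q" and [simp]: "a \<in> carrier I"
    have [simp]: "h x \<in> carrier I" "sigma \<chi>' x a \<in> carrier I" "tau \<chi>' x a \<in> carrier I"
      "nu \<chi>' x a \<in> carrier I"
      using x h assms(2) by (auto simp: action_maps_def)
    show "sigma \<chi>' x a = cj I (inv\<^bsub>I\<^esub> h x) (sigma \<chi> x a) \<and>
      tau \<chi>' x a = cj I (inv\<^bsub>I\<^esub> h x) (tau \<chi> x a) \<otimes>\<^bsub>I\<^esub> \<lbrace>inv\<^bsub>I\<^esub> h x, a\<rbrace>\<^bsub>I\<^esub> \<and>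
      nu \<chi>' x a = \<lbrace>a, inv\<^bsub>I\<^esub> h x\<rbrace>\<^bsub>I\<^esub> \<otimes>\<^bsub>I\<^esub> cj I (inv\<^bsub>I\<^esub> h x) (nu \<chi> x a)"
      using eq x by (simp add: I.cj_mult I.lie_inv_left I.lie_inv_right I.lie_closed I.m_assoc
          I.inv_cancel_left)
  qed (use h in auto)
qed

lemma act_equiv_trans:
  assumes "mult_lie_algebra I" "action_maps I Q \<chi>''" "act_equiv I Q \<chi> \<chi>'" "act_equiv I Q \<chi>' \<chi>''"
  shows "act_equiv I Q \<chi> \<chi>''"
proof -
  interpret I: mult_lie_algebra I by fact
  obtain h where h: "h \<in> carrier Q \<rightarrow> carrier I"
    and eq: "\<forall>x \<in> carrier Q. \<forall>a \<in> carrier I. sigma \<chi> x a = cj I (h x) (sigma \<chi>' x a) \<and>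
        tau \<chi> x a = cj I (h x) (tau \<chi>' x a) \<otimes>\<^bsub>I\<^esub> \<lbrace>h x, a\<rbrace>\<^bsub>I\<^esub> \<and>
        nu \<chi> x a = \<lbrace>a, h x\<rbrace>\<^bsub>I\<^esub> \<otimes>\<^bsub>I\<^esub> cj I (h x) (nu \<chi>' x a)"
    using assms(3) unfolding act_equiv_def by (elim bexE)
  obtain k where k: "k \<in> carrier Q \<rightarrow> carrier I"
    and eq': "\<forall>x \<in> carrier Q. \<forall>a \<in> carrier I. sigma \<chi>' x a = cj I (k x) (sigma \<chi>'' x a) \<and>
        tau \<chi>' x a = cj I (k x) (tau \<chi>'' x a) \<otimes>\<^bsub>I\<^esub> \<lbrace>k x, a\<rbrace>\<^bsub>I\<^esub> \<and>
        nu \<chi>' x a = \<lbrace>a, k x\<rbrace>\<^bsub>I\<^esub> \<otimes>\<^bsub>I\<^esub> cj I (k x) (nu \<chi>'' x a)"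
    using assms(4) unfolding act_equiv_def by (elim bexE)
  show ?thesis
    unfolding act_equiv_def
  proof (intro bexI [of _ "\<lambda>x. h x \<otimes>\<^bsub>I\<^esub> k x"] ballI)
    fix x a assume x: "x \<in> carrier Q" and [simp]: "a \<in> carrier I"
    have [simp]: "h x \<in> carrier I" "k x \<in> carrier I" "sigma \<chi>'' x a \<in> carrier I"
      "tau \<chi>'' x a \<in> carrier I" "nu \<chi>'' x a \<in> carrier I"
      using x h k assms(2) by (auto simp: action_maps_def)
    show "sigma \<chi> x a = cj I (h x \<otimes>\<^bsub>I\<^esub> k x) (sigma \<chi>'' x a) \<and>
      tau \<chi> x a = cj I (h x \<otimes>\<^bsub>I\<^esub> k x) (tau \<chi>'' x a) \<otimes>\<^bsub>I\<^esub> \<lbrace>h x \<otimes>\<^bsub>I\<^esub> k x, a\<rbrace>\<^bsub>I\<^esub> \<and>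
      nu \<chi> x a = \<lbrace>a, h x \<otimes>\<^bsub>I\<^esub> k x\<rbrace>\<^bsub>I\<^esub> \<otimes>\<^bsub>I\<^esub> cj I (h x \<otimes>\<^bsub>I\<^esub> k x) (nu \<chi>'' x a)"
      using eq eq' x by (simp add: I.cj_mult I.cj_cj I.lie_mult_left I.lie_mult_right I.lie_closed I.m_assoc)
  qed (use h k in auto)
qed

lemma act_class_eq_iff:
  assumes I: "mult_lie_algebra I" and \<chi>: "action_terms I Q \<chi>" and \<chi>': "action_terms I Q \<chi>'"
  shows "act_class I Q \<chi> = act_class I Q \<chi>' \<longleftrightarrow> act_equiv I Q \<chi> \<chi>'"
proof
  assume "act_class I Q \<chi> = act_class I Q \<chi>'"
  moreover have "\<chi>' \<in> act_class I Q \<chi>'"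
    using \<chi>' act_equiv_refl [OF I action_maps_terms [OF \<chi>']] by (simp add: act_class_def)
  ultimately have "\<chi>' \<in> act_class I Q \<chi>" by simp
  then show "act_equiv I Q \<chi> \<chi>'" by (simp add: act_class_def)
next
  assume e: "act_equiv I Q \<chi> \<chi>'"
  note e' = act_equiv_sym [OF I action_maps_terms [OF \<chi>'] e]
  have "act_equiv I Q \<chi> \<chi>'' \<longleftrightarrow> act_equiv I Q \<chi>' \<chi>''" if "action_terms I Q \<chi>''" for \<chi>''
    using act_equiv_trans [OF I action_maps_terms [OF that] e']
      act_equiv_trans [OF I action_maps_terms [OF that] e] by (rule iffI)
  then show "act_class I Q \<chi> = act_class I Q \<chi>'"
    unfolding act_class_def by (intro Collect_cong conj_cong refl)
qed

lemma act_twist_simps [simp]: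
  "sigma (act_twist I Q (\<omega>, \<kappa>) \<chi>) = twist I Q \<omega> \<kappa> (sigma \<chi>)"
  "tau (act_twist I Q (\<omega>, \<kappa>) \<chi>) = twist I Q \<omega> \<kappa> (tau \<chi>)"
  "nu (act_twist I Q (\<omega>, \<kappa>) \<chi>) = twist I Q \<omega> \<kappa> (nu \<chi>)"
  by (simp_all add: act_twist_def)

lemma twist_twist:
  assumes "\<omega> \<in> mla_auto I" "\<omega>' \<in> mla_auto I" "\<kappa> \<in> mla_auto Q" "\<kappa>' \<in> mla_auto Q"
    and f: "\<And>x a. x \<in> carrier Q \<Longrightarrow> a \<in> carrier I \<Longrightarrow> f x a \<in> carrier I"
  shows "twist I Q \<omega> \<kappa> (twist I Q \<omega>' \<kappa>' f) =
    twist I Q (compose (carrier I) \<omega> \<omega>') (compose (carrier Q) \<kappa> \<kappa>') f"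
proof -
  note D = mla_autoD [OF assms(1)] mla_autoD [OF assms(2)] mla_autoD [OF assms(3)]
    mla_autoD [OF assms(4)]
  have inj: "inj_on (compose (carrier I) \<omega> \<omega>') (carrier I)"
    "inj_on (compose (carrier Q) \<kappa> \<kappa>') (carrier Q)"
    by (auto intro!: inj_onI simp: compose_def D)
  have "inv_into (carrier I) (compose (carrier I) \<omega> \<omega>') a =
      inv_into (carrier I) \<omega>' (inv_into (carrier I) \<omega> a)" if "a \<in> carrier I" for a
    by (rule inv_into_f_eq [OF inj(1)]) (use that in \<open>simp_all add: compose_def D\<close>)
  moreover have "inv_into (carrier Q) (compose (carrier Q) \<kappa> \<kappa>') x =
      inv_into (carrier Q) \<kappa>' (inv_into (carrier Q) \<kappa> x)" if "x \<in> carrier Q" for x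
    by (rule inv_into_f_eq [OF inj(2)]) (use that in \<open>simp_all add: compose_def D\<close>)
  ultimately show ?thesis
    by (simp add: twist_def D f compose_def cong: restrict_cong)
qed

lemma act_twist_twist:
  assumes "p \<in> mla_auto I \<times> mla_auto Q" "q \<in> mla_auto I \<times> mla_auto Q" "action_maps I Q \<chi>"
  shows "act_twist I Q p (act_twist I Q q \<chi>) =
    act_twist I Q (p \<otimes>\<^bsub>mla_AutoGroup I \<times>\<times> mla_AutoGroup Q\<^esub> q) \<chi>"
  using assms by (auto simp: act_twist_def twist_twist mla_AutoGroup_simps action_maps_def)

lemma act_twist_one:
  assumes "action_terms I Q \<chi>"
  shows "act_twist I Q \<one>\<^bsub>mla_AutoGroup I \<times>\<times> mla_AutoGroup Q\<^esub> \<chi> = \<chi>"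
proof -
  have id: "inv_into S (\<lambda>x \<in> S. x) y = y" if "y \<in> S" for S and y :: 'c
    by (rule inv_into_f_eq) (use that in \<open>auto intro: inj_onI\<close>)
  have "twist I Q (\<lambda>a \<in> carrier I. a) (\<lambda>x \<in> carrier Q. x) f = f"
    if f: "f \<in> carrier Q \<rightarrow>\<^sub>E (carrier I \<rightarrow>\<^sub>E carrier I)" for f
  proof -
    have fx: "f x a \<in> carrier I" if "x \<in> carrier Q" "a \<in> carrier I" for x a
      using that f by (auto simp: PiE_iff)
    have "twist I Q (\<lambda>a \<in> carrier I. a) (\<lambda>x \<in> carrier Q. x) f =
        (\<lambda>x \<in> carrier Q. \<lambda>a \<in> carrier I. f x a)"
      by (simp add: twist_def id fx cong: restrict_cong)
    also have "\<dots> = (\<lambda>x \<in> carrier Q. f x)"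
      using f by (intro restrict_ext) (auto simp: PiE_iff intro: extensional_restrict)
    also have "\<dots> = f" using f by (intro extensional_restrict) (simp add: PiE_iff)
    finally show ?thesis .
  qed
  moreover have "sigma \<chi> \<in> carrier Q \<rightarrow>\<^sub>E (carrier I \<rightarrow>\<^sub>E carrier I)"
    using assms unfolding action_terms_def PiE_iff by (auto dest: mla_autoD(2,4))
  ultimately show ?thesis
    using assms by (intro act_terms.equality) (simp_all add: action_terms_def mla_AutoGroup_simps)
qed

text \<open>
  If \<open>h\<close> witnesses the equivalence, then $x \mapsto \omega(h(\kappa^{-1}(x)))$
  witnesses that of the twisted action terms.
\<close>

lemma act_equiv_twist:
  assumes "mult_lie_algebra I" and \<chi>': "action_maps I Q \<chi>'" and e: "act_equiv I Q \<chi> \<chi>'"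
    and p: "p \<in> mla_auto I \<times> mla_auto Q"
  shows "act_equiv I Q (act_twist I Q p \<chi>) (act_twist I Q p \<chi>')"
proof -
  interpret I: mult_lie_algebra I by fact
  obtain \<omega> \<kappa> where p_eq: "p = (\<omega>, \<kappa>)" and \<omega>: "\<omega> \<in> mla_auto I" and \<kappa>: "\<kappa> \<in> mla_auto Q"
    using p by auto
  note D = mla_autoD(4-9) [OF \<omega>] and D' = mla_autoD(4-9) [OF \<kappa>]
  interpret \<omega>: group_hom I I \<omega>
    by unfold_locales (use D(1,2) in \<open>simp add: hom_def\<close>)
  obtain h where h: "h \<in> carrier Q \<rightarrow> carrier I"
    and eq: "\<forall>x \<in> carrier Q. \<forall>a \<in> carrier I. sigma \<chi> x a = cj I (h x) (sigma \<chi>' x a) \<and>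
        tau \<chi> x a = cj I (h x) (tau \<chi>' x a) \<otimes>\<^bsub>I\<^esub> \<lbrace>h x, a\<rbrace>\<^bsub>I\<^esub> \<and>
        nu \<chi> x a = \<lbrace>a, h x\<rbrace>\<^bsub>I\<^esub> \<otimes>\<^bsub>I\<^esub> cj I (h x) (nu \<chi>' x a)"
    using e unfolding act_equiv_def by (elim bexE)
  let ?k = "inv_into (carrier Q) \<kappa>" and ?w = "inv_into (carrier I) \<omega>"
  have h' [simp]: "h x \<in> carrier I" if "x \<in> carrier Q" for x using h that by auto
  have [simp]: "sigma \<chi>' x a \<in> carrier I" "tau \<chi>' x a \<in> carrier I" "nu \<chi>' x a \<in> carrier I"
    if "x \<in> carrier Q" "a \<in> carrier I" for x a
    using that \<chi>' by (auto simp: action_maps_def)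
  show ?thesis
    unfolding act_equiv_def p_eq
  proof (intro bexI [of _ "\<lambda>x. \<omega> (h (?k x))"] ballI)
    fix x a assume [simp]: "x \<in> carrier Q" "a \<in> carrier I"
    have [simp]: "?k x \<in> carrier Q" "?w a \<in> carrier I" by (simp_all add: D D')
    show "sigma (act_twist I Q (\<omega>, \<kappa>) \<chi>) x a =
        cj I (\<omega> (h (?k x))) (sigma (act_twist I Q (\<omega>, \<kappa>) \<chi>') x a) \<and>
      tau (act_twist I Q (\<omega>, \<kappa>) \<chi>) x a =
        cj I (\<omega> (h (?k x))) (tau (act_twist I Q (\<omega>, \<kappa>) \<chi>') x a) \<otimes>\<^bsub>I\<^esub> \<lbrace>\<omega> (h (?k x)), a\<rbrace>\<^bsub>I\<^esub> \<and>
      nu (act_twist I Q (\<omega>, \<kappa>) \<chi>) x a =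
        \<lbrace>a, \<omega> (h (?k x))\<rbrace>\<^bsub>I\<^esub> \<otimes>\<^bsub>I\<^esub> cj I (\<omega> (h (?k x))) (nu (act_twist I Q (\<omega>, \<kappa>) \<chi>') x a)"
      using eq by (simp add: twist_def cj_def D(3,5) I.lie_closed)
  qed (use D(1) D'(4) h' in auto)
qed

lemma action_terms_twist:
  assumes "mult_lie_algebra I" and \<chi>: "action_terms I Q \<chi>" and p: "p \<in> mla_auto I \<times> mla_auto Q"
  shows "action_maps I Q (act_twist I Q p \<chi>)"
  using action_maps_terms [OF \<chi>] p
  by (auto simp: action_maps_def twist_def mla_autoD)

section \<open>Automorphisms preserving the kernel\<close>

text \<open>
  The extension whose cocycles are the $T^{(\omega,\kappa)}$. Its middle term is unchanged, so
  that isomorphisms onto \<open>E\<close> are automorphisms of the middle term.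
\<close>

definition relabel_ext ::
    "'i mla \<Rightarrow> ('i \<Rightarrow> 'i) \<times> ('q \<Rightarrow> 'q) \<Rightarrow> ('i, 'a, 'q) mla_ext \<Rightarrow> ('i, 'a, 'q) mla_ext" where
  "relabel_ext I p E = E\<lparr>incl := \<lambda>a. incl E (inv_into (carrier I) (fst p) a),
                      proj := \<lambda>u. snd p (proj E u)\<rparr>"

lemma relabel_ext_simps [simp]:
  "mid (relabel_ext I p E) = mid E"
  "incl (relabel_ext I p E) a = incl E (inv_into (carrier I) (fst p) a)"
  "proj (relabel_ext I p E) u = snd p (proj E u)"
  by (simp_all add: relabel_ext_def)

context mla_extension
begin

lemma Aut_I_simps:
  "carrier (Aut_I I E) = {\<phi> \<in> mla_auto A. \<phi> ` \<iota> ` carrier I = \<iota> ` carrier I}"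
  "\<phi> \<in> mla_auto A \<Longrightarrow> \<phi>' \<in> mla_auto A \<Longrightarrow> \<phi> \<otimes>\<^bsub>Aut_I I E\<^esub> \<phi>' = compose (carrier A) \<phi> \<phi>'"
  "\<one>\<^bsub>Aut_I I E\<^esub> = (\<lambda>u \<in> carrier A. u)"
  by (simp_all add: Aut_I_def mla_AutoGroup_simps)

lemma group_Aut_I: "group (Aut_I I E)"
proof -
  interpret G: group "mla_AutoGroup A" by (rule A.group_mla_AutoGroup)
  let ?J = "\<iota> ` carrier I"
  have J: "u \<in> carrier A" if "u \<in> ?J" for u using that by auto
  have "subgroup {\<phi> \<in> mla_auto A. \<phi> ` ?J = ?J} (mla_AutoGroup A)"
  proof (rule G.subgroupI)
    show "{\<phi> \<in> mla_auto A. \<phi> ` ?J = ?J} \<subseteq> carrier (mla_AutoGroup A)"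
      by (auto simp: mla_AutoGroup_simps)
    have "\<one>\<^bsub>mla_AutoGroup A\<^esub> \<in> mla_auto A" using G.one_closed by (simp add: mla_AutoGroup_simps(1))
    moreover have "(\<lambda>u \<in> carrier A. u) ` ?J = (\<lambda>u. u) ` ?J" by (rule image_cong) auto
    ultimately have "\<one>\<^bsub>mla_AutoGroup A\<^esub> \<in> {\<phi> \<in> mla_auto A. \<phi> ` ?J = ?J}"
      by (simp add: mla_AutoGroup_simps(3))
    then show "{\<phi> \<in> mla_auto A. \<phi> ` ?J = ?J} \<noteq> {}" by (rule ex_in_conv [THEN iffD1, OF exI])
  next
    fix \<phi> assume \<phi>: "\<phi> \<in> {\<phi> \<in> mla_auto A. \<phi> ` ?J = ?J}"
    then have m: "\<phi> \<in> mla_auto A" and im: "\<phi> ` ?J = ?J" by auto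
    have inv: "inv\<^bsub>mla_AutoGroup A\<^esub> \<phi> \<in> mla_auto A"
      using G.inv_closed [of \<phi>] m by (simp add: mla_AutoGroup_simps(1))
    have "compose (carrier A) (inv\<^bsub>mla_AutoGroup A\<^esub> \<phi>) \<phi> = (\<lambda>u \<in> carrier A. u)"
      using G.l_inv [of \<phi>] m inv by (simp add: mla_AutoGroup_simps)
    note comp = this
    have id: "(inv\<^bsub>mla_AutoGroup A\<^esub> \<phi>) (\<phi> u) = u" if "u \<in> carrier A" for u
      using that fun_cong [OF comp, of u] by (simp add: compose_def)
    have "(inv\<^bsub>mla_AutoGroup A\<^esub> \<phi>) ` \<phi> ` ?J = (\<lambda>u. u) ` ?J"
      unfolding image_image by (rule image_cong) (simp_all add: id)
    then have "(inv\<^bsub>mla_AutoGroup A\<^esub> \<phi>) ` ?J = ?J" by (simp add: im)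
    then show "inv\<^bsub>mla_AutoGroup A\<^esub> \<phi> \<in> {\<phi> \<in> mla_auto A. \<phi> ` ?J = ?J}" using inv by simp
    fix \<phi>' assume "\<phi>' \<in> {\<phi> \<in> mla_auto A. \<phi> ` ?J = ?J}"
    then have m': "\<phi>' \<in> mla_auto A" and im': "\<phi>' ` ?J = ?J" by auto
    have "compose (carrier A) \<phi> \<phi>' ` ?J = \<phi> ` \<phi>' ` ?J"
      unfolding image_image [of \<phi> \<phi>'] by (rule image_cong) (auto simp: compose_def)
    then have "compose (carrier A) \<phi> \<phi>' ` ?J = ?J" by (simp add: im im')
    moreover have "compose (carrier A) \<phi> \<phi>' \<in> mla_auto A"
      using G.m_closed [of \<phi> \<phi>'] m m' by (simp add: mla_AutoGroup_simps)
    ultimately show "\<phi> \<otimes>\<^bsub>mla_AutoGroup A\<^esub> \<phi>' \<in> {\<phi> \<in> mla_auto A. \<phi> ` ?J = ?J}"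
      using m m' by (simp add: mla_AutoGroup_simps)
  qed
  then show ?thesis
    unfolding Aut_I_def by (rule subgroup.subgroup_is_group) (rule G.is_group)
qed

text \<open>
  The equations for \<open>\<iota>\<close> and \<open>\<pi>\<close>, read with the induced
  automorphisms of \<open>I\<close> and \<open>Q\<close> absorbed into the inclusion and the
  projection, say that \<open>\<phi>\<close> is an isomorphism from the relabelled extension.
\<close>

lemma psi_spec:
  assumes t: "is_section Q E t" and \<phi>: "\<phi> \<in> carrier (Aut_I I E)"
  shows "psi I Q E t \<phi> \<in> mla_auto I \<times> mla_auto Q"
    and "a \<in> carrier I \<Longrightarrow> \<phi> (\<iota> a) = \<iota> (fst (psi I Q E t \<phi>) a)"
    and "u \<in> carrier A \<Longrightarrow> \<pi> (\<phi> u) = snd (psi I Q E t \<phi>) (\<pi> u)"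
    and "ext_iso I (relabel_ext I (psi I Q E t \<phi>) E) E \<phi>"
proof -
  interpret S: ext_section I Q E t by unfold_locales (rule t)
  have m: "\<phi> \<in> mla_auto A" and im: "\<phi> ` \<iota> ` carrier I = \<iota> ` carrier I"
    using \<phi> by (simp_all add: Aut_I_simps)
  note D = mla_autoD [OF m]
  interpret \<phi>: group_hom A A \<phi> by unfold_locales (use D(4,5) in \<open>simp add: hom_def\<close>)
  define \<omega> where "\<omega> = fst (psi I Q E t \<phi>)"
  define \<kappa> where "\<kappa> = snd (psi I Q E t \<phi>)"
  have psi: "psi I Q E t \<phi> = (\<omega>, \<kappa>)" by (simp add: \<omega>_def \<kappa>_def)
  have \<omega>: "\<omega> a \<in> carrier I" "\<iota> (\<omega> a) = \<phi> (\<iota> a)" if "a \<in> carrier I" for a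
  proof -
    have "\<phi> (\<iota> a) \<in> \<iota> ` carrier I" using that im by blast
    then obtain b where "b \<in> carrier I" "\<phi> (\<iota> a) = \<iota> b" by (rule imageE)
    then show "\<omega> a \<in> carrier I" "\<iota> (\<omega> a) = \<phi> (\<iota> a)" using that by (simp_all add: \<omega>_def psi_def)
  qed
  have \<kappa>: "\<kappa> (\<pi> u) = \<pi> (\<phi> u)" if u: "u \<in> carrier A" for u
  proof -
    obtain a where a: "a \<in> carrier I" and u': "u = \<iota> a \<otimes>\<^bsub>A\<^esub> t (\<pi> u)" using S.decompose [OF u] .
    have "\<pi> (\<phi> u) = \<pi> (\<phi> (\<iota> a) \<otimes>\<^bsub>A\<^esub> \<phi> (t (\<pi> u)))"
      by (subst u') (use a u in simp)
    also have "\<dots> = \<kappa> (\<pi> u)" using a u by (simp add: \<kappa>_def psi_def \<omega>(1) flip: \<omega>(2))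
    finally show ?thesis ..
  qed
  have \<omega>_auto: "\<omega> \<in> mla_auto I"
  proof (rule mla_autoI)
    show "\<omega> \<in> extensional (carrier I)" by (simp add: \<omega>_def psi_def)
    have "inj_on \<omega> (carrier I)"
    proof (rule inj_onI)
      fix a b assume ab: "a \<in> carrier I" "b \<in> carrier I" "\<omega> a = \<omega> b"
      then have "\<phi> (\<iota> a) = \<phi> (\<iota> b)" by (simp flip: \<omega>(2))
      then show "a = b" using ab by (simp add: D(10))
    qed
    moreover have "\<omega> ` carrier I = carrier I"
    proof (intro equalityI subsetI)
      fix b assume b: "b \<in> carrier I"
      then have "\<iota> b \<in> \<phi> ` \<iota> ` carrier I" using im by simp
      then obtain a where a: "a \<in> carrier I" "\<iota> b = \<phi> (\<iota> a)" by (elim imageE) simp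
      then have "b = \<omega> a" using b \<omega> by (metis incl_eq_iff)
      then show "b \<in> \<omega> ` carrier I" using a(1) by (rule image_eqI)
    qed (use \<omega>(1) in auto)
    ultimately show "bij_betw \<omega> (carrier I) (carrier I)" by (simp add: bij_betw_def)
    fix a b assume ab: "a \<in> carrier I" "b \<in> carrier I"
    have "\<iota> (\<omega> (a \<otimes>\<^bsub>I\<^esub> b)) = \<iota> (\<omega> a \<otimes>\<^bsub>I\<^esub> \<omega> b)" "\<iota> (\<omega> \<lbrace>a, b\<rbrace>\<^bsub>I\<^esub>) = \<iota> \<lbrace>\<omega> a, \<omega> b\<rbrace>\<^bsub>I\<^esub>"
      using ab by (simp_all add: \<omega> I.lie_closed D(6))
    then show "\<omega> (a \<otimes>\<^bsub>I\<^esub> b) = \<omega> a \<otimes>\<^bsub>I\<^esub> \<omega> b \<and> \<omega> \<lbrace>a, b\<rbrace>\<^bsub>I\<^esub> = \<lbrace>\<omega> a, \<omega> b\<rbrace>\<^bsub>I\<^esub>"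
      using ab by (simp_all only: incl_eq_iff \<omega>(1) I.m_closed I.lie_closed)
  qed
  have \<kappa>_auto: "\<kappa> \<in> mla_auto Q"
  proof (rule mla_autoI)
    show "\<kappa> \<in> extensional (carrier Q)" by (simp add: \<kappa>_def psi_def)
    have "inj_on \<kappa> (carrier Q)"
    proof (rule inj_onI)
      fix x y assume x: "x \<in> carrier Q" and y: "y \<in> carrier Q" and e: "\<kappa> x = \<kappa> y"
      obtain u where u [simp]: "u \<in> carrier A" "\<pi> u = x" by (rule proj_surjE [OF x])
      obtain v where v [simp]: "v \<in> carrier A" "\<pi> v = y" by (rule proj_surjE [OF y])
      have "\<pi> (\<phi> u) = \<pi> (\<phi> v)" using e \<kappa> [of u] \<kappa> [of v] by simp
      then obtain b where b: "b \<in> carrier I" "\<phi> u = \<iota> b \<otimes>\<^bsub>A\<^esub> \<phi> v"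
        by (rule proj_eqE [rotated 2]) simp_all
      have "\<iota> b \<in> \<phi> ` \<iota> ` carrier I" using b(1) im by simp
      then obtain a where a: "a \<in> carrier I" "\<iota> b = \<phi> (\<iota> a)" by (elim imageE) simp
      have "\<phi> u = \<phi> (\<iota> a \<otimes>\<^bsub>A\<^esub> v)" using a b by simp
      then have "u = \<iota> a \<otimes>\<^bsub>A\<^esub> v" using a(1) D(10) [of u "\<iota> a \<otimes>\<^bsub>A\<^esub> v"] by simp
      then have "\<pi> u = \<pi> v" using a(1) y by simp
      then show "x = y" by simp
    qed
    moreover have "\<kappa> ` carrier Q = carrier Q"
    proof (intro equalityI subsetI)
      fix y assume y: "y \<in> carrier Q"
      obtain v where v: "v \<in> carrier A" "\<pi> v = y" by (rule proj_surjE [OF y])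
      then have "y = \<kappa> (\<pi> (inv_into (carrier A) \<phi> v))" by (simp add: \<kappa> D(7,8))
      then show "y \<in> \<kappa> ` carrier Q" by (rule image_eqI) (simp add: D(7) v)
    next
      fix y assume "y \<in> \<kappa> ` carrier Q"
      then obtain x where "x \<in> carrier Q" "y = \<kappa> x" by blast
      then show "y \<in> carrier Q" using \<kappa> [of "t x"] by simp
    qed
    ultimately show "bij_betw \<kappa> (carrier Q) (carrier Q)" by (simp add: bij_betw_def)
    fix x y assume x: "x \<in> carrier Q" and y: "y \<in> carrier Q"
    show "\<kappa> (x \<otimes>\<^bsub>Q\<^esub> y) = \<kappa> x \<otimes>\<^bsub>Q\<^esub> \<kappa> y \<and> \<kappa> \<lbrace>x, y\<rbrace>\<^bsub>Q\<^esub> = \<lbrace>\<kappa> x, \<kappa> y\<rbrace>\<^bsub>Q\<^esub>"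
      using x y \<kappa> [of "t x"] \<kappa> [of "t y"] \<kappa> [of "t x \<otimes>\<^bsub>A\<^esub> t y"] \<kappa> [of "\<lbrace>t x, t y\<rbrace>\<^bsub>A\<^esub>"]
      by (simp add: A.lie_closed D(6))
  qed
  show "psi I Q E t \<phi> \<in> mla_auto I \<times> mla_auto Q" using \<omega>_auto \<kappa>_auto by (simp add: psi)
  show "a \<in> carrier I \<Longrightarrow> \<phi> (\<iota> a) = \<iota> (fst (psi I Q E t \<phi>) a)" by (simp add: psi \<omega>)
  show "u \<in> carrier A \<Longrightarrow> \<pi> (\<phi> u) = snd (psi I Q E t \<phi>) (\<pi> u)" by (simp add: psi \<kappa>)
  show "ext_iso I (relabel_ext I (psi I Q E t \<phi>) E) E \<phi>"
    unfolding ext_iso_def psi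
    by (simp add: D(3,4,6) A.lie_closed mla_autoD(7,8) [OF \<omega>_auto] \<kappa> \<omega>(1) flip: \<omega>(2))
qed

lemma iso_relabel_aut:
  assumes t: "is_section Q E t" and p: "p \<in> mla_auto I \<times> mla_auto Q"
    and f: "ext_iso I (relabel_ext I p E) E f"
  shows "restrict f (carrier A) \<in> carrier (Aut_I I E)"
    and "psi I Q E t (restrict f (carrier A)) = p"
proof -
  interpret S: ext_section I Q E t by unfold_locales (rule t)
  obtain \<omega> \<kappa> where p_eq: "p = (\<omega>, \<kappa>)" and \<omega>: "\<omega> \<in> mla_auto I" and \<kappa>: "\<kappa> \<in> mla_auto Q"
    using p by auto
  note D = ext_isoD [OF f, simplified]
  have f\<iota>: "f (\<iota> a) = \<iota> (\<omega> a)" if "a \<in> carrier I" for a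
    using D(10) [of "\<omega> a"] that by (simp add: p_eq mla_autoD(4,9) [OF \<omega>])
  have "restrict f (carrier A) \<in> mla_auto A"
  proof (rule mla_autoI)
    show "bij_betw (restrict f (carrier A)) (carrier A) (carrier A)" using D(1) by simp
  qed (simp_all add: D(4,6) A.lie_closed)
  moreover have "restrict f (carrier A) ` \<iota> ` carrier I = \<iota> ` \<omega> ` carrier I"
    unfolding image_image by (rule image_cong) (simp_all add: f\<iota>)
  moreover have "\<omega> ` carrier I = carrier I" using mla_autoD(3) [OF \<omega>] by (simp add: bij_betw_def)
  ultimately show "restrict f (carrier A) \<in> carrier (Aut_I I E)" by (simp add: Aut_I_simps)
  have "(\<lambda>a \<in> carrier I. incl_inv I E (restrict f (carrier A) (\<iota> a))) = restrict \<omega> (carrier I)"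
    by (rule restrict_ext) (simp add: f\<iota> mla_autoD(4) [OF \<omega>])
  moreover have "(\<lambda>x \<in> carrier Q. \<pi> (restrict f (carrier A) (t x))) = restrict \<kappa> (carrier Q)"
    by (rule restrict_ext) (use D(11) in \<open>simp add: p_eq\<close>)
  ultimately show "psi I Q E t (restrict f (carrier A)) = p"
    by (simp add: psi_def p_eq extensional_restrict [OF mla_autoD(2)] \<omega> \<kappa>)
qed

end

context ext_section
begin

lemma relabel_section:
  assumes p: "p \<in> mla_auto I \<times> mla_auto Q"
  defines "l' \<equiv> \<lambda>x. l (inv_into (carrier Q) (snd p) x)"
  shows "ext_section I Q (relabel_ext I p E) l'"
    and "section_action I Q (relabel_ext I p E) l' = act_twist I Q p \<alpha>"
    and "section_cocycle I Q (relabel_ext I p E) l' = cocycle_twist I Q p R"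
proof -
  obtain \<omega> \<kappa> where p_eq: "p = (\<omega>, \<kappa>)" and \<omega>: "\<omega> \<in> mla_auto I" and \<kappa>: "\<kappa> \<in> mla_auto Q"
    using p by auto
  note D\<omega> = mla_autoD [OF \<omega>] and D\<kappa> = mla_autoD [OF \<kappa>]
  let ?E = "relabel_ext I p E"
  let ?w = "inv_into (carrier I) \<omega>" and ?k = "inv_into (carrier Q) \<kappa>"
  interpret \<kappa>: group_hom Q Q \<kappa> by unfold_locales (use D\<kappa>(4,5) in \<open>simp add: hom_def\<close>)
  have w: "?w (a \<otimes>\<^bsub>I\<^esub> b) = ?w a \<otimes>\<^bsub>I\<^esub> ?w b" "?w \<lbrace>a, b\<rbrace>\<^bsub>I\<^esub> = \<lbrace>?w a, ?w b\<rbrace>\<^bsub>I\<^esub>" "?w a = ?w b \<longleftrightarrow> a = b"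
    if "a \<in> carrier I" "b \<in> carrier I" for a b
  proof -
    have "\<omega> (?w (a \<otimes>\<^bsub>I\<^esub> b)) = \<omega> (?w a \<otimes>\<^bsub>I\<^esub> ?w b)" "\<omega> (?w \<lbrace>a, b\<rbrace>\<^bsub>I\<^esub>) = \<omega> \<lbrace>?w a, ?w b\<rbrace>\<^bsub>I\<^esub>"
      using that by (simp_all add: D\<omega>(5-8) I.lie_closed)
    then show "?w (a \<otimes>\<^bsub>I\<^esub> b) = ?w a \<otimes>\<^bsub>I\<^esub> ?w b" "?w \<lbrace>a, b\<rbrace>\<^bsub>I\<^esub> = \<lbrace>?w a, ?w b\<rbrace>\<^bsub>I\<^esub>"
      using that by (simp_all add: D\<omega>(10) D\<omega>(7) I.lie_closed)
    show "?w a = ?w b \<longleftrightarrow> a = b" using that D\<omega>(8) by metis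
  qed
  have k: "?k (x \<otimes>\<^bsub>Q\<^esub> y) = ?k x \<otimes>\<^bsub>Q\<^esub> ?k y" "?k \<lbrace>x, y\<rbrace>\<^bsub>Q\<^esub> = \<lbrace>?k x, ?k y\<rbrace>\<^bsub>Q\<^esub>"
    if "x \<in> carrier Q" "y \<in> carrier Q" for x y
  proof -
    have "\<kappa> (?k (x \<otimes>\<^bsub>Q\<^esub> y)) = \<kappa> (?k x \<otimes>\<^bsub>Q\<^esub> ?k y)" "\<kappa> (?k \<lbrace>x, y\<rbrace>\<^bsub>Q\<^esub>) = \<kappa> \<lbrace>?k x, ?k y\<rbrace>\<^bsub>Q\<^esub>"
      using that by (simp_all add: D\<kappa>(6-8) Q.lie_closed)
    then show "?k (x \<otimes>\<^bsub>Q\<^esub> y) = ?k x \<otimes>\<^bsub>Q\<^esub> ?k y" "?k \<lbrace>x, y\<rbrace>\<^bsub>Q\<^esub> = \<lbrace>?k x, ?k y\<rbrace>\<^bsub>Q\<^esub>"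
      using that by (simp_all add: D\<kappa>(10) D\<kappa>(7) Q.lie_closed del: \<kappa>.hom_mult)
  qed
  have k1: "?k \<one>\<^bsub>Q\<^esub> = \<one>\<^bsub>Q\<^esub>" using D\<kappa>(9) [of "\<one>\<^bsub>Q\<^esub>"] by simp
  have incl_im: "incl ?E ` carrier I = \<iota> ` carrier I"
  proof -
    have "incl ?E ` carrier I = \<iota> ` ?w ` carrier I" unfolding image_image by (simp add: p_eq)
    also have "?w ` carrier I = carrier I"
      using bij_betw_inv_into [OF D\<omega>(3)] by (simp add: bij_betw_def)
    finally show ?thesis .
  qed
  have ker: "kernel A Q (proj ?E) = kernel A Q \<pi>"
  proof -
    have "\<kappa> (\<pi> u) = \<one>\<^bsub>Q\<^esub> \<longleftrightarrow> \<pi> u = \<one>\<^bsub>Q\<^esub>" if "u \<in> carrier A" for u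
      using D\<kappa>(10) [of "\<pi> u" "\<one>\<^bsub>Q\<^esub>"] that by simp
    then show ?thesis by (auto simp: kernel_def p_eq)
  qed
  have "incl ?E \<in> mla_hom I A"
    by (simp add: mla_hom_def hom_def p_eq w D\<omega>(7) I.lie_closed)
  moreover have "inj_on (incl ?E) (carrier I)"
    by (rule inj_onI) (simp add: p_eq D\<omega>(7) w(3))
  moreover have "proj ?E \<in> mla_hom A Q"
    by (simp add: mla_hom_def hom_def p_eq D\<kappa>(4,6))
  moreover have "proj ?E ` carrier A = carrier Q"
  proof -
    have "proj ?E ` carrier A = \<kappa> ` \<pi> ` carrier A" unfolding image_image by (simp add: p_eq)
    also have "\<pi> ` carrier A = carrier Q" using ext by (simp add: extension_def)
    also have "\<kappa> ` carrier Q = carrier Q" using D\<kappa>(3) by (simp add: bij_betw_def)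
    finally show ?thesis .
  qed
  ultimately have E': "extension I Q ?E"
    using kernel_incl unfolding extension_def incl_im relabel_ext_simps(1) ker
    by (simp add: I.mult_lie_algebra_axioms A.mult_lie_algebra_axioms Q.mult_lie_algebra_axioms)
  have "is_section Q ?E l'"
    by (simp add: is_section_def l'_def p_eq D\<kappa>(7,8) k1)
  then show S': "ext_section I Q ?E l'" by (rule ext_sectionI [OF E'])
  interpret E': mla_extension I Q ?E by unfold_locales (rule E')
  have inv: "incl_inv I ?E u = \<omega> (incl_inv I E u)" if u: "u \<in> carrier A" "\<pi> u = \<one>\<^bsub>Q\<^esub>" for u
  proof -
    obtain a where a: "a \<in> carrier I" "u = \<iota> a" by (rule proj_oneE [OF u])
    have e: "incl ?E (\<omega> a) = u" using a by (simp add: p_eq D\<omega>(9))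
    have "incl_inv I ?E (incl ?E (\<omega> a)) = \<omega> a" using a by (intro E'.incl_inv_incl D\<omega>(4))
    then show ?thesis unfolding e using a by simp
  qed
  show act: "section_action I Q ?E l' = act_twist I Q p \<alpha>"
    by (intro act_terms.equality)
      (simp_all add: p_eq section_action_def twist_def l'_def inv [unfolded p_eq] D\<omega>(7) D\<kappa>(7)
        A.lie_closed cong: restrict_cong)
  have trunc: "act_terms.truncate R = \<alpha>" by simp
  show "section_cocycle I Q ?E l' = cocycle_twist I Q p R"
    unfolding section_cocycle_def [of I Q ?E] act
    by (simp add: cocycle_twist_def p_eq l'_def case_prod_beta mem_Times_iff
        section_cocycle_def [of I Q E l] act_terms.defs cocycle.defs
        inv [unfolded p_eq] D\<kappa>(7) k A.lie_closed Q.lie_closed cong: restrict_cong)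
qed

end

section \<open>Derivations\<close>

context central_action
begin

lemma DerD:
  assumes "d \<in> carrier (Der B Q \<chi>)"
  shows "d \<in> extensional (carrier Q)" "x \<in> carrier Q \<Longrightarrow> d x \<in> carrier B"
    "x \<in> carrier Q \<Longrightarrow> y \<in> carrier Q \<Longrightarrow> d (x \<otimes>\<^bsub>Q\<^esub> y) = d x \<otimes>\<^bsub>I\<^esub> sigma \<chi> x (d y)"
    "x \<in> carrier Q \<Longrightarrow> y \<in> carrier Q \<Longrightarrow> d \<lbrace>x, y\<rbrace>\<^bsub>Q\<^esub> = lt (d x) x (d y) y"
  using assms by (auto simp: Der_def PiE_iff)

lemma DerI:
  assumes "d \<in> extensional (carrier Q)" "\<And>x. x \<in> carrier Q \<Longrightarrow> d x \<in> carrier B"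
    "\<And>x y. x \<in> carrier Q \<Longrightarrow> y \<in> carrier Q \<Longrightarrow> d (x \<otimes>\<^bsub>Q\<^esub> y) = d x \<otimes>\<^bsub>I\<^esub> sigma \<chi> x (d y)"
    "\<And>x y. x \<in> carrier Q \<Longrightarrow> y \<in> carrier Q \<Longrightarrow> d \<lbrace>x, y\<rbrace>\<^bsub>Q\<^esub> = lt (d x) x (d y) y"
  shows "d \<in> carrier (Der B Q \<chi>)"
  using assms by (simp add: Der_def PiE_iff)

lemma Der_simps:
  "d \<otimes>\<^bsub>Der B Q \<chi>\<^esub> d' = (\<lambda>x \<in> carrier Q. d x \<otimes>\<^bsub>I\<^esub> d' x)"
  "\<one>\<^bsub>Der B Q \<chi>\<^esub> = (\<lambda>x \<in> carrier Q. \<one>\<^bsub>I\<^esub>)"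
  by (simp_all add: Der_def)

lemma sigma_inv:
  assumes [simp]: "x \<in> carrier Q" "b \<in> carrier B"
  shows "sigma \<chi> x (inv\<^bsub>I\<^esub> b) = inv\<^bsub>I\<^esub> sigma \<chi> x b"
  using sigma_mult [of x "inv\<^bsub>I\<^esub> b" b] I.inv_equality [of "sigma \<chi> x (inv\<^bsub>I\<^esub> b)" "sigma \<chi> x b"]
  by simp

lemma lt_inv:
  assumes [simp]: "x \<in> carrier Q" "y \<in> carrier Q" "c \<in> carrier B" "d \<in> carrier B"
  shows "lt (inv\<^bsub>I\<^esub> c) x (inv\<^bsub>I\<^esub> d) y = inv\<^bsub>I\<^esub> lt c x d y"
  using lt_mult [of x y "inv\<^bsub>I\<^esub> c" "inv\<^bsub>I\<^esub> d" c d]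
    I.inv_equality [of "lt (inv\<^bsub>I\<^esub> c) x (inv\<^bsub>I\<^esub> d) y" "lt c x d y"]
  by simp

lemma group_Der: "group (Der B Q \<chi>)"
proof (rule groupI)
  fix d d' assume d: "d \<in> carrier (Der B Q \<chi>)" and d': "d' \<in> carrier (Der B Q \<chi>)"
  note [simp] = DerD(2-4) [OF d] DerD(2-4) [OF d']
  show "d \<otimes>\<^bsub>Der B Q \<chi>\<^esub> d' \<in> carrier (Der B Q \<chi>)"
    by (rule DerI) (simp_all add: Der_simps sigma_mult lt_mult Q.lie_closed Z_ac)
next
  show "\<one>\<^bsub>Der B Q \<chi>\<^esub> \<in> carrier (Der B Q \<chi>)"
    by (rule DerI) (simp_all add: Der_simps Q.lie_closed)
next
  fix d d' d'' assume d: "d \<in> carrier (Der B Q \<chi>)" and d': "d' \<in> carrier (Der B Q \<chi>)"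
    and d'': "d'' \<in> carrier (Der B Q \<chi>)"
  show "d \<otimes>\<^bsub>Der B Q \<chi>\<^esub> d' \<otimes>\<^bsub>Der B Q \<chi>\<^esub> d'' = d \<otimes>\<^bsub>Der B Q \<chi>\<^esub> (d' \<otimes>\<^bsub>Der B Q \<chi>\<^esub> d'')"
    by (simp add: Der_simps I.m_assoc DerD(2) [OF d] DerD(2) [OF d'] DerD(2) [OF d'']
        cong: restrict_cong)
next
  fix d assume d: "d \<in> carrier (Der B Q \<chi>)"
  note [simp] = DerD(2-4) [OF d]
  show "\<one>\<^bsub>Der B Q \<chi>\<^esub> \<otimes>\<^bsub>Der B Q \<chi>\<^esub> d = d"
    by (simp add: Der_simps extensional_restrict [OF DerD(1) [OF d]] cong: restrict_cong)
  let ?d' = "\<lambda>x \<in> carrier Q. inv\<^bsub>I\<^esub> d x"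
  have "?d' \<in> carrier (Der B Q \<chi>)"
    by (rule DerI) (simp_all add: sigma_inv lt_inv Q.lie_closed I.inv_mult_group Z_ac)
  moreover have "?d' \<otimes>\<^bsub>Der B Q \<chi>\<^esub> d = \<one>\<^bsub>Der B Q \<chi>\<^esub>"
    by (simp add: Der_simps cong: restrict_cong)
  ultimately show "\<exists>d' \<in> carrier (Der B Q \<chi>). d' \<otimes>\<^bsub>Der B Q \<chi>\<^esub> d = \<one>\<^bsub>Der B Q \<chi>\<^esub>" by blast
qed

lemma Der_one:
  assumes d: "d \<in> carrier (Der B Q \<chi>)"
  shows "d \<one>\<^bsub>Q\<^esub> = \<one>\<^bsub>I\<^esub>"
  using DerD(3) [OF d, of "\<one>\<^bsub>Q\<^esub>" "\<one>\<^bsub>Q\<^esub>"] DerD(2) [OF d, of "\<one>\<^bsub>Q\<^esub>"] by simp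

lemma Der_iso:
  assumes d: "d \<in> carrier (Der B Q \<chi>)"
  shows "ext_iso I E E (\<lambda>u. \<iota> (d (\<pi> u)) \<otimes>\<^bsub>A\<^esub> u)"
proof -
  note [simp] = DerD(2-4) [OF d] Der_one [OF d]
  have "bij_betw (\<lambda>u. \<iota> (d (\<pi> u)) \<otimes>\<^bsub>A\<^esub> u) (carrier A) (carrier A)"
    by (rule bij_betw_byWitness [where f' = "\<lambda>u. \<iota> (inv\<^bsub>I\<^esub> d (\<pi> u)) \<otimes>\<^bsub>A\<^esub> u"])
      (auto simp: A.inv_cancel_left)
  then show ?thesis
    unfolding ext_iso_def
    by (simp add: central_mult central_lie A.lie_closed del: incl.hom_mult)
qed

text \<open>
  The case of two trivial cochains in \<open>twist_iso_form\<close>: the coboundary of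
  \<open>k\<close> is trivial exactly when \<open>k\<close> is a derivation.
\<close>

lemma iso_Der:
  assumes f: "ext_iso I E E f"
  obtains d where "d \<in> carrier (Der B Q \<chi>)" "\<And>u. u \<in> carrier A \<Longrightarrow> f u = \<iota> (d (\<pi> u)) \<otimes>\<^bsub>A\<^esub> u"
proof -
  have "ext_iso I (twist_ext E \<one>\<^bsub>cochains B Q\<^esub>) (twist_ext E \<one>\<^bsub>cochains B Q\<^esub>) f"
    by (rule twist_ext_iso [OF ext ext f C.one_closed])
  then obtain k where k: "k \<in> carrier Q \<rightarrow>\<^sub>E carrier B" "k \<one>\<^bsub>Q\<^esub> = \<one>\<^bsub>I\<^esub>"
    and fk: "\<And>u. u \<in> carrier A \<Longrightarrow> f u = \<iota> (k (\<pi> u)) \<otimes>\<^bsub>A\<^esub> u"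
    and eq: "\<one>\<^bsub>cochains B Q\<^esub> = \<one>\<^bsub>cochains B Q\<^esub> \<otimes>\<^bsub>cochains B Q\<^esub> \<delta> k"
    by (rule twist_iso_form [OF C.one_closed C.one_closed]) (rule that; simp)
  have kp: "k \<in> carrier Q \<rightarrow> carrier B" using k(1) by auto
  have kB [simp]: "k x \<in> carrier B" if "x \<in> carrier Q" for x using kp that by auto
  have \<delta>: "\<delta> k = \<one>\<^bsub>cochains B Q\<^esub>" using eq \<delta>_cochain [OF kp k(2)] by simp
  have "k \<in> carrier (Der B Q \<chi>)"
  proof (rule DerI)
    fix x y assume xy [simp]: "x \<in> carrier Q" "y \<in> carrier Q"
    have "k x \<otimes>\<^bsub>I\<^esub> sigma \<chi> x (k y) \<otimes>\<^bsub>I\<^esub> inv\<^bsub>I\<^esub> k (x \<otimes>\<^bsub>Q\<^esub> y) = \<one>\<^bsub>I\<^esub>"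
      "lt (k x) x (k y) y \<otimes>\<^bsub>I\<^esub> inv\<^bsub>I\<^esub> k \<lbrace>x, y\<rbrace>\<^bsub>Q\<^esub> = \<one>\<^bsub>I\<^esub>"
      using \<delta>_simps [OF kp xy] by (simp_all add: \<delta> cochain_ops)
    then show "k (x \<otimes>\<^bsub>Q\<^esub> y) = k x \<otimes>\<^bsub>I\<^esub> sigma \<chi> x (k y)" "k \<lbrace>x, y\<rbrace>\<^bsub>Q\<^esub> = lt (k x) x (k y) y"
      using I.inv_solve_right' [of "\<one>\<^bsub>I\<^esub>" "k x \<otimes>\<^bsub>I\<^esub> sigma \<chi> x (k y)" "k (x \<otimes>\<^bsub>Q\<^esub> y)"]
        I.inv_solve_right' [of "\<one>\<^bsub>I\<^esub>" "lt (k x) x (k y) y" "k \<lbrace>x, y\<rbrace>\<^bsub>Q\<^esub>"]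
      by (simp_all add: Q.lie_closed)
  qed (use k(1) in \<open>auto simp: PiE_iff\<close>)
  then show ?thesis by (rule that [OF _ fk])
qed

end

section \<open>The group of compatible automorphisms\<close>

lemma (in mla_extension) ext_iso_refl: "ext_iso I E E (\<lambda>u. u)"
  by (simp add: ext_iso_def bij_betw_def A.lie_closed)

lemma ext_class_eq_iff:
  assumes E: "extension I Q E" and E': "extension I Q E'"
  shows "ext_class I Q E = ext_class I Q E' \<longleftrightarrow> (\<exists>f. ext_iso I E E' f)"
proof
  assume eq: "ext_class I Q E = ext_class I Q E'"
  have "E' \<in> ext_class I Q E'"
    using E' ext_equivI [OF mla_extension.ext_iso_refl [OF mla_extension.intro [OF E']]]
    by (simp add: ext_class_def)
  then have "ext_equiv I E E'" unfolding eq [symmetric] by (simp add: ext_class_def)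
  then obtain f where "ext_iso I E E' f" using E E' by (rule ext_equivE)
  then show "\<exists>f. ext_iso I E E' f" by blast
next
  assume "\<exists>f. ext_iso I E E' f"
  then obtain f where f: "ext_iso I E E' f" by blast
  have "ext_equiv I E F \<longleftrightarrow> ext_equiv I E' F" if F: "extension I Q F" for F
  proof
    assume "ext_equiv I E F"
    then obtain g where "ext_iso I E F g" using E F by (rule ext_equivE)
    with ext_iso_sym [OF f] show "ext_equiv I E' F" by (rule ext_equivI [OF ext_iso_trans])
  next
    assume "ext_equiv I E' F"
    then obtain g where "ext_iso I E' F g" using E' F by (rule ext_equivE)
    with f show "ext_equiv I E F" by (rule ext_equivI [OF ext_iso_trans])
  qed
  then show "ext_class I Q E = ext_class I Q E'"
    unfolding ext_class_def by (intro Collect_cong conj_cong refl)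
qed

context ext_section
begin

lemma compatible_iff:
  "p \<in> carrier (compatible_autos I Q \<alpha>) \<longleftrightarrow>
    p \<in> mla_auto I \<times> mla_auto Q \<and> act_equiv I Q \<alpha> (act_twist I Q p \<alpha>)"
proof -
  have "action_terms I Q (act_twist I Q p \<alpha>)" if p: "p \<in> mla_auto I \<times> mla_auto Q"
    using ext_section.action_terms_section [OF relabel_section(1) [OF p]]
    by (simp only: relabel_section(2) [OF p])
  then show ?thesis
    using act_class_eq_iff [OF I.mult_lie_algebra_axioms action_terms_section]
    by (auto simp: compatible_autos_def)
qed

lemma group_compatible: "group (compatible_autos I Q \<alpha>)"
proof -
  let ?P = "mla_AutoGroup I \<times>\<times> mla_AutoGroup Q"
  interpret P: group ?P by (rule DirProd_group [OF I.group_mla_AutoGroup Q.group_mla_AutoGroup])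
  have carrier: "carrier ?P = mla_auto I \<times> mla_auto Q" by (simp add: mla_AutoGroup_simps)
  note I = I.mult_lie_algebra_axioms and maps = action_maps_terms [OF action_terms_section]
  note maps_twist = action_terms_twist [OF I action_terms_section]
  let ?C = "carrier (compatible_autos I Q \<alpha>)"
  have twist_mult: "act_twist I Q p (act_twist I Q q \<alpha>) = act_twist I Q (p \<otimes>\<^bsub>?P\<^esub> q) \<alpha>"
    if "p \<in> mla_auto I \<times> mla_auto Q" "q \<in> mla_auto I \<times> mla_auto Q" for p q
    using act_twist_twist [OF that maps] .
  have "subgroup ?C ?P"
  proof (rule P.subgroupI)
    show "?C \<subseteq> carrier ?P" by (auto simp: compatible_iff mla_AutoGroup_simps(1))
    have "\<one>\<^bsub>?P\<^esub> \<in> ?C"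
      using P.one_closed act_equiv_refl [OF I maps]
      by (simp only: compatible_iff act_twist_one [OF action_terms_section] carrier simp_thms)
    then show "?C \<noteq> {}" by blast
  next
    fix p assume "p \<in> ?C"
    then have p: "p \<in> mla_auto I \<times> mla_auto Q" and e: "act_equiv I Q \<alpha> (act_twist I Q p \<alpha>)"
      by (simp_all only: compatible_iff)
    have p': "inv\<^bsub>?P\<^esub> p \<in> mla_auto I \<times> mla_auto Q"
      using P.inv_closed [of p] p by (simp only: carrier)
    have "inv\<^bsub>?P\<^esub> p \<otimes>\<^bsub>?P\<^esub> p = \<one>\<^bsub>?P\<^esub>" by (rule P.l_inv) (simp only: carrier p)
    then have "act_equiv I Q (act_twist I Q (inv\<^bsub>?P\<^esub> p) \<alpha>) \<alpha>"
      using act_equiv_twist [OF I maps_twist [OF p] e p']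
      by (simp only: twist_mult [OF p' p] act_twist_one [OF action_terms_section])
    then have "act_equiv I Q \<alpha> (act_twist I Q (inv\<^bsub>?P\<^esub> p) \<alpha>)"
      by (rule act_equiv_sym [OF I maps])
    then show "inv\<^bsub>?P\<^esub> p \<in> ?C" using p' by (simp only: compatible_iff simp_thms)
    fix q assume "q \<in> ?C"
    then have q: "q \<in> mla_auto I \<times> mla_auto Q" and e': "act_equiv I Q \<alpha> (act_twist I Q q \<alpha>)"
      by (simp_all only: compatible_iff)
    have pq: "p \<otimes>\<^bsub>?P\<^esub> q \<in> mla_auto I \<times> mla_auto Q"
      using P.m_closed [of p q] p q by (simp only: carrier)
    have "act_equiv I Q (act_twist I Q p \<alpha>) (act_twist I Q (p \<otimes>\<^bsub>?P\<^esub> q) \<alpha>)"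
      using act_equiv_twist [OF I maps_twist [OF q] e' p] by (simp only: twist_mult [OF p q])
    then have "act_equiv I Q \<alpha> (act_twist I Q (p \<otimes>\<^bsub>?P\<^esub> q) \<alpha>)"
      by (rule act_equiv_trans [OF I maps_twist [OF pq] e])
    then show "p \<otimes>\<^bsub>?P\<^esub> q \<in> ?C" using pq by (simp only: compatible_iff simp_thms)
  qed
  then have "group (?P\<lparr>carrier := ?C\<rparr>)" by (rule subgroup.subgroup_is_group) (rule P.is_group)
  then show ?thesis by (simp add: compatible_autos_def)
qed

text \<open>
  The isomorphism from the relabelled extension carries its section to a section of
  \<open>E\<close> with the twisted action terms, and any two sections of \<open>E\<close> have
  equivalent action terms.
\<close>

lemma psi_compatible:
  assumes t: "is_section Q E t" and \<phi>: "\<phi> \<in> carrier (Aut_I I E)"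
  shows "psi I Q E t \<phi> \<in> carrier (compatible_autos I Q \<alpha>)"
proof -
  let ?p = "psi I Q E t \<phi>"
  note p = psi_spec(1) [OF t \<phi>]
  interpret F: ext_section I Q "relabel_ext I ?p E" "\<lambda>x. l (inv_into (carrier Q) (snd ?p) x)"
    by (rule relabel_section(1) [OF p])
  note sec' = F.section_transport(1,3) [OF psi_spec(4) [OF t \<phi>] ext]
  have "act_equiv I Q \<alpha> (act_twist I Q ?p \<alpha>)"
    using change_section [OF sec'(1)] by (simp only: sec'(2) relabel_section(2) [OF p])
  then show ?thesis using p by (simp only: compatible_iff simp_thms)
qed

lemma group_hom_psi:
  assumes t: "is_section Q E t"
  shows "group_hom (Aut_I I E) (compatible_autos I Q \<alpha>) (psi I Q E t)"
proof -
  interpret T: ext_section I Q E t by unfold_locales (rule t)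
  have "psi I Q E t (\<phi> \<otimes>\<^bsub>Aut_I I E\<^esub> \<phi>') =
      psi I Q E t \<phi> \<otimes>\<^bsub>compatible_autos I Q \<alpha>\<^esub> psi I Q E t \<phi>'"
    if \<phi>: "\<phi> \<in> carrier (Aut_I I E)" and \<phi>': "\<phi>' \<in> carrier (Aut_I I E)" for \<phi> \<phi>'
  proof -
    note S = psi_spec [OF t \<phi>] and S' = psi_spec [OF t \<phi>']
    obtain \<omega> \<kappa> where p: "psi I Q E t \<phi> = (\<omega>, \<kappa>)" by (rule prod.exhaust)
    obtain \<omega>' \<kappa>' where p': "psi I Q E t \<phi>' = (\<omega>', \<kappa>')" by (rule prod.exhaust)
    have auto: "\<omega> \<in> mla_auto I" "\<kappa> \<in> mla_auto Q" "\<omega>' \<in> mla_auto I" "\<kappa>' \<in> mla_auto Q"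
      using S(1) S'(1) by (simp_all add: p p')
    have m: "\<phi> \<in> mla_auto A" "\<phi>' \<in> mla_auto A" using \<phi> \<phi>' by (simp_all add: Aut_I_simps)
    have "psi I Q E t (compose (carrier A) \<phi> \<phi>') =
        (compose (carrier I) \<omega> \<omega>', compose (carrier Q) \<kappa> \<kappa>')"
      unfolding psi_def [of I Q E t "compose (carrier A) \<phi> \<phi>'"]
      using S(2,3) S'(2,3)
      by (simp add: compose_def p p'
          mla_autoD(4) [OF m(1)] mla_autoD(4) [OF m(2)] mla_autoD(4) [OF auto(1)]
          mla_autoD(4) [OF auto(3)] cong: restrict_cong)
    then show ?thesis
      by (simp add: Aut_I_simps(2) [OF m] p p' compatible_autos_def mla_AutoGroup_simps auto)
  qed
  then show ?thesis
    using group_Aut_I group_compatible psi_compatible [OF t]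
    by (simp add: group_hom_def group_hom_axioms_def hom_def Pi_iff)
qed

section \<open>The Wells map\<close>

abbreviation \<zeta> where "\<zeta> \<equiv> act_restrict B Q \<alpha>"

sublocale central_action I Q E \<zeta> by (rule central_action_section)

text \<open>
  Compatibility provides a section of the relabelled extension with the action terms of
  \<open>l\<close>, so \<open>same_action_cocycle\<close> applies.
\<close>

lemma obstruction_exists:
  assumes p: "p \<in> carrier (compatible_autos I Q \<alpha>)"
  shows "central_action I Q (relabel_ext I p E) \<zeta>"
    and "\<exists>S \<in> carrier (Z2 B Q \<zeta>). \<exists>f. ext_iso I (twist_ext (relabel_ext I p E) S) E f"
proof -
  have p': "p \<in> mla_auto I \<times> mla_auto Q" and e: "act_equiv I Q \<alpha> (act_twist I Q p \<alpha>)"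
    using p by (simp_all only: compatible_iff)
  let ?F = "relabel_ext I p E" and ?l = "\<lambda>x. l (inv_into (carrier Q) (snd p) x)"
  have F: "ext_section I Q ?F ?l" by (rule relabel_section(1) [OF p'])
  obtain m where m: "is_section Q ?F m" and act: "section_action I Q ?F m = \<alpha>"
    by (rule section_with_action [OF F ext_section_axioms])
      (simp only: relabel_section(2) [OF p'] e)
  have FE: "extension I Q ?F" using F by (simp add: ext_section_def mla_extension_def)
  interpret M: ext_section I Q ?F m by (rule ext_sectionI [OF FE m])
  show c: "central_action I Q ?F \<zeta>" using M.central_action_section by (simp only: act)
  interpret c: central_action I Q ?F \<zeta> by (rule c)
  obtain S where S: "S \<in> carrier (cochains B Q)" and R: "R = cocycle_shift I Q M.R S"
    by (rule same_action_cocycle [OF M.ext_section_axioms ext_section_axioms act])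
  have "ext_iso I (cocycle_ext I Q R) (twist_ext ?F S) (decode ?F m)"
    unfolding R by (rule M.decode_iso [OF S])
  then have iso: "ext_iso I (twist_ext ?F S) E
      (decode E l \<circ> inv_into (carrier (mid (cocycle_ext I Q R))) (decode ?F m))"
    by (rule ext_iso_trans [OF ext_iso_sym decode_iso_one])
  have "S \<in> carrier (Z2 B Q \<zeta>)"
    using c.Z2_iff [OF S] extension_iso [OF iso ext] by simp
  then show "\<exists>S \<in> carrier (Z2 B Q \<zeta>). \<exists>f. ext_iso I (twist_ext ?F S) E f" using iso by blast
qed

text \<open>
  Replacing cocycles by twists turns the defining property of the Wells map into a statement
  about isomorphisms: a twist of the relabelled extension by a cocycle \<open>S'\<close> is
  isomorphic to \<open>E\<close> exactly when \<open>S'\<close> is cohomologous to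
  \<open>S\<close>.
\<close>

lemma Wells_eq:
  assumes p: "p \<in> carrier (compatible_autos I Q \<alpha>)"
    and S: "S \<in> carrier (Z2 B Q \<zeta>)" and f: "ext_iso I (twist_ext (relabel_ext I p E) S) E f"
  shows "Wells I Q R p = B2 B Q \<zeta> #>\<^bsub>Z2 B Q \<zeta>\<^esub> S"
proof -
  have p': "p \<in> mla_auto I \<times> mla_auto Q" using p by (simp only: compatible_iff)
  let ?F = "relabel_ext I p E" and ?l = "\<lambda>x. l (inv_into (carrier Q) (snd p) x)"
  let ?Rp = "cocycle_twist I Q p R"
  let ?u = "B2 B Q \<zeta> #>\<^bsub>Z2 B Q \<zeta>\<^esub> S"
  interpret F: ext_section I Q ?F ?l by (rule relabel_section(1) [OF p'])
  interpret FC: central_action I Q ?F \<zeta> by (rule obstruction_exists(1) [OF p])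
  interpret Z: comm_group "Z2 B Q \<zeta>" by (rule comm_group_Z2)
  have Rp: "section_cocycle I Q ?F ?l = ?Rp" by (rule relabel_section(3) [OF p'])
  have ER: "extension I Q (cocycle_ext I Q R)" by (rule extension_iso [OF decode_iso_one ext])
  have Rp_iso: "ext_iso I (cocycle_ext I Q ?Rp) ?F (decode ?F ?l)"
    using F.decode_iso_one by (simp only: Rp)
  have ERp: "extension I Q (cocycle_ext I Q ?Rp)" by (rule extension_iso [OF Rp_iso F.ext])
  \<comment> \<open>Which representatives of the class and of the cohomology class are taken does not matter.\<close>
  have repr: "ext_class I Q (cocycle_ext I Q (cocycle_shift I Q R' S')) = ext_class I Q (cocycle_ext I Q R)"
    if R': "two_cocycle I Q R'" and X: "ext_class I Q (cocycle_ext I Q R') = ext_class I Q (cocycle_ext I Q ?Rp)"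
      and S': "S' \<in> ?u" for R' S'
  proof -
    obtain E' :: "('i, 'i \<times> 'q, 'q) mla_ext" and m where E': "extension I Q E'" "is_section Q E' m"
      and R'_eq: "R' = section_cocycle I Q E' m"
      using R' unfolding two_cocycle_def by (elim exE conjE)
    interpret E': ext_section I Q E' m by (rule ext_sectionI [OF E'])
    have R'_iso: "ext_iso I (cocycle_ext I Q R') E' (decode E' m)"
      unfolding R'_eq by (rule E'.decode_iso_one)
    have ER': "extension I Q (cocycle_ext I Q R')" by (rule extension_iso [OF R'_iso E'(1)])
    obtain g where "ext_iso I (cocycle_ext I Q R') (cocycle_ext I Q ?Rp) g"
      using X ext_class_eq_iff [OF ER' ERp] by blast
    note iso = ext_iso_trans [OF ext_iso_trans [OF ext_iso_sym [OF R'_iso] this] Rp_iso]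
    have S'Z: "S' \<in> carrier (Z2 B Q \<zeta>)"
      using S' Z.r_coset_subset_G [of "B2 B Q \<zeta>" S] S subgroup.subset [OF subgroup_B2] by blast
    obtain k where k: "ext_iso I (twist_ext ?F S') (twist_ext ?F S) k"
      using FC.twist_iso_iff [OF S'Z S] S' by blast
    have "ext_iso I (cocycle_ext I Q (cocycle_shift I Q R' S')) (twist_ext E' S') (decode E' m)"
      unfolding R'_eq by (rule E'.decode_iso [OF Z2_cochain [OF S'Z]])
    note chain = ext_iso_trans [OF ext_iso_trans [OF ext_iso_trans [OF ext_iso_trans [OF this
          twist_ext_iso [OF E'(1) F.ext iso Z2_cochain [OF S'Z]]] k] f] ext_iso_sym [OF decode_iso_one]]
    then show ?thesis
      using ext_class_eq_iff [OF extension_iso [OF chain ER] ER] by blast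
  qed
  have two: "two_cocycle I Q ?Rp" using F.two_cocycle_section by (simp only: Rp)
  have trunc: "act_terms.truncate R = \<alpha>" by simp
  have S_u: "S \<in> ?u" using Z.rcos_self [OF S subgroup_B2] .
  show ?thesis
    unfolding Wells_def trunc
  proof (rule the_equality)
    have "?u \<in> carrier (H2 B Q \<zeta>)" using S by (auto simp: H2_def carrier_FactGroup)
    moreover have "ext_act I Q (ext_class I Q (cocycle_ext I Q ?Rp)) ?u = ext_class I Q (cocycle_ext I Q R)"
      unfolding ext_act_def
    proof (intro equalityI subsetI)
      fix X assume "X \<in> (\<Union>R' \<in> {R'. two_cocycle I Q R' \<and>
            ext_class I Q (cocycle_ext I Q R') = ext_class I Q (cocycle_ext I Q ?Rp)}.
          \<Union>S' \<in> ?u. ext_class I Q (cocycle_ext I Q (cocycle_shift I Q R' S')))"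
      then show "X \<in> ext_class I Q (cocycle_ext I Q R)"
        by (elim UN_E CollectE conjE) (simp only: repr)
    next
      fix X assume "X \<in> ext_class I Q (cocycle_ext I Q R)"
      then have "X \<in> ext_class I Q (cocycle_ext I Q (cocycle_shift I Q ?Rp S))"
        by (simp only: repr [OF two refl S_u])
      then show "X \<in> (\<Union>R' \<in> {R'. two_cocycle I Q R' \<and>
            ext_class I Q (cocycle_ext I Q R') = ext_class I Q (cocycle_ext I Q ?Rp)}.
          \<Union>S' \<in> ?u. ext_class I Q (cocycle_ext I Q (cocycle_shift I Q R' S')))"
        using two S_u by blast
    qed
    ultimately show "?u \<in> carrier (H2 B Q \<zeta>) \<and>
      ext_act I Q (ext_class I Q (cocycle_ext I Q ?Rp)) ?u = ext_class I Q (cocycle_ext I Q R)" ..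
  next
    fix v assume v: "v \<in> carrier (H2 B Q \<zeta>) \<and>
      ext_act I Q (ext_class I Q (cocycle_ext I Q ?Rp)) v = ext_class I Q (cocycle_ext I Q R)"
    then obtain S' where S': "S' \<in> carrier (Z2 B Q \<zeta>)" and v_eq: "v = B2 B Q \<zeta> #>\<^bsub>Z2 B Q \<zeta>\<^esub> S'"
      by (auto simp: H2_def carrier_FactGroup)
    have S'v: "S' \<in> v" unfolding v_eq by (rule Z.rcos_self [OF S' subgroup_B2])
    let ?G = "cocycle_ext I Q (cocycle_shift I Q ?Rp S')"
    have G: "ext_iso I ?G (twist_ext ?F S') (decode ?F ?l)"
      using F.decode_iso [OF Z2_cochain [OF S']] by (simp only: Rp)
    have EG: "extension I Q ?G" by (rule extension_iso [OF G FC.Z2_extension [OF S']])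
    have "?G \<in> ext_class I Q ?G"
      using EG ext_equivI [OF mla_extension.ext_iso_refl [OF mla_extension.intro [OF EG]]]
      by (simp add: ext_class_def)
    then have "?G \<in> ext_act I Q (ext_class I Q (cocycle_ext I Q ?Rp)) v"
      unfolding ext_act_def using two S'v by blast
    then have "ext_equiv I (cocycle_ext I Q R) ?G" using v by (simp add: ext_class_def)
    then obtain g where g: "ext_iso I (cocycle_ext I Q R) ?G g" using ER EG by (rule ext_equivE)
    have "ext_iso I (twist_ext ?F S') (twist_ext ?F S) (inv_into (carrier (mid (twist_ext ?F S))) f \<circ>
        (decode E l \<circ> (inv_into (carrier (mid (cocycle_ext I Q R))) g \<circ>
          inv_into (carrier (mid ?G)) (decode ?F ?l))))"
      by (intro ext_iso_trans [OF ext_iso_trans [OF ext_iso_trans [OF ext_iso_sym [OF G] ext_iso_sym [OF g]]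
            decode_iso_one] ext_iso_sym [OF f]])
    then have "S' \<in> ?u" using FC.twist_iso_iff [OF S' S] by blast
    then show "v = ?u" unfolding v_eq
      by (rule Z.repr_independence [OF _ S subgroup_B2, symmetric])
  qed
qed

lemma Wells_closed:
  assumes p: "p \<in> carrier (compatible_autos I Q \<alpha>)"
  shows "Wells I Q R p \<in> carrier (H2 B Q \<zeta>)"
proof -
  obtain S f where S: "S \<in> carrier (Z2 B Q \<zeta>)" and "ext_iso I (twist_ext (relabel_ext I p E) S) E f"
    using obstruction_exists(2) [OF p] by (elim bexE exE)
  then have "Wells I Q R p = B2 B Q \<zeta> #>\<^bsub>Z2 B Q \<zeta>\<^esub> S" by (rule Wells_eq [OF p])
  then show ?thesis using S by (auto simp: H2_def carrier_FactGroup)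
qed

lemma Wells_trivial_iff:
  assumes p: "p \<in> carrier (compatible_autos I Q \<alpha>)"
  shows "Wells I Q R p = \<one>\<^bsub>H2 B Q \<zeta>\<^esub> \<longleftrightarrow> (\<exists>f. ext_iso I (relabel_ext I p E) E f)"
proof -
  let ?F = "relabel_ext I p E"
  interpret F: central_action I Q ?F \<zeta> by (rule obstruction_exists(1) [OF p])
  interpret Z: comm_group "Z2 B Q \<zeta>" by (rule comm_group_Z2)
  have one: "\<one>\<^bsub>H2 B Q \<zeta>\<^esub> = B2 B Q \<zeta>" by (simp add: H2_def)
  have Z1: "\<one>\<^bsub>Z2 B Q \<zeta>\<^esub> = \<one>\<^bsub>cochains B Q\<^esub>" by (subst Z2_eq) simp
  show ?thesis
  proof
    assume W: "Wells I Q R p = \<one>\<^bsub>H2 B Q \<zeta>\<^esub>"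
    obtain S f where S: "S \<in> carrier (Z2 B Q \<zeta>)" and f: "ext_iso I (twist_ext ?F S) E f"
      using obstruction_exists(2) [OF p] by (elim bexE exE)
    have "B2 B Q \<zeta> #>\<^bsub>Z2 B Q \<zeta>\<^esub> S = B2 B Q \<zeta>" using Wells_eq [OF p S f] W one by simp
    then have "\<one>\<^bsub>Z2 B Q \<zeta>\<^esub> \<in> B2 B Q \<zeta> #>\<^bsub>Z2 B Q \<zeta>\<^esub> S"
      using subgroup.one_closed [OF subgroup_B2] by simp
    then obtain g where g: "ext_iso I (twist_ext ?F \<one>\<^bsub>Z2 B Q \<zeta>\<^esub>) (twist_ext ?F S) g"
      using F.twist_iso_iff [OF Z.one_closed S] by blast
    have "ext_iso I ?F (twist_ext ?F \<one>\<^bsub>Z2 B Q \<zeta>\<^esub>) (inv_into (carrier (mid (twist_ext ?F \<one>\<^bsub>Z2 B Q \<zeta>\<^esub>))) (\<lambda>u. u))"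
      unfolding Z1 by (rule ext_iso_sym [OF F.twist_one_iso])
    from ext_iso_trans [OF ext_iso_trans [OF this g] f]
    show "\<exists>f. ext_iso I ?F E f" by blast
  next
    assume "\<exists>f. ext_iso I ?F E f"
    then obtain f where f: "ext_iso I ?F E f" by blast
    have "ext_iso I (twist_ext ?F \<one>\<^bsub>Z2 B Q \<zeta>\<^esub>) E (f \<circ> (\<lambda>u. u))"
      unfolding Z1 by (rule ext_iso_trans [OF F.twist_one_iso f])
    then have "Wells I Q R p = B2 B Q \<zeta> #>\<^bsub>Z2 B Q \<zeta>\<^esub> \<one>\<^bsub>Z2 B Q \<zeta>\<^esub>"
      by (rule Wells_eq [OF p Z.one_closed])
    also have "\<dots> = B2 B Q \<zeta>" by (rule Z.coset_mult_one) (rule subgroup.subset [OF subgroup_B2])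
    finally show "Wells I Q R p = \<one>\<^bsub>H2 B Q \<zeta>\<^esub>" by (simp add: one)
  qed
qed

lemma image_psi:
  assumes t: "is_section Q E t"
  shows "psi I Q E t ` carrier (Aut_I I E) =
    {p \<in> carrier (compatible_autos I Q \<alpha>). Wells I Q R p = \<one>\<^bsub>H2 B Q \<zeta>\<^esub>}"
proof (intro equalityI subsetI)
  fix p assume "p \<in> psi I Q E t ` carrier (Aut_I I E)"
  then obtain \<phi> where \<phi>: "\<phi> \<in> carrier (Aut_I I E)" and p: "p = psi I Q E t \<phi>" by blast
  have "p \<in> carrier (compatible_autos I Q \<alpha>)" unfolding p by (rule psi_compatible [OF t \<phi>])
  moreover have "ext_iso I (relabel_ext I p E) E \<phi>" unfolding p by (rule psi_spec(4) [OF t \<phi>])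
  ultimately show "p \<in> {p \<in> carrier (compatible_autos I Q \<alpha>). Wells I Q R p = \<one>\<^bsub>H2 B Q \<zeta>\<^esub>}"
    using Wells_trivial_iff by blast
next
  fix p assume "p \<in> {p \<in> carrier (compatible_autos I Q \<alpha>). Wells I Q R p = \<one>\<^bsub>H2 B Q \<zeta>\<^esub>}"
  then have p: "p \<in> carrier (compatible_autos I Q \<alpha>)" and W: "Wells I Q R p = \<one>\<^bsub>H2 B Q \<zeta>\<^esub>" by auto
  have p': "p \<in> mla_auto I \<times> mla_auto Q" using p by (simp only: compatible_iff)
  obtain f where f: "ext_iso I (relabel_ext I p E) E f"
    using W Wells_trivial_iff [OF p] by blast
  show "p \<in> psi I Q E t ` carrier (Aut_I I E)"
    using iso_relabel_aut [OF t p' f] by (metis imageI)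
qed

section \<open>The automorphisms given by derivations\<close>

lemma i_map_eq:
  assumes d: "d \<in> carrier (Der B Q \<zeta>)"
  shows "i_map I Q E l d = (\<lambda>u \<in> carrier A. \<iota> (d (\<pi> u)) \<otimes>\<^bsub>A\<^esub> u)"
  unfolding i_map_def
proof (rule restrict_ext)
  fix u assume u: "u \<in> carrier A"
  obtain a where a: "a \<in> carrier I" "u = \<iota> a \<otimes>\<^bsub>A\<^esub> l (\<pi> u)" using decompose [OF u] .
  have dec: "u = decode E l (a, \<pi> u)" using a(2) by (simp add: decode_def)
  have "inv_into (carrier I \<times> carrier Q) (decode E l) u = (a, \<pi> u)"
    by (subst dec) (rule bij_betw_inv_into_left [OF bij_decode], use a u in simp)
  moreover have "decode E l (a \<otimes>\<^bsub>I\<^esub> d (\<pi> u), \<pi> u) = \<iota> (d (\<pi> u)) \<otimes>\<^bsub>A\<^esub> (\<iota> a \<otimes>\<^bsub>A\<^esub> l (\<pi> u))"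
    using a(1) u DerD(2) [OF d, of "\<pi> u"] incl_Z_comm [of "d (\<pi> u)" a]
    by (simp add: decode_def flip: A.m_assoc)
  ultimately show "(let (a, x) = inv_into (carrier I \<times> carrier Q) (decode E l) u
      in decode E l (a \<otimes>\<^bsub>I\<^esub> d x, x)) = \<iota> (d (\<pi> u)) \<otimes>\<^bsub>A\<^esub> u"
    using a(2) by simp
qed

lemma i_map_aut:
  assumes d: "d \<in> carrier (Der B Q \<zeta>)"
  shows "i_map I Q E l d \<in> carrier (Aut_I I E)"
proof -
  note D = ext_isoD [OF Der_iso [OF d]]
  have "i_map I Q E l d \<in> mla_auto A"
    unfolding i_map_eq [OF d]
  proof (rule mla_autoI)
    show "bij_betw (\<lambda>u \<in> carrier A. \<iota> (d (\<pi> u)) \<otimes>\<^bsub>A\<^esub> u) (carrier A) (carrier A)" using D(1) by simp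
    fix u v assume uv: "u \<in> carrier A" "v \<in> carrier A"
    then show "(\<lambda>u \<in> carrier A. \<iota> (d (\<pi> u)) \<otimes>\<^bsub>A\<^esub> u) (u \<otimes>\<^bsub>A\<^esub> v) =
        (\<lambda>u \<in> carrier A. \<iota> (d (\<pi> u)) \<otimes>\<^bsub>A\<^esub> u) u \<otimes>\<^bsub>A\<^esub> (\<lambda>u \<in> carrier A. \<iota> (d (\<pi> u)) \<otimes>\<^bsub>A\<^esub> u) v \<and>
      (\<lambda>u \<in> carrier A. \<iota> (d (\<pi> u)) \<otimes>\<^bsub>A\<^esub> u) \<lbrace>u, v\<rbrace>\<^bsub>A\<^esub> =
        \<lbrace>(\<lambda>u \<in> carrier A. \<iota> (d (\<pi> u)) \<otimes>\<^bsub>A\<^esub> u) u, (\<lambda>u \<in> carrier A. \<iota> (d (\<pi> u)) \<otimes>\<^bsub>A\<^esub> u) v\<rbrace>\<^bsub>A\<^esub>"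
      using D(4) [OF uv] D(6) [OF uv] by (simp only: restrict_apply' A.m_closed A.lie_closed simp_thms)
  qed simp
  moreover have "i_map I Q E l d ` \<iota> ` carrier I = (\<lambda>u. u) ` \<iota> ` carrier I"
    unfolding i_map_eq [OF d] by (rule image_cong) (use Der_one [OF d] in auto)
  ultimately show ?thesis by (simp add: Aut_I_simps)
qed

lemma group_hom_i_map: "group_hom (Der B Q \<zeta>) (Aut_I I E) (i_map I Q E l)"
proof -
  have "i_map I Q E l (d \<otimes>\<^bsub>Der B Q \<zeta>\<^esub> d') = i_map I Q E l d \<otimes>\<^bsub>Aut_I I E\<^esub> i_map I Q E l d'"
    if d: "d \<in> carrier (Der B Q \<zeta>)" and d': "d' \<in> carrier (Der B Q \<zeta>)" for d d'
  proof -
    note [simp] = DerD(2) [OF d] DerD(2) [OF d']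
    have m: "i_map I Q E l d \<in> mla_auto A" "i_map I Q E l d' \<in> mla_auto A"
      using i_map_aut [OF d] i_map_aut [OF d'] by (simp_all add: Aut_I_simps)
    have dd': "d \<otimes>\<^bsub>Der B Q \<zeta>\<^esub> d' \<in> carrier (Der B Q \<zeta>)"
      by (rule monoid.m_closed [OF group.is_monoid [OF group_Der] d d'])
    show ?thesis
      unfolding Aut_I_simps(2) [OF m] unfolding i_map_eq [OF dd'] i_map_eq [OF d] i_map_eq [OF d']
      by (simp add: Der_simps(1) compose_def A.m_assoc cong: restrict_cong)
  qed
  then show ?thesis
    using group_Der group_Aut_I i_map_aut
    by (simp add: group_hom_def group_hom_axioms_def hom_def Pi_iff)
qed

lemma inj_i_map: "inj_on (i_map I Q E l) (carrier (Der B Q \<zeta>))"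
proof (rule inj_onI)
  fix d d' assume d: "d \<in> carrier (Der B Q \<zeta>)" and d': "d' \<in> carrier (Der B Q \<zeta>)"
    and eq: "i_map I Q E l d = i_map I Q E l d'"
  show "d = d'"
  proof (rule extensionalityI [OF DerD(1) [OF d] DerD(1) [OF d']])
    fix x assume x: "x \<in> carrier Q"
    have "\<iota> (d x) \<otimes>\<^bsub>A\<^esub> l x = \<iota> (d' x) \<otimes>\<^bsub>A\<^esub> l x"
      using fun_cong [OF eq, of "l x"] x by (simp add: i_map_eq d d')
    then show "d x = d' x" using x DerD(2) [OF d x] DerD(2) [OF d' x] by simp
  qed
qed

lemma image_i_map:
  assumes t: "is_section Q E t"
  shows "i_map I Q E l ` carrier (Der B Q \<zeta>) =
    kernel (Aut_I I E) (compatible_autos I Q \<alpha>) (psi I Q E t)"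
proof -
  interpret T: ext_section I Q E t by unfold_locales (rule t)
  have one: "\<one>\<^bsub>compatible_autos I Q \<alpha>\<^esub> = (\<lambda>a \<in> carrier I. a, \<lambda>x \<in> carrier Q. x)"
    by (simp add: compatible_autos_def mla_AutoGroup_simps)
  show ?thesis
  proof (intro equalityI subsetI)
    fix \<phi> assume "\<phi> \<in> i_map I Q E l ` carrier (Der B Q \<zeta>)"
    then obtain d where d: "d \<in> carrier (Der B Q \<zeta>)" and \<phi>: "\<phi> = i_map I Q E l d" by blast
    note [simp] = DerD(2) [OF d]
    have "psi I Q E t \<phi> = \<one>\<^bsub>compatible_autos I Q \<alpha>\<^esub>"
      unfolding one psi_def \<phi> i_map_eq [OF d] by (simp add: Der_one [OF d] cong: restrict_cong)
    then show "\<phi> \<in> kernel (Aut_I I E) (compatible_autos I Q \<alpha>) (psi I Q E t)"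
      using i_map_aut [OF d] by (simp add: kernel_def \<phi>)
  next
    fix \<phi> assume "\<phi> \<in> kernel (Aut_I I E) (compatible_autos I Q \<alpha>) (psi I Q E t)"
    then have \<phi>: "\<phi> \<in> carrier (Aut_I I E)" and psi: "psi I Q E t \<phi> = \<one>\<^bsub>compatible_autos I Q \<alpha>\<^esub>"
      by (auto simp: kernel_def)
    have m: "\<phi> \<in> mla_auto A" using \<phi> by (simp add: Aut_I_simps)
    have "ext_iso I E E \<phi>"
      unfolding ext_iso_def
      using mla_autoD(3-6) [OF m] psi_spec(2) [OF t \<phi>, of "\<one>\<^bsub>I\<^esub>"] psi_spec(2,3) [OF t \<phi>]
      by (simp add: psi one A.lie_closed)
    then obtain d where d: "d \<in> carrier (Der B Q \<zeta>)"
      and \<phi>d: "\<And>u. u \<in> carrier A \<Longrightarrow> \<phi> u = \<iota> (d (\<pi> u)) \<otimes>\<^bsub>A\<^esub> u"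
      by (rule iso_Der) (rule that; simp)
    have "\<phi> = i_map I Q E l d"
      unfolding i_map_eq [OF d]
      by (rule extensionalityI [OF mla_autoD(2) [OF m] restrict_extensional]) (simp add: \<phi>d)
    then show "\<phi> \<in> i_map I Q E l ` carrier (Der B Q \<zeta>)" using d by (rule image_eqI)
  qed
qed

end

theorem theorem4p1:
  fixes I :: "'i mla" and Q :: "'q mla" and E :: "('i, 'a, 'q) mla_ext"
    and \<chi> :: "('i, 'q) act_terms" and T :: "('i, 'q) cocycle" and l t :: "'q \<Rightarrow> 'a"
  assumes "extension I Q E"
    and "realizes I Q E \<chi>"
    and "is_section Q E l" and "section_action I Q E l = \<chi>"
    and "T = section_cocycle I Q E l"
    and "is_section Q E t"
  shows "let B = alg_center I;
             \<chi>\<^sub>\<zeta> = act_restrict B Q \<chi>;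
             D = Der B Q \<chi>\<^sub>\<zeta>;
             A = Aut_I I E;
             C = compatible_autos I Q \<chi>;
             H = H2 B Q \<chi>\<^sub>\<zeta>;
             i = i_map I Q E l;
             \<psi> = psi I Q E t;
             W = Wells I Q T
         in group_hom D A i \<and> group_hom A C \<psi> \<and>
            group H \<and> W \<in> carrier C \<rightarrow> carrier H \<and>
            inj_on i (carrier D) \<and>
            i ` carrier D = kernel A C \<psi> \<and>
            \<psi> ` carrier A = {p \<in> carrier C. W p = \<one>\<^bsub>H\<^esub>}"
proof -
  interpret ext_section I Q E l by (rule ext_sectionI) fact+
  note t = \<open>is_section Q E t\<close>
  have \<chi>: "\<chi> = \<alpha>" and T: "T = R" using assms by simp_all
  show ?thesis
    unfolding Let_def \<chi> T
    using group_hom_i_map group_hom_psi [OF t] group_H2 Wells_closed inj_i_map image_i_map [OF t]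
      image_psi [OF t]
    by (intro conjI funcsetI)
qed

end
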